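(* The property $\mathcal{D}^{\rm iso}=\bigcup_{x^*\in\{0,1\}^n}\mathcal{D}^{\rm iso}(x^* )$ can be tested in the DoHO model using $O(1/\epsilon)$ samples and $\mathrm{poly}(1/\epsilon)\cdot\widetilde{O}(n^{5/8})$ queries.
   Context: Each $n$-bit string $x$ is viewed as the adjacency matrix of a graph $G_x$ on $\sqrt{n}$ vertices. For $x^*\in\{0,1\}^n$, $\mathcal{D}^{\rm iso}(x^* )$ is the set of all distributions $X$ over $\{0,1\}^n$ such that every string in the support of $X$ describes a graph isomorphic to $G_{x^*}$. For $x,y\in\{0,1\}^n$ let $\Delta_H(x,y)=\frac1n|\{i:x_i\neq y_i\}|$. The distance between distributions $P,Q$ over $\{0,1\}^n$ is $\min\sum_{x,y}w_{x,y}\Delta_H(x,y)$ over nonnegative $w_{x,y}$ with $\sum_y w_{x,y}=P(x)$, $\sum_x w_{x,y}=Q(y)$; $\epsilon$-far from a set means distance greater than $\epsilon$ to every member. A tester in the DoHO model for a set $\mathcal{E}$ of distributions over $\{0,1\}^n$ gets $n,\epsilon$ and oracle access to independent samples of an unknown distribution $P$, may query individual bits of samples, and must accept with probability at least $2/3$ if $P\in\mathcal{E}$ and reject with probability at least $2/3$ if $P$ is $\epsilon$-far from $\mathcal{E}$; its query complexity is the total number of bit queries. *)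

theory Defs
  imports
    "HOL-Probability.Probability"
    "HOL-Library.Landau_Symbols"
    "HOL-Computational_Algebra.Polynomial"
    "Graph_Theory.Graph_Theory"
begin

definition bitstrings :: "nat \<Rightarrow> bool list set" where
  "bitstrings n = {x. length x = n}"

definition distributions :: "nat \<Rightarrow> bool list pmf set" where
  "distributions n = {P. set_pmf P \<subseteq> bitstrings n}"

definition rel_hamming :: "nat \<Rightarrow> bool list \<Rightarrow> bool list \<Rightarrow> real" where
  "rel_hamming n x y = real (card {i. i < n \<and> x ! i \<noteq> y ! i}) / real n"

definition couplings ::
    "nat \<Rightarrow> bool list pmf \<Rightarrow> bool list pmf \<Rightarrow> (bool list \<Rightarrow> bool list \<Rightarrow> real) set" where
  "couplings n P Q = {w.
     (\<forall>x \<in> bitstrings n. \<forall>y \<in> bitstrings n. w x y \<ge> 0) \<and>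
     (\<forall>x \<in> bitstrings n. (\<Sum>y \<in> bitstrings n. w x y) = pmf P x) \<and>
     (\<forall>y \<in> bitstrings n. (\<Sum>x \<in> bitstrings n. w x y) = pmf Q y)}"

(* For distributions over bit strings of length n the couplings form a nonempty compact
   polytope, so the infimum is attained: it is the minimum. *)
definition dist_distance :: "nat \<Rightarrow> bool list pmf \<Rightarrow> bool list pmf \<Rightarrow> real" where
  "dist_distance n P Q =
     (INF w \<in> couplings n P Q.
        \<Sum>x \<in> bitstrings n. \<Sum>y \<in> bitstrings n. w x y * rel_hamming n x y)"

definition far_from :: "nat \<Rightarrow> real \<Rightarrow> bool list pmf \<Rightarrow> bool list pmf set \<Rightarrow> bool" where
  "far_from n \<epsilon> P E \<longleftrightarrow> (\<forall>Q \<in> E. dist_distance n P Q > \<epsilon>)"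

(* A deterministic adaptive query algorithm. "Query i j t0 t1" asks for bit j of the i-th
   sample and continues with t0 or t1 if the answer is 0 or 1; "Verdict True" accepts. *)
datatype query_tree = Verdict bool | Query nat nat query_tree query_tree

primrec accepts :: "query_tree \<Rightarrow> (nat \<Rightarrow> bool list) \<Rightarrow> bool" where
  "accepts (Verdict b) X = b"
| "accepts (Query i j t0 t1) X = (if X i ! j then accepts t1 X else accepts t0 X)"

primrec num_queries :: "query_tree \<Rightarrow> nat" where
  "num_queries (Verdict b) = 0"
| "num_queries (Query i j t0 t1) = Suc (max (num_queries t0) (num_queries t1))"

primrec legal_queries :: "nat \<Rightarrow> nat \<Rightarrow> query_tree \<Rightarrow> bool" where
  "legal_queries s n (Verdict b) \<longleftrightarrow> True"
| "legal_queries s n (Query i j t0 t1) \<longleftrightarrow>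
     i < s \<and> j < n \<and> legal_queries s n t0 \<and> legal_queries s n t1"

(* A randomized algorithm is a distribution over deterministic ones: its coins are tossed
   in advance, independently of the s samples, which are drawn independently from P. *)
definition execution ::
    "query_tree pmf \<Rightarrow> nat \<Rightarrow> bool list pmf \<Rightarrow> (query_tree \<times> (nat \<Rightarrow> bool list)) pmf" where
  "execution T s P = pair_pmf T (Pi_pmf {..<s} [] (\<lambda>_. P))"

(* T is a tester for E at length n and proximity parameter \<epsilon> that uses s samples and
   makes at most q bit queries in total, whatever its coins and the answers are. *)
definition doho_tester ::
    "nat \<Rightarrow> real \<Rightarrow> bool list pmf set \<Rightarrow> nat \<Rightarrow> nat \<Rightarrow> query_tree pmf \<Rightarrow> bool" where
  "doho_tester n \<epsilon> E s q T \<longleftrightarrow>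
     (\<forall>t \<in> set_pmf T. legal_queries s n t \<and> num_queries t \<le> q) \<and>
     (\<forall>P \<in> distributions n.
        (P \<in> E \<longrightarrow>
           measure_pmf.prob (execution T s P) {(t, X). accepts t X} \<ge> 2 / 3) \<and>
        (far_from n \<epsilon> P E \<longrightarrow>
           measure_pmf.prob (execution T s P) {(t, X). \<not> accepts t X} \<ge> 2 / 3))"

(* The graph on m vertices whose adjacency matrix is x, read row by row. Every string of
   length m^2 describes a graph: the matrix need be neither symmetric nor zero on the
   diagonal. *)
definition graph_of :: "nat \<Rightarrow> bool list \<Rightarrow> nat pair_pre_digraph" where
  "graph_of m x = \<lparr> pverts = {..<m}, parcs = {(u, v). u < m \<and> v < m \<and> x ! (u * m + v)} \<rparr>"

definition D_iso_of :: "nat \<Rightarrow> bool list \<Rightarrow> bool list pmf set" where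
  "D_iso_of m x = {P \<in> distributions (m\<^sup>2).
     \<forall>y \<in> set_pmf P. digraph_iso (with_proj (graph_of m y)) (with_proj (graph_of m x))}"

definition D_iso :: "nat \<Rightarrow> bool list pmf set" where
  "D_iso m = (\<Union>x \<in> bitstrings (m\<^sup>2). D_iso_of m x)"

definition soft_bigo :: "(nat \<Rightarrow> real) \<Rightarrow> (nat \<Rightarrow> real) set" where
  "soft_bigo f = {g. \<exists>k::nat. g \<in> O(\<lambda>n. f n * ln (f n) ^ k)}"

end

(* Two graphs G and H on m vertices are compared as follows.  Small random vertex sets of
   sizes about m^(1/4) in G and m^(3/4) in H contain, by the birthday paradox, a list of pairs
   (x, \<sigma> x) for any fixed isomorphism \<sigma>, and a logarithmic number of such pairs (a core)
   suffices to separate all vertices of G whose neighbourhoods differ much.  Labelling every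
   vertex by its adjacencies to the core, one checks for each candidate core that the
   distributions of labels agree, by a collision statistic weighted with the known class sizes
   of G, and that random label-matched pairs of vertices carry the same edges, by a weighted
   count over the collisions between samples of size about m^(1/2).  If both hold, a random
   label-preserving bijection is nearly an isomorphism.  All queries together number about
   m^(5/4) = n^(5/8).  Candidates are accepted when few of many independent blocks reject, so
   that soundness survives the union bound over all candidates while completeness only needs
   one good candidate.  Finally, a distribution that is far from D_iso yields, among O(1/\<epsilon>)
   samples, one that is far from every relabelling of the first sample. *)
theory Submission
  imports Defs "HOL-Combinatorics.Permutations"
begin

section \<open>Finite expectations and independent samples\<close>

text \<open>The unequal sample sizes come from the query count. The weights need the exact class
  sizes of G, so every vertex of G is labelled, at cost m^(1/4) * m. In H only the sampled vertices
  are labelled, at cost m^(3/4) * m^(1/2). Both are m^(5/4), and the product m^(1/4) * m^(3/4) = m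
  is what the birthday paradox asks for. The obstacle is the number of candidate cores, about m^(2c)
  for cores of length c, while one block errs with a probability that does not shrink with m. Hence
  the lopsided amplification: \<open>k\<close> rejections out of \<open>8 * k\<close> blocks are
  tolerated. A false candidate, rejected by each block with probability at least 1/2, passes with
  probability at most \<open>1 / 4 ^ k\<close>. The one true core is treated by Markov's inequality,
  so its rejection probability per block must be small but may be independent of \<open>k\<close>.
  All concentration comes from second moments. Enlarging the samples by factors \<open>R\<close> and
  \<open>R'\<close> polynomial in 1/\<epsilon> makes variances small against the relevant squared
  scale.\<close>

abbreviation mean :: "'a pmf \<Rightarrow> ('a \<Rightarrow> real) \<Rightarrow> real" where
  "mean p f \<equiv> measure_pmf.expectation p f"

abbreviation prb :: "'a pmf \<Rightarrow> ('a \<Rightarrow> bool) \<Rightarrow> real" where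
  "prb p Q \<equiv> measure_pmf.prob p {x. Q x}"

lemma mean_mono:
  assumes "finite (set_pmf p)" "\<And>x. x \<in> set_pmf p \<Longrightarrow> f x \<le> g x"
  shows "mean p f \<le> mean p g"
  using assms by (intro integral_mono_AE) (auto intro: integrable_measure_pmf_finite simp: AE_measure_pmf_iff)

lemma mean_cong:
  assumes "\<And>x. x \<in> set_pmf p \<Longrightarrow> f x = g x"
  shows "mean p f = mean p g"
  using assms by (intro integral_cong_AE) (auto simp: AE_measure_pmf_iff)

lemma mean_nonneg:
  assumes "\<And>x. x \<in> set_pmf p \<Longrightarrow> 0 \<le> f x"
  shows "0 \<le> mean p f"
  using assms by (intro integral_nonneg_AE) (auto simp: AE_measure_pmf_iff)

lemma mean_add: "finite (set_pmf p) \<Longrightarrow> mean p (\<lambda>x. f x + g x) = mean p f + mean p g"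
  by (intro Bochner_Integration.integral_add integrable_measure_pmf_finite)

lemma mean_diff: "finite (set_pmf p) \<Longrightarrow> mean p (\<lambda>x. f x - g x) = mean p f - mean p g"
  by (intro Bochner_Integration.integral_diff integrable_measure_pmf_finite)

lemma mean_le_const:
  assumes "finite (set_pmf p)" "\<And>x. x \<in> set_pmf p \<Longrightarrow> f x \<le> c"
  shows "mean p f \<le> c"
  using mean_mono[OF assms(1), of f "\<lambda>_. c"] assms(2) by simp

lemma mean_bind:
  assumes "finite (set_pmf p)" "\<And>x. x \<in> set_pmf p \<Longrightarrow> finite (set_pmf (f x))"
  shows "mean (bind_pmf p f) h = mean p (\<lambda>x. mean (f x) h)"
proof -
  have "mean (bind_pmf p f) h = (\<Sum>a\<in>set_pmf p. pmf p a *\<^sub>R mean (f a) h)"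
    by (rule pmf_expectation_bind) (use assms in auto)
  also have "\<dots> = mean p (\<lambda>x. mean (f x) h)"
    by (subst integral_measure_pmf[of "set_pmf p"]) (use assms in auto)
  finally show ?thesis .
qed

lemma mean_pair:
  assumes "finite (set_pmf p)" "finite (set_pmf q)"
  shows "mean (pair_pmf p q) h = mean p (\<lambda>x. mean q (\<lambda>y. h (x, y)))"
  using assms by (simp add: pair_pmf_def mean_bind)

lemma mean_swap:
  assumes "finite (set_pmf p)" "finite (set_pmf q)"
  shows "mean p (\<lambda>x. mean q (\<lambda>y. h x y)) = mean q (\<lambda>y. mean p (\<lambda>x. h x y))"
proof -
  have "mean p (\<lambda>x. mean q (\<lambda>y. h x y)) = mean (pair_pmf p q) (\<lambda>(x, y). h x y)"
    using assms by (simp add: mean_pair)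
  also have "\<dots> = mean (pair_pmf q p) (\<lambda>(y, x). h x y)"
    by (subst pair_commute_pmf) (simp add: case_prod_unfold)
  finally show ?thesis using assms by (simp add: mean_pair)
qed

lemma prb_eq_mean: "prb p Q = mean p (\<lambda>x. of_bool (Q x))"
proof -
  have "mean p (\<lambda>x. of_bool (Q x)) = mean p (indicator {x. Q x})"
    by (intro Bochner_Integration.integral_cong) (auto simp: indicator_def)
  then show ?thesis by simp
qed

lemma prb_pair:
  assumes "finite (set_pmf p)" "finite (set_pmf q)"
  shows "prb (pair_pmf p q) Q = mean p (\<lambda>x. prb q (\<lambda>y. Q (x, y)))"
  using assms by (simp add: prb_eq_mean mean_pair)

lemma prb_mono:
  assumes "\<And>x. x \<in> set_pmf p \<Longrightarrow> Q x \<Longrightarrow> R x"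
  shows "prb p Q \<le> prb p R"
  by (intro measure_pmf.finite_measure_mono_AE) (use assms in \<open>auto simp: AE_measure_pmf_iff\<close>)

lemma prb_disj: "prb p (\<lambda>x. Q x \<or> R x) \<le> prb p Q + prb p R"
  using measure_Un_le[of "{x. Q x}" p "{x. R x}"] by (simp add: Collect_disj_eq)

lemma prb_not: "prb p (\<lambda>x. \<not> Q x) = 1 - prb p Q"
  using measure_pmf.prob_compl[of "{x. Q x}" p] by (simp add: Compl_eq_Diff_UNIV[symmetric] Collect_neg_eq)

lemma prb_Bex_le:
  assumes "finite I" "\<And>i. i \<in> I \<Longrightarrow> prb p (Q i) \<le> b"
  shows "prb p (\<lambda>x. \<exists>i\<in>I. Q i x) \<le> real (card I) * b"
proof -
  have "{x. \<exists>i\<in>I. Q i x} = (\<Union>i\<in>I. {x. Q i x})" by auto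
  then have "prb p (\<lambda>x. \<exists>i\<in>I. Q i x) \<le> (\<Sum>i\<in>I. prb p (Q i))"
    using measure_pmf.finite_measure_subadditive_finite[OF assms(1), of "\<lambda>i. {x. Q i x}" p] by simp
  also have "\<dots> \<le> (\<Sum>i\<in>I. b)" by (intro sum_mono assms)
  finally show ?thesis by simp
qed

lemma prb_markov:
  assumes "finite (set_pmf p)" "\<And>x. x \<in> set_pmf p \<Longrightarrow> 0 \<le> f x" "t > 0"
  shows "prb p (\<lambda>x. t \<le> f x) \<le> mean p f / t"
proof -
  have "mean p (\<lambda>x. t * of_bool (t \<le> f x)) \<le> mean p f"
    by (intro mean_mono) (use assms in auto)
  then show ?thesis using assms(3) by (simp add: prb_eq_mean field_simps)
qed

text \<open>Phrased through a bound on the second moment, the form in which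
  \<open>mean_bipartite_sq\<close> delivers it.\<close>

lemma prb_chebyshev:
  assumes fin: "finite (set_pmf p)" and d: "d > 0"
    and \<mu>: "mean p f = \<mu>" and v: "mean p (\<lambda>x. (f x)\<^sup>2) \<le> v + \<mu>\<^sup>2"
  shows "prb p (\<lambda>x. d \<le> \<bar>f x - \<mu>\<bar>) \<le> v / d\<^sup>2"
proof -
  have "prb p (\<lambda>x. d \<le> \<bar>f x - \<mu>\<bar>) \<le> prb p (\<lambda>x. d\<^sup>2 \<le> (f x - \<mu>)\<^sup>2)"
    by (intro prb_mono) (use d in \<open>metis abs_of_pos abs_le_square_iff\<close>)
  also have "\<dots> \<le> mean p (\<lambda>x. (f x - \<mu>)\<^sup>2) / d\<^sup>2"
    by (intro prb_markov) (use fin d in auto)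
  also have "mean p (\<lambda>x. (f x - \<mu>)\<^sup>2) = mean p (\<lambda>x. ((f x)\<^sup>2 - 2 * \<mu> * f x) + \<mu>\<^sup>2)"
    by (simp add: power2_diff algebra_simps)
  also have "\<dots> = mean p (\<lambda>x. (f x)\<^sup>2) - 2 * \<mu> * \<mu> + \<mu>\<^sup>2"
    using fin by (simp add: mean_add mean_diff \<mu>)
  also have "\<dots> \<le> v" using v by (simp add: power2_eq_square)
  finally show ?thesis using d by (simp add: divide_right_mono)
qed

text \<open>For two-stage experiments: the second stage has to be controlled only after a good first
  stage.\<close>

lemma prb_pair_le:
  assumes fin: "finite (set_pmf p)" "finite (set_pmf q)"
    and bad: "prb p (\<lambda>x. \<not> Good x) \<le> \<alpha>"
    and good: "\<And>x. x \<in> set_pmf p \<Longrightarrow> Good x \<Longrightarrow> prb q (\<lambda>y. Q (x, y)) \<le> \<beta>" and \<beta>: "\<beta> \<ge> 0"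
  shows "prb (pair_pmf p q) Q \<le> \<alpha> + \<beta>"
proof -
  have "prb (pair_pmf p q) Q \<le> mean p (\<lambda>x. of_bool (\<not> Good x) + \<beta>)"
    unfolding prb_pair[OF fin] using good \<beta>
    by (intro mean_mono fin) (auto intro: add_increasing2 order.trans)
  also have "\<dots> \<le> \<alpha> + \<beta>" using fin bad by (simp add: mean_add prb_eq_mean)
  finally show ?thesis .
qed

section \<open>Independent repetitions: moments and tails\<close>

lemma finite_set_replicate_pmf [simp]: "finite (set_pmf p) \<Longrightarrow> finite (set_pmf (replicate_pmf n p))"
proof -
  assume "finite (set_pmf p)"
  then have "finite {xs. set xs \<subseteq> set_pmf p \<and> length xs = n}" by (rule finite_lists_length_eq)
  then show ?thesis unfolding set_replicate_pmf by (rule rev_finite_subset) (auto simp: lists_eq_set)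
qed

lemma mean_replicate_Suc:
  assumes "finite (set_pmf p)"
  shows "mean (replicate_pmf (Suc n) p) h = mean p (\<lambda>x. mean (replicate_pmf n p) (\<lambda>xs. h (x # xs)))"
  using assms by (simp add: mean_bind)

lemma mean_replicate_sum_list:
  assumes "finite (set_pmf p)"
  shows "mean (replicate_pmf n p) (\<lambda>xs. \<Sum>x\<leftarrow>xs. f x) = n * mean p f"
proof (induction n)
  case (Suc n)
  then show ?case
    using assms unfolding mean_replicate_Suc[OF assms] by (simp add: mean_add algebra_simps)
qed simp

lemma mean_replicate_sum_list_sq:
  assumes "finite (set_pmf p)"
  shows "mean (replicate_pmf n p) (\<lambda>xs. (\<Sum>x\<leftarrow>xs. f x)\<^sup>2) =
    n * (mean p (\<lambda>x. (f x)\<^sup>2) - (mean p f)\<^sup>2) + (n * mean p f)\<^sup>2"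
proof (induction n)
  case (Suc n)
  have "mean (replicate_pmf (Suc n) p) (\<lambda>xs. (\<Sum>x\<leftarrow>xs. f x)\<^sup>2) =
    mean p (\<lambda>x. mean (replicate_pmf n p) (\<lambda>xs. ((f x)\<^sup>2 + 2 * f x * (\<Sum>x\<leftarrow>xs. f x)) + (\<Sum>x\<leftarrow>xs. f x)\<^sup>2))"
    unfolding mean_replicate_Suc[OF assms] by (simp add: power2_sum algebra_simps)
  also have "\<dots> = mean p (\<lambda>x. ((f x)\<^sup>2 + 2 * (n * mean p f) * f x) + (n * (mean p (\<lambda>x. (f x)\<^sup>2) - (mean p f)\<^sup>2) + (n * mean p f)\<^sup>2))"
    using assms by (simp add: mean_add Suc mean_replicate_sum_list mult_ac)
  also have "\<dots> = mean p (\<lambda>x. (f x)\<^sup>2) + 2 * (n * mean p f) * mean p f + (n * (mean p (\<lambda>x. (f x)\<^sup>2) - (mean p f)\<^sup>2) + (n * mean p f)\<^sup>2)"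
    using assms by (simp add: mean_add)
  finally show ?case by (simp add: algebra_simps power2_eq_square)
qed simp

lemma mean_replicate_prod_list:
  assumes "finite (set_pmf p)"
  shows "mean (replicate_pmf n p) (\<lambda>xs. \<Prod>x\<leftarrow>xs. f x) = mean p f ^ n"
proof (induction n)
  case (Suc n)
  then show ?case unfolding mean_replicate_Suc[OF assms] by simp
qed simp

lemma prb_replicate_all:
  assumes "finite (set_pmf p)"
  shows "prb (replicate_pmf n p) (\<lambda>xs. \<forall>x\<in>set xs. Q x) = prb p Q ^ n"
proof -
  have "(\<Prod>x\<leftarrow>xs. of_bool (Q x) :: real) = of_bool (\<forall>x\<in>set xs. Q x)" for xs
    by (induction xs) (simp_all add: of_bool_conj)
  then show ?thesis by (simp add: prb_eq_mean flip: mean_replicate_prod_list[OF assms])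
qed

lemma length_filter_eq_sum_list: "real (length (filter Q xs)) = (\<Sum>x\<leftarrow>xs. of_bool (Q x))"
  by (induction xs) auto

text \<open>Markov's inequality for the number of successes; enough for the single correct core,
  where no exponentially small bound is called for.\<close>

lemma prb_replicate_many:
  assumes "finite (set_pmf p)" "k > 0"
  shows "prb (replicate_pmf n p) (\<lambda>xs. length (filter Q xs) > k) \<le> n * prb p Q / k"
proof -
  have "prb (replicate_pmf n p) (\<lambda>xs. length (filter Q xs) > k) \<le>
      prb (replicate_pmf n p) (\<lambda>xs. real k \<le> (\<Sum>x\<leftarrow>xs. of_bool (Q x)))"
    by (intro prb_mono) (simp flip: length_filter_eq_sum_list)
  also have "\<dots> \<le> mean (replicate_pmf n p) (\<lambda>xs. \<Sum>x\<leftarrow>xs. of_bool (Q x)) / k"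
    by (intro prb_markov) (use assms in \<open>auto simp flip: length_filter_eq_sum_list\<close>)
  also have "\<dots> = n * prb p Q / k"
    by (simp add: mean_replicate_sum_list assms prb_eq_mean)
  finally show ?thesis .
qed

text \<open>Exponential moment with base 1/2: a trial has mean weight at most 3/4, and Markov at
  level \<open>(1 / 2) ^ k\<close> leaves \<open>(2 * (3 / 4) ^ 8) ^ k\<close>. Eight is the least
  multiple of \<open>k\<close> for which this argument gives base 1/4.\<close>

lemma prb_replicate_few:
  assumes fin: "finite (set_pmf p)" and Q: "prb p Q \<ge> 1 / 2"
  shows "prb (replicate_pmf (8 * k) p) (\<lambda>xs. length (filter Q xs) \<le> k) \<le> 1 / 4 ^ k"
proof -
  let ?h = "\<lambda>x. if Q x then 1 / 2 else 1 :: real"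
  have h: "(\<Prod>x\<leftarrow>xs. ?h x) = (1 / 2) ^ length (filter Q xs)" for xs
    by (induction xs) auto
  have "mean p ?h = mean p (\<lambda>x. 1 - of_bool (Q x) / 2)" by (intro mean_cong) auto
  also have "\<dots> = 1 - prb p Q / 2" using fin by (simp add: mean_diff prb_eq_mean)
  finally have m: "mean p ?h \<le> 3 / 4" using Q by simp
  have m0: "mean p ?h \<ge> 0" by (intro mean_nonneg) auto
  have "prb (replicate_pmf (8 * k) p) (\<lambda>xs. length (filter Q xs) \<le> k) \<le>
    prb (replicate_pmf (8 * k) p) (\<lambda>xs. (1 / 2) ^ k \<le> (\<Prod>x\<leftarrow>xs. ?h x))"
    unfolding h by (intro prb_mono power_decreasing) auto
  also have "\<dots> \<le> mean (replicate_pmf (8 * k) p) (\<lambda>xs. \<Prod>x\<leftarrow>xs. ?h x) / (1 / 2) ^ k"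
    by (intro prb_markov) (use fin h in auto)
  also have "\<dots> = (2 * mean p ?h ^ 8) ^ k"
    by (simp add: mean_replicate_prod_list fin power_mult power_mult_distrib power_divide)
  also have "\<dots> \<le> (2 * (3 / 4) ^ 8) ^ k"
    using m m0 by (intro power_mono mult_left_mono) auto
  also have "\<dots> \<le> (1 / 4) ^ k" by (intro power_mono) (auto simp: power_divide)
  finally show ?thesis by (simp add: power_divide)
qed

section \<open>Bilinear statistics of two independent samples\<close>

lemma mean_bipartite:
  assumes "finite (set_pmf p)" "finite (set_pmf q)"
  shows "mean (pair_pmf (replicate_pmf r p) (replicate_pmf r' q)) (\<lambda>(xs, ys). \<Sum>x\<leftarrow>xs. \<Sum>y\<leftarrow>ys. k x y) =
    real r * real r' * mean p (\<lambda>x. mean q (k x))"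
proof -
  have *: "mean (replicate_pmf r' q) (\<lambda>ys. \<Sum>x\<leftarrow>xs. \<Sum>y\<leftarrow>ys. k x y) = (\<Sum>x\<leftarrow>xs. r' * mean q (k x))" for xs
    using assms by (induction xs) (simp_all add: mean_add mean_replicate_sum_list)
  show ?thesis using assms by (simp add: mean_pair * mean_replicate_sum_list)
qed

text \<open>Two index pairs share both members, only the second, only the first, or none; these
  cases account for the four terms. The square is expanded over \<open>ys\<close> with
  \<open>xs\<close> fixed, and then over \<open>xs\<close>.\<close>

lemma mean_bipartite_sq:
  assumes fin: "finite (set_pmf p)" "finite (set_pmf q)"
  shows "mean (pair_pmf (replicate_pmf r p) (replicate_pmf r' q)) (\<lambda>(xs, ys). (\<Sum>x\<leftarrow>xs. \<Sum>y\<leftarrow>ys. k x y)\<^sup>2) \<le>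
    real r * real r' * mean p (\<lambda>x. mean q (\<lambda>y. (k x y)\<^sup>2))
    + (real r)\<^sup>2 * real r' * mean q (\<lambda>y. (mean p (\<lambda>x. k x y))\<^sup>2)
    + real r * (real r')\<^sup>2 * mean p (\<lambda>x. (mean q (k x))\<^sup>2)
    + (real r * real r' * mean p (\<lambda>x. mean q (k x)))\<^sup>2"
proof -
  have iid: "mean (replicate_pmf n u) (\<lambda>xs. (\<Sum>x\<leftarrow>xs. f x)\<^sup>2) \<le> n * mean u (\<lambda>x. (f x)\<^sup>2) + (n * mean u f)\<^sup>2"
    if "finite (set_pmf u)" for n :: nat and u :: "'x pmf" and f
    by (simp add: mean_replicate_sum_list_sq[OF that] algebra_simps)
  have lin: "mean q (\<lambda>y. \<Sum>x\<leftarrow>xs. k x y) = (\<Sum>x\<leftarrow>xs. mean q (k x))" for xs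
    using fin by (induction xs) (simp_all add: mean_add)
  have swap: "(\<Sum>x\<leftarrow>xs. \<Sum>y\<leftarrow>ys. k x y) = (\<Sum>y\<leftarrow>ys. \<Sum>x\<leftarrow>xs. k x y)" for xs ys
    by (induction xs) (simp_all add: sum_list_addf)
  let ?P = "replicate_pmf r p"
  have "mean (pair_pmf ?P (replicate_pmf r' q)) (\<lambda>(xs, ys). (\<Sum>x\<leftarrow>xs. \<Sum>y\<leftarrow>ys. k x y)\<^sup>2)
    = mean ?P (\<lambda>xs. mean (replicate_pmf r' q) (\<lambda>ys. (\<Sum>y\<leftarrow>ys. \<Sum>x\<leftarrow>xs. k x y)\<^sup>2))"
    using fin by (simp add: mean_pair swap)
  also have "\<dots> \<le> mean ?P (\<lambda>xs. r' * mean q (\<lambda>y. (\<Sum>x\<leftarrow>xs. k x y)\<^sup>2) + (real r')\<^sup>2 * (\<Sum>x\<leftarrow>xs. mean q (k x))\<^sup>2)"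
    using fin by (intro mean_mono) (auto intro!: order.trans[OF iid] simp: lin power_mult_distrib)
  also have "\<dots> = r' * mean q (\<lambda>y. mean ?P (\<lambda>xs. (\<Sum>x\<leftarrow>xs. k x y)\<^sup>2)) + (real r')\<^sup>2 * mean ?P (\<lambda>xs. (\<Sum>x\<leftarrow>xs. mean q (k x))\<^sup>2)"
    using fin by (simp add: mean_add mean_swap[of ?P q])
  also have "\<dots> \<le> r' * mean q (\<lambda>y. r * mean p (\<lambda>x. (k x y)\<^sup>2) + (real r)\<^sup>2 * (mean p (\<lambda>x. k x y))\<^sup>2)
      + (real r')\<^sup>2 * (r * mean p (\<lambda>x. (mean q (k x))\<^sup>2) + (real r * mean p (\<lambda>x. mean q (k x)))\<^sup>2)"
    using fin by (intro add_mono mult_left_mono mean_mono order.trans[OF iid]) (auto simp: power_mult_distrib)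
  also have "\<dots> = real r * real r' * mean p (\<lambda>x. mean q (\<lambda>y. (k x y)\<^sup>2))
    + (real r)\<^sup>2 * real r' * mean q (\<lambda>y. (mean p (\<lambda>x. k x y))\<^sup>2)
    + real r * (real r')\<^sup>2 * mean p (\<lambda>x. (mean q (k x))\<^sup>2)
    + (real r * real r' * mean p (\<lambda>x. mean q (k x)))\<^sup>2"
    using fin by (simp add: mean_add mean_swap[of p q] power_mult_distrib algebra_simps)
  finally show ?thesis .
qed

lemma mean_unif: "m > 0 \<Longrightarrow> mean (pmf_of_set {..<m::nat}) f = (\<Sum>x<m. f x) / m"
  by (subst integral_pmf_of_set) auto

section \<open>Label classes and the collision statistic\<close>

definition cls :: "nat \<Rightarrow> (nat \<Rightarrow> 'c) \<Rightarrow> 'c \<Rightarrow> nat" where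
  "cls m l c = card {v. v < m \<and> l v = c}"

text \<open>A label that occurs in the second graph only must count as overrepresented, hence the
  weight 4 for an empty class: \<open>4 * a\<^sup>2 - 2 * a \<ge> 2 * a\<close> for natural \<open>a\<close>.\<close>
definition wt :: "nat \<Rightarrow> (nat \<Rightarrow> 'c) \<Rightarrow> 'c \<Rightarrow> real" where
  "wt m l c = (if cls m l c = 0 then 4 else 1 / cls m l c)"

text \<open>The weight always refers to \<open>l\<close>, because only the class sizes of the first
  graph are known exactly; \<open>f\<close> and \<open>g\<close> label the two arguments. With
  \<open>f = g = l'\<close> this serves the collision test. With \<open>f = l\<close> and
  \<open>g = l'\<close> it is the probability that the vertex \<open>x\<close> of the first graph is
  picked when \<open>y\<close> receives a uniform partner with its own label.\<close>

definition kern :: "nat \<Rightarrow> (nat \<Rightarrow> 'c) \<Rightarrow> (nat \<Rightarrow> 'c) \<Rightarrow> (nat \<Rightarrow> 'c) \<Rightarrow> nat \<Rightarrow> nat \<Rightarrow> real" where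
  "kern m l f g x y = (if f x = g y then wt m l (f x) else 0)"

definition collision_stat :: "nat \<Rightarrow> (nat \<Rightarrow> 'c) \<Rightarrow> (nat \<Rightarrow> 'c) \<Rightarrow> nat list \<Rightarrow> nat list \<Rightarrow> real" where
  "collision_stat m l l' xs ys = (\<Sum>x\<leftarrow>xs. \<Sum>y\<leftarrow>ys. kern m l l' l' x y)"

definition mismatch_stat :: "nat \<Rightarrow> (nat \<Rightarrow> 'c) \<Rightarrow> (nat \<Rightarrow> 'c) \<Rightarrow> (nat \<Rightarrow> nat \<Rightarrow> nat \<Rightarrow> nat \<Rightarrow> bool) \<Rightarrow>
    nat list \<Rightarrow> nat list \<Rightarrow> nat list \<Rightarrow> nat list \<Rightarrow> real" where
  "mismatch_stat m l l' X us us' vs vs' =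
    (\<Sum>u\<leftarrow>us. \<Sum>u'\<leftarrow>us'. \<Sum>v\<leftarrow>vs. \<Sum>v'\<leftarrow>vs'. kern m l l l' u u' * kern m l l l' v v' * of_bool (X u u' v v'))"

text \<open>If no label is confined to the second graph, then \<open>chi - 1\<close> is the chi-squared distance of
  the label distribution of the second graph from that of the first.\<close>
definition chi :: "nat \<Rightarrow> (nat \<Rightarrow> 'c) \<Rightarrow> (nat \<Rightarrow> 'c) \<Rightarrow> real" where
  "chi m l l' = (\<Sum>x<m. cls m l' (l' x) * wt m l (l' x)) / m"

text \<open>The probability that \<open>X\<close> holds for uniform \<open>u'\<close>,
  \<open>v'\<close> in the second graph and independent, uniform label-mates \<open>u\<close>,
  \<open>v\<close> in the first; a vertex without a label-mate contributes 0.\<close>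

definition mismatch_density :: "nat \<Rightarrow> (nat \<Rightarrow> 'c) \<Rightarrow> (nat \<Rightarrow> 'c) \<Rightarrow> (nat \<Rightarrow> nat \<Rightarrow> nat \<Rightarrow> nat \<Rightarrow> bool) \<Rightarrow> real" where
  "mismatch_density m l l' X =
    (\<Sum>u<m. \<Sum>u'<m. \<Sum>v<m. \<Sum>v'<m. kern m l l l' u u' * kern m l l l' v v' * of_bool (X u u' v v')) / (real m)\<^sup>2"

abbreviation unif :: "nat \<Rightarrow> nat pmf" where "unif m \<equiv> pmf_of_set {..<m}"

abbreviation iid :: "nat \<Rightarrow> nat \<Rightarrow> nat list pmf" where "iid r m \<equiv> replicate_pmf r (unif m)"

lemma sum_class: "(\<Sum>y<m. if c = f y then z else 0) = real (cls m f c) * z"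
proof -
  have "(\<Sum>y<m. if c = f y then z else 0) = (\<Sum>y\<in>{v. v < m \<and> f v = c}. z)"
    by (intro sum.mono_neutral_cong_right) auto
  then show ?thesis by (simp add: cls_def)
qed

lemma cls_pos: "x < m \<Longrightarrow> cls m f (f x) > 0"
  unfolding cls_def by (subst card_gt_0_iff) auto

lemma wt_pos: "wt m l c > 0" unfolding wt_def by simp

lemma wt_le_4: "wt m l c \<le> 4" unfolding wt_def by (auto simp: field_simps)

lemma wt_le_1: "cls m l c > 0 \<Longrightarrow> wt m l c \<le> 1"
  unfolding wt_def by (auto simp: field_simps)

lemma cls_mult_wt: "real (cls m l c) * wt m l c = of_bool (cls m l c > 0)"
  unfolding wt_def by auto

lemma kern_nonneg: "kern m l f g x y \<ge> 0"
  unfolding kern_def using wt_pos[of m l "f x"] by auto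

lemma sum_kern: "(\<Sum>y<m. kern m l f g x y) = cls m g (f x) * wt m l (f x)"
  unfolding kern_def by (simp add: sum_class)

lemma kern_commute: "kern m l f g x y = kern m l g f y x"
  unfolding kern_def by auto

lemma sum_kern': "(\<Sum>x<m. kern m l f g x y) = cls m f (g y) * wt m l (g y)"
  using sum_kern[of m l g f y] by (simp add: kern_commute[of m l g f])

lemma set_unif: "m > 0 \<Longrightarrow> set_pmf (unif m) = {..<m}" by (simp add: lessThan_empty_iff)

lemma set_iid: "m > 0 \<Longrightarrow> set_pmf (iid r m) = {xs. set xs \<subseteq> {..<m} \<and> length xs = r}"
  by (auto simp: set_replicate_pmf set_unif lists_eq_set)

lemma finite_set_unif [simp]: "m > 0 \<Longrightarrow> finite (set_pmf (unif m))" by (simp add: set_unif)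

lemma chebyshev_ratio: "M \<noteq> 0 \<Longrightarrow> a * M\<^sup>2 / R / (b * M)\<^sup>2 = a / (R * b\<^sup>2)" for M :: real
  by (simp add: power_mult_distrib)

locale labels =
  fixes m :: nat and l l' :: "nat \<Rightarrow> 'c"
  assumes m: "m > 0"
begin

abbreviation "Q \<equiv> chi m l l'"
abbreviation "K \<equiv> kern m l l l'"

lemma fin [simp]: "finite (set_pmf (unif m))" using m by simp

lemma mean_collision: "mean (unif m) (\<lambda>x. mean (unif m) (kern m l l' l' x)) = Q / m"
  using m by (simp add: mean_unif sum_kern chi_def flip: sum_divide_distrib)

lemma mean_collision_sq: "mean (unif m) (\<lambda>x. mean (unif m) (\<lambda>y. (kern m l l' l' x y)\<^sup>2)) \<le> 4 * (Q / m)"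
proof -
  have "(kern m l l' l' x y)\<^sup>2 \<le> 4 * kern m l l' l' x y" for x y
    unfolding power2_eq_square
    by (intro mult_right_mono kern_nonneg) (auto simp: kern_def wt_le_4)
  then have "mean (unif m) (\<lambda>x. mean (unif m) (\<lambda>y. (kern m l l' l' x y)\<^sup>2)) \<le>
      mean (unif m) (\<lambda>x. mean (unif m) (\<lambda>y. 4 * kern m l l' l' x y))"
    by (intro mean_mono) auto
  also have "\<dots> = 4 * (Q / m)" by (simp add: mean_collision)
  finally show ?thesis .
qed

text \<open>Controls the variance from pairs that share one vertex. The row sum \<open>?f\<close> is
  constant on each class of \<open>l'\<close>, so a large value recurs on its whole class;
  comparison with the total \<open>Q * m\<close> caps it by \<open>2 * sqrt (Q * m)\<close>. The
  bound is in terms of \<open>Q\<close> itself, as \<open>Q\<close> may be large when the test has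
  to reject.\<close>

lemma mean_sq_mean_collision:
  "mean (unif m) (\<lambda>x. (mean (unif m) (kern m l l' l' x))\<^sup>2) \<le> 2 * sqrt (Q * m) * Q / m\<^sup>2"
proof -
  let ?f = "\<lambda>x. cls m l' (l' x) * wt m l (l' x)"
  have f0: "?f x \<ge> 0" for x using wt_pos[of m l "l' x"] by simp
  have sumf: "(\<Sum>x<m. ?f x) = Q * m" using m by (simp add: chi_def)
  have f_le: "?f x \<le> 2 * sqrt (Q * m)" for x
  proof -
    have "?f x * cls m l' (l' x) = (\<Sum>y<m. if l' x = l' y then ?f y else 0)"
      using sum_class[where m = m and c = "l' x" and f = l' and z = "?f x"] by (simp add: mult.commute cong: if_cong)
    also have "\<dots> \<le> (\<Sum>y<m. ?f y)" using f0 by (intro sum_mono) auto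
    finally have 1: "?f x * cls m l' (l' x) \<le> Q * m" using sumf by simp
    have "(?f x)\<^sup>2 = wt m l (l' x) * (?f x * cls m l' (l' x))" by (simp add: power2_eq_square)
    also have "\<dots> \<le> 4 * (Q * m)"
      by (rule mult_mono[OF wt_le_4 1]) (use f0[of x] in auto)
    finally have "?f x \<le> sqrt (4 * (Q * m))" by (rule real_le_rsqrt)
    then show ?thesis by (simp add: real_sqrt_mult)
  qed
  have "(\<Sum>x<m. (?f x)\<^sup>2) \<le> (\<Sum>x<m. 2 * sqrt (Q * m) * ?f x)"
    unfolding power2_eq_square by (intro sum_mono mult_right_mono f_le f0)
  also have "\<dots> = 2 * sqrt (Q * m) * (Q * m)" by (simp only: sum_distrib_left[symmetric] sumf)
  finally have *: "(\<Sum>x<m. (?f x)\<^sup>2) \<le> 2 * sqrt (Q * m) * (Q * m)" .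
  have "mean (unif m) (\<lambda>x. (mean (unif m) (kern m l l' l' x))\<^sup>2) = (\<Sum>x<m. (?f x)\<^sup>2) / m ^ 3"
    using m by (simp add: mean_unif sum_kern power_divide power2_eq_square power3_eq_cube flip: sum_divide_distrib)
  also have "\<dots> \<le> 2 * sqrt (Q * m) * (Q * m) / m ^ 3"
    using * by (intro divide_right_mono) auto
  also have "\<dots> = 2 * sqrt (Q * m) * Q / m\<^sup>2"
    using m by (simp add: power2_eq_square power3_eq_cube)
  finally show ?thesis .
qed

lemma sum_vertices_eq_sum_labels:
  assumes "f = l \<or> f = l'"
  shows "(\<Sum>x<m. h (f x)) = (\<Sum>c\<in>l ` {..<m} \<union> l' ` {..<m}. real (cls m f c) * h c)"
proof -
  have "(\<Sum>c\<in>l ` {..<m} \<union> l' ` {..<m}. real (cls m f c) * h c)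
      = (\<Sum>c\<in>l ` {..<m} \<union> l' ` {..<m}. \<Sum>x<m. if c = f x then h c else 0)"
    by (simp add: sum_class)
  also have "\<dots> = (\<Sum>x<m. \<Sum>c\<in>l ` {..<m} \<union> l' ` {..<m}. if c = f x then h c else 0)" by (rule sum.swap)
  also have "\<dots> = (\<Sum>x<m. h (f x))"
  proof (intro sum.cong refl)
    fix x assume "x \<in> {..<m}"
    then have "f x \<in> l ` {..<m} \<union> l' ` {..<m}" using assms by auto
    then show "(\<Sum>c\<in>l ` {..<m} \<union> l' ` {..<m}. if c = f x then h c else 0) = h (f x)"
      by (subst sum.delta) auto
  qed
  finally show ?thesis by simp
qed

text \<open>Both graphs have \<open>m\<close> vertices, so the last two terms sum to
  \<open>- m\<close>; they complete the square label by label.\<close>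

lemma chi_minus_one:
  "(Q - 1) * m = (\<Sum>c\<in>l ` {..<m} \<union> l' ` {..<m}. (real (cls m l' c))\<^sup>2 * wt m l c - 2 * cls m l' c + cls m l c)"
proof -
  have "(\<Sum>c\<in>l ` {..<m} \<union> l' ` {..<m}. (real (cls m l' c))\<^sup>2 * wt m l c) = Q * m"
    using m sum_vertices_eq_sum_labels[of l' "\<lambda>c. cls m l' c * wt m l c"]
    by (simp add: chi_def power2_eq_square mult_ac)
  moreover have "(\<Sum>c\<in>l ` {..<m} \<union> l' ` {..<m}. real (cls m l' c)) = m"
    using sum_vertices_eq_sum_labels[of l' "\<lambda>_. 1"] by simp
  moreover have "(\<Sum>c\<in>l ` {..<m} \<union> l' ` {..<m}. real (cls m l c)) = m"
    using sum_vertices_eq_sum_labels[of l "\<lambda>_. 1"] by simp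
  ultimately show ?thesis
    by (simp add: sum.distrib sum_subtractf algebra_simps flip: sum_distrib_left)
qed

lemma chi_term_cases:
  "(real (cls m l' c))\<^sup>2 * wt m l c - 2 * cls m l' c + cls m l c =
    (if cls m l c = 0 then 4 * (real (cls m l' c))\<^sup>2 - 2 * cls m l' c
     else (real (cls m l' c) - cls m l c)\<^sup>2 / cls m l c)"
  by (auto simp: wt_def power2_eq_square field_simps)

lemma nat_sq_ge: "real n \<le> (real n)\<^sup>2"
  by (cases n) (auto simp: power2_eq_square)

lemma chi_term_nonneg: "(real (cls m l' c))\<^sup>2 * wt m l c - 2 * cls m l' c + cls m l c \<ge> 0"
proof -
  have "2 * real (cls m l' c) \<le> 4 * (real (cls m l' c))\<^sup>2" using nat_sq_ge[of "cls m l' c"] by linarith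
  then show ?thesis unfolding chi_term_cases by simp
qed

lemma chi_ge_one: "Q \<ge> 1"
proof -
  have "(Q - 1) * m \<ge> 0" unfolding chi_minus_one by (intro sum_nonneg chi_term_nonneg)
  then show ?thesis using m by (simp add: zero_le_mult_iff)
qed

text \<open>The inequality of arithmetic and geometric means turns the chi-squared distance into a
  count of vertices, with \<open>t\<close> balancing the two parts. Subtraction of naturals is
  truncated, so the left side counts the vertices of the second graph that exceed the size of their
  class in the first.\<close>

lemma excess_le:
  assumes t: "0 < t" "t \<le> 1"
  shows "(\<Sum>c\<in>l ` {..<m} \<union> l' ` {..<m}. real (cls m l' c - cls m l c)) \<le> (t + (Q - 1) / t) * m"
proof -
  have "real (cls m l' c - cls m l c) \<le> t * cls m l c +
      ((real (cls m l' c))\<^sup>2 * wt m l c - 2 * cls m l' c + cls m l c) / t" for c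
  proof (cases "cls m l c = 0")
    case True
    have "real (cls m l' c) * t \<le> real (cls m l' c)" using t by (simp add: mult_left_le)
    also have "\<dots> \<le> 4 * (real (cls m l' c))\<^sup>2 - 2 * cls m l' c" using nat_sq_ge[of "cls m l' c"] by linarith
    finally show ?thesis unfolding chi_term_cases using True t by (simp add: field_simps)
  next
    case False
    define b d where "b = real (cls m l c)" and "d = real (cls m l' c) - cls m l c"
    have b: "b > 0" using False by (simp add: b_def)
    have "0 \<le> (t * b - \<bar>d\<bar>)\<^sup>2" by simp
    then have "2 * t * b * \<bar>d\<bar> \<le> (t * b)\<^sup>2 + d\<^sup>2" by (simp add: power2_diff mult_ac)
    moreover have "0 \<le> t * b * \<bar>d\<bar>" using t b by simp
    ultimately have "\<bar>d\<bar> * (t * b) \<le> (t * b)\<^sup>2 + d\<^sup>2" by (simp add: mult_ac)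
    then have "\<bar>d\<bar> \<le> t * b + d\<^sup>2 / b / t" using t b by (simp add: field_simps power2_eq_square)
    moreover have "real (cls m l' c - cls m l c) \<le> \<bar>d\<bar>" by (simp add: d_def)
    ultimately show ?thesis unfolding chi_term_cases using False by (simp add: b_def d_def)
  qed
  then have "(\<Sum>c\<in>l ` {..<m} \<union> l' ` {..<m}. real (cls m l' c - cls m l c)) \<le>
    (\<Sum>c\<in>l ` {..<m} \<union> l' ` {..<m}. t * cls m l c +
      ((real (cls m l' c))\<^sup>2 * wt m l c - 2 * cls m l' c + cls m l c) / t)"
    by (intro sum_mono)
  also have "\<dots> = t * (\<Sum>c\<in>l ` {..<m} \<union> l' ` {..<m}. real (cls m l c)) + (Q - 1) * m / t"
    by (subst sum.distrib) (simp only: sum_distrib_left chi_minus_one sum_divide_distrib)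
  also have "(\<Sum>c\<in>l ` {..<m} \<union> l' ` {..<m}. real (cls m l c)) = m"
    using sum_vertices_eq_sum_labels[of l "\<lambda>_. 1"] by simp
  finally show ?thesis by (simp add: algebra_simps)
qed

lemma chi_eq_one:
  assumes "\<And>x. x < m \<Longrightarrow> cls m l (l' x) = cls m l' (l' x)"
  shows "Q = 1"
proof -
  have "(\<Sum>x<m. cls m l' (l' x) * wt m l (l' x)) = (\<Sum>x<m. 1)"
    using assms cls_pos[of _ m l'] by (intro sum.cong refl) (metis cls_mult_wt lessThan_iff of_bool_eq(2))
  then show ?thesis using m by (simp add: chi_def)
qed

section \<open>The collision test\<close>

text \<open>Since \<open>Q \<ge> 1\<close>, the mean \<open>M\<close> is at least
  \<open>R\<^sup>2\<close>. The variance is of order \<open>M * sqrt M\<close>, hence at most a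
  fraction \<open>8 / R\<close> of \<open>M\<^sup>2\<close>, however large \<open>Q\<close>
  is.\<close>

lemma collision_second_moment:
  fixes R :: real
  assumes R: "R \<ge> 1" and r: "(real r)\<^sup>2 \<ge> R\<^sup>2 * m"
  defines "M \<equiv> (real r)\<^sup>2 / m * Q"
  shows "mean (pair_pmf (iid r m) (iid r m)) (\<lambda>(xs, ys). collision_stat m l l' xs ys) = M"
    and "mean (pair_pmf (iid r m) (iid r m)) (\<lambda>(xs, ys). (collision_stat m l l' xs ys)\<^sup>2) \<le> 8 * M\<^sup>2 / R + M\<^sup>2"
proof -
  show "mean (pair_pmf (iid r m) (iid r m)) (\<lambda>(xs, ys). collision_stat m l l' xs ys) = M"
    unfolding collision_stat_def
    by (subst mean_bipartite) (use m in \<open>auto simp: mean_collision M_def power2_eq_square\<close>)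
  have sym: "mean (unif m) (\<lambda>y. (mean (unif m) (\<lambda>x. kern m l l' l' x y))\<^sup>2) =
      mean (unif m) (\<lambda>x. (mean (unif m) (kern m l l' l' x))\<^sup>2)"
    by (subst kern_commute) simp
  have M: "M \<ge> R\<^sup>2"
  proof -
    have "R\<^sup>2 * 1 \<le> (real r)\<^sup>2 / m * Q"
      using r m chi_ge_one by (intro mult_mono) (auto simp: field_simps)
    then show ?thesis by (simp add: M_def)
  qed
  then have M1: "M \<ge> 1" and sM: "sqrt M \<ge> R" 
    using R by (auto simp: real_le_rsqrt intro: order.trans[OF one_le_power])
  \<comment> \<open>Expresses the factor \<open>sqrt (Q * m)\<close> of the shared-vertex terms by
    the mean alone.\<close>
  have s: "real r * sqrt (Q * m) = m * sqrt M"
  proof -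
    have "m * sqrt M = sqrt (real m ^ 2 * M)" by (simp add: real_sqrt_mult)
    also have "real m ^ 2 * M = (real r)\<^sup>2 * (Q * m)" using m by (simp add: M_def power2_eq_square)
    also have "sqrt \<dots> = real r * sqrt (Q * m)" by (simp add: real_sqrt_mult)
    finally show ?thesis by simp
  qed
  have "mean (pair_pmf (iid r m) (iid r m)) (\<lambda>(xs, ys). (collision_stat m l l' xs ys)\<^sup>2) \<le>
     real r * real r * (4 * (Q / m)) + (real r)\<^sup>2 * real r * (2 * sqrt (Q * m) * Q / m\<^sup>2)
     + real r * (real r)\<^sup>2 * (2 * sqrt (Q * m) * Q / m\<^sup>2) + (real r * real r * (Q / m))\<^sup>2"
    unfolding collision_stat_def
    by (rule order.trans[OF mean_bipartite_sq[OF fin fin]], unfold mean_collision sym)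
      (intro add_mono mult_left_mono mean_collision_sq mean_sq_mean_collision order.refl; simp)
  also have "\<dots> = 4 * M + 4 * (M * (real r * sqrt (Q * m) / m)) + M\<^sup>2"
    using m by (simp add: M_def power2_eq_square field_simps)
  also have "real r * sqrt (Q * m) / m = sqrt M" using s m by simp
  also have "4 * M + 4 * (M * sqrt M) + M\<^sup>2 \<le> 8 * (M * sqrt M) + M\<^sup>2"
    using M1 by (auto simp: real_le_rsqrt)
  also have "M * sqrt M \<le> M\<^sup>2 / R"
  proof -
    have "M * sqrt M * R \<le> M * sqrt M * sqrt M" using M1 sM by (intro mult_left_mono) auto
    also have "\<dots> = M\<^sup>2" using M1 by (simp add: power2_eq_square)
    finally show ?thesis using R by (simp add: field_simps)
  qed
  finally show "mean (pair_pmf (iid r m) (iid r m)) (\<lambda>(xs, ys). (collision_stat m l l' xs ys)\<^sup>2) \<le> 8 * M\<^sup>2 / R + M\<^sup>2"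
    by simp
qed

lemma collision_accepts:
  fixes R :: real
  assumes R: "R \<ge> 1" and r: "(real r)\<^sup>2 \<ge> R\<^sup>2 * m" and \<eta>: "\<eta> > 0" and Q1: "Q = 1"
  shows "prb (pair_pmf (iid r m) (iid r m)) (\<lambda>(xs, ys). collision_stat m l l' xs ys > (1 + \<eta>) * ((real r)\<^sup>2 / m))
    \<le> 8 / (R * \<eta>\<^sup>2)"
proof -
  let ?M = "(real r)\<^sup>2 / m * Q"
  have "R\<^sup>2 * m > 0" using R m by simp
  then have "(real r)\<^sup>2 > 0" using r by linarith
  then have M0: "?M > 0" using m Q1 by simp
  have d: "\<eta> * ?M > 0" using \<eta> M0 by (rule mult_pos_pos)
  have "prb (pair_pmf (iid r m) (iid r m)) (\<lambda>(xs, ys). collision_stat m l l' xs ys > (1 + \<eta>) * ((real r)\<^sup>2 / m))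
    \<le> prb (pair_pmf (iid r m) (iid r m)) (\<lambda>z. \<eta> * ?M \<le> \<bar>(case z of (xs, ys) \<Rightarrow> collision_stat m l l' xs ys) - ?M\<bar>)"
  proof (intro prb_mono, clarify)
    fix xs ys assume "collision_stat m l l' xs ys > (1 + \<eta>) * ((real r)\<^sup>2 / m)"
    then have "\<eta> * ?M \<le> collision_stat m l l' xs ys - ?M" by (simp only: distrib_right Q1 mult_1_right mult_1)
    then show "\<eta> * ?M \<le> \<bar>collision_stat m l l' xs ys - ?M\<bar>" by linarith
  qed
  also have "\<dots> \<le> (8 * ?M\<^sup>2 / R) / (\<eta> * ?M)\<^sup>2"
    using collision_second_moment[OF R r] d by (intro prb_chebyshev) (auto simp: case_prod_unfold m)
  also have "\<dots> = 8 / (R * \<eta>\<^sup>2)" by (rule chebyshev_ratio[OF less_imp_neq[OF M0, symmetric]])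
  finally show ?thesis .
qed

text \<open>The threshold lies below the mean by a relative margin of at least
  \<open>\<eta> / 3\<close>, because
  \<open>(1 - \<eta> / 3) * (1 + 2 * \<eta>) \<ge> 1 + \<eta>\<close> for
  \<open>\<eta> \<le> 1\<close>. The 72 is 8 times the square of this 3.\<close>

lemma collision_rejects:
  fixes R :: real
  assumes R: "R \<ge> 1" and r: "(real r)\<^sup>2 \<ge> R\<^sup>2 * m" and \<eta>: "0 < \<eta>" "\<eta> \<le> 1" and Q1: "Q > 1 + 2 * \<eta>"
  shows "prb (pair_pmf (iid r m) (iid r m)) (\<lambda>(xs, ys). \<not> collision_stat m l l' xs ys > (1 + \<eta>) * ((real r)\<^sup>2 / m))
    \<le> 72 / (R * \<eta>\<^sup>2)"
proof -
  let ?M = "(real r)\<^sup>2 / m * Q"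
  have "R\<^sup>2 * m > 0" using R m by simp
  then have "(real r)\<^sup>2 > 0" using r by linarith
  then have M0: "?M > 0" using m Q1 \<eta> by simp
  have d: "\<eta> / 3 * ?M > 0" using \<eta> by (intro mult_pos_pos[OF _ M0]) simp
  have "(1 + \<eta>) \<le> (1 - \<eta> / 3) * (1 + 2 * \<eta>)"
    using \<eta> mult_left_mono[of \<eta> 1 \<eta>] by (simp add: algebra_simps)
  also have "\<dots> \<le> (1 - \<eta> / 3) * Q" using Q1 \<eta> by (intro mult_left_mono) auto
  finally have "(1 + \<eta>) * ((real r)\<^sup>2 / m) \<le> (1 - \<eta> / 3) * Q * ((real r)\<^sup>2 / m)"
    by (intro mult_right_mono) auto
  then have th: "(1 + \<eta>) * ((real r)\<^sup>2 / m) \<le> (1 - \<eta> / 3) * ?M" by (simp add: mult_ac)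
  have "prb (pair_pmf (iid r m) (iid r m)) (\<lambda>(xs, ys). \<not> collision_stat m l l' xs ys > (1 + \<eta>) * ((real r)\<^sup>2 / m))
    \<le> prb (pair_pmf (iid r m) (iid r m)) (\<lambda>z. \<eta> / 3 * ?M \<le> \<bar>(case z of (xs, ys) \<Rightarrow> collision_stat m l l' xs ys) - ?M\<bar>)"
  proof (intro prb_mono, clarify)
    fix xs ys assume "\<not> collision_stat m l l' xs ys > (1 + \<eta>) * ((real r)\<^sup>2 / m)"
    then have "collision_stat m l l' xs ys \<le> (1 - \<eta> / 3) * ?M" using th by linarith
    then have "\<eta> / 3 * ?M \<le> ?M - collision_stat m l l' xs ys" by (simp only: left_diff_distrib)
    then show "\<eta> / 3 * ?M \<le> \<bar>collision_stat m l l' xs ys - ?M\<bar>" by linarith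
  qed
  also have "\<dots> \<le> (8 * ?M\<^sup>2 / R) / (\<eta> / 3 * ?M)\<^sup>2"
    using collision_second_moment[OF R r] d by (intro prb_chebyshev) (auto simp: case_prod_unfold m)
  also have "\<dots> = 72 / (R * \<eta>\<^sup>2)" by (subst chebyshev_ratio[OF less_imp_neq[OF M0, symmetric]]) (auto simp: power_divide)
  finally show ?thesis .
qed

end

section \<open>The mismatch statistic\<close>

context labels
begin

text \<open>For a fixed vertex of the second graph the weights form a subprobability on its
  label-mates.\<close>

lemma sum_K_left_le: "(\<Sum>u<m. K u u') \<le> 1"
  unfolding sum_kern' cls_mult_wt by simp

lemma sum_sum_K_le: "(\<Sum>u<m. \<Sum>u'<m. K u u') \<le> m"
proof -
  have "(\<Sum>u<m. \<Sum>u'<m. K u u') = (\<Sum>u'<m. \<Sum>u<m. K u u')" by (rule sum.swap)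
  also have "\<dots> \<le> (\<Sum>u'<m. 1)" by (intro sum_mono sum_K_left_le)
  finally show ?thesis by simp
qed

lemma K_le_one: "u < m \<Longrightarrow> K u u' \<le> 1"
  unfolding kern_def using wt_le_1[OF cls_pos, of u m l] by auto

text \<open>A row sum may exceed 1 where a label is overrepresented in the second graph. One factor
  of its square depends on the label only and can be moved to the vertices \<open>x\<close> of the
  second graph; the column bound then leaves the sum that defines \<open>Q\<close>.\<close>

lemma sum_sq_sum_K_le: "(\<Sum>u<m. (\<Sum>u'<m. K u u')\<^sup>2) \<le> Q * m"
proof -
  let ?f = "\<lambda>x. cls m l' (l' x) * wt m l (l' x)"
  have f0: "?f x \<ge> 0" for x using wt_pos[of m l "l' x"] by simp
  have "(\<Sum>u'<m. K u u')\<^sup>2 = (\<Sum>x<m. K u x * ?f x)" for u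
  proof -
    have "(\<Sum>u'<m. K u u')\<^sup>2 = (\<Sum>x<m. K u x * (cls m l' (l u) * wt m l (l u)))"
      by (simp only: power2_eq_square sum_kern sum_distrib_right[symmetric])
    also have "\<dots> = (\<Sum>x<m. K u x * ?f x)" by (intro sum.cong refl) (simp add: kern_def)
    finally show ?thesis .
  qed
  then have "(\<Sum>u<m. (\<Sum>u'<m. K u u')\<^sup>2) = (\<Sum>u<m. \<Sum>x<m. K u x * ?f x)" by simp
  also have "\<dots> = (\<Sum>x<m. (\<Sum>u<m. K u x) * ?f x)"
    by (subst sum.swap) (simp only: sum_distrib_right)
  also have "\<dots> \<le> (\<Sum>x<m. 1 * ?f x)"
    by (intro sum_mono mult_right_mono sum_K_left_le f0)
  also have "\<dots> = Q * m" using m by (simp add: chi_def)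
  finally show ?thesis .
qed

lemma mean_weighted:
  "mean (pair_pmf (iid r m) (iid r m)) (\<lambda>(us, us'). \<Sum>u\<leftarrow>us. \<Sum>u'\<leftarrow>us'. K u u' * D u u') =
    (real r)\<^sup>2 / m * ((\<Sum>u<m. \<Sum>u'<m. K u u' * D u u') / m)"
  by (subst mean_bipartite) (use m in \<open>auto simp: mean_unif power2_eq_square simp flip: sum_divide_distrib\<close>)

text \<open>The variance is compared with the squared scale \<open>B * (r^2 / m)\<close> rather than
  with the squared mean, as \<open>D\<close> may be small on most pairs. The condition
  \<open>Q \<le> 2\<close> enters through the row sums, in \<open>right\<close>.\<close>

lemma weighted_second_moment:
  fixes R B :: real
  assumes R: "R \<ge> 1" and r: "(real r)\<^sup>2 \<ge> R\<^sup>2 * m" and Q2: "Q \<le> 2" and B: "B \<ge> 0"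
    and D: "\<And>u u'. 0 \<le> D u u'" "\<And>u u'. D u u' \<le> B"
  shows "mean (pair_pmf (iid r m) (iid r m)) (\<lambda>(us, us'). (\<Sum>u\<leftarrow>us. \<Sum>u'\<leftarrow>us'. K u u' * D u u')\<^sup>2) \<le>
    4 * (B * ((real r)\<^sup>2 / m))\<^sup>2 / R + ((real r)\<^sup>2 / m * ((\<Sum>u<m. \<Sum>u'<m. K u u' * D u u') / m))\<^sup>2"
proof -
  let ?k = "\<lambda>u u'. K u u' * D u u'"
  note K0 = kern_nonneg[of m l l l']
  have kB: "?k u u' \<le> K u u' * B" for u u' by (intro mult_left_mono D K0)
  have k0: "0 \<le> ?k u u'" for u u' by (intro mult_nonneg_nonneg D K0)
  have e: "mean (unif m) (\<lambda>u. mean (unif m) (?k u)) = (\<Sum>u<m. \<Sum>u'<m. ?k u u') / m / m"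
    using m by (simp add: mean_unif flip: sum_divide_distrib)
  have sq: "mean (unif m) (\<lambda>u. mean (unif m) (\<lambda>u'. (?k u u')\<^sup>2)) \<le> B\<^sup>2 / m"
  proof -
    have "(?k u u')\<^sup>2 \<le> B\<^sup>2 * K u u'" if "u < m" for u u'
    proof -
      have "(?k u u')\<^sup>2 \<le> (K u u' * B)\<^sup>2" by (intro power_mono kB k0)
      also have "\<dots> = B\<^sup>2 * (K u u' * K u u')" by (simp add: power2_eq_square)
      also have "\<dots> \<le> B\<^sup>2 * (K u u' * 1)" by (intro mult_left_mono K_le_one that K0) auto
      finally show ?thesis by simp
    qed
    then have "(\<Sum>u<m. \<Sum>u'<m. (?k u u')\<^sup>2) \<le> (\<Sum>u<m. \<Sum>u'<m. B\<^sup>2 * K u u')"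
      by (intro sum_mono) auto
    also have "\<dots> \<le> B\<^sup>2 * m"
      unfolding sum_distrib_left[symmetric] by (intro mult_left_mono sum_sum_K_le) auto
    finally have "(\<Sum>u<m. \<Sum>u'<m. (?k u u')\<^sup>2) / m / m \<le> B\<^sup>2 * m / m / m" by (intro divide_right_mono) auto
    then show ?thesis using m by (simp add: mean_unif flip: sum_divide_distrib)
  qed
  have left: "mean (unif m) (\<lambda>u'. (mean (unif m) (\<lambda>u. ?k u u'))\<^sup>2) \<le> B\<^sup>2 / m\<^sup>2"
  proof (intro mean_le_const)
    fix u'
    have "(\<Sum>u<m. ?k u u') \<le> (\<Sum>u<m. K u u') * B" unfolding sum_distrib_right by (intro sum_mono kB)
    also have "\<dots> \<le> 1 * B" by (intro mult_right_mono sum_K_left_le B)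
    finally have "mean (unif m) (\<lambda>u. ?k u u') \<le> B / m" using m by (simp add: mean_unif divide_right_mono)
    then show "(mean (unif m) (\<lambda>u. ?k u u'))\<^sup>2 \<le> B\<^sup>2 / m\<^sup>2"
      unfolding power_divide[symmetric] of_nat_power by (intro power_mono mean_nonneg k0)
  qed simp
  have right: "mean (unif m) (\<lambda>u. (mean (unif m) (?k u))\<^sup>2) \<le> 2 * (B\<^sup>2 / m\<^sup>2)"
  proof -
    have "(\<Sum>u<m. (\<Sum>u'<m. ?k u u')\<^sup>2) \<le> (\<Sum>u<m. B\<^sup>2 * (\<Sum>u'<m. K u u')\<^sup>2)"
    proof (intro sum_mono)
      fix u
      have "(\<Sum>u'<m. ?k u u') \<le> B * (\<Sum>u'<m. K u u')"
        unfolding sum_distrib_left by (intro sum_mono) (use kB in \<open>simp add: mult.commute\<close>)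
      then have "(\<Sum>u'<m. ?k u u')\<^sup>2 \<le> (B * (\<Sum>u'<m. K u u'))\<^sup>2" by (intro power_mono sum_nonneg k0)
      then show "(\<Sum>u'<m. ?k u u')\<^sup>2 \<le> B\<^sup>2 * (\<Sum>u'<m. K u u')\<^sup>2" by (simp add: power_mult_distrib)
    qed
    also have "\<dots> \<le> B\<^sup>2 * (Q * m)"
      unfolding sum_distrib_left[symmetric] by (intro mult_left_mono sum_sq_sum_K_le) auto
    also have "\<dots> \<le> B\<^sup>2 * (2 * m)" using mult_right_mono[OF Q2, of "real m"] by (intro mult_left_mono) auto
    finally have "(\<Sum>u<m. (\<Sum>u'<m. ?k u u')\<^sup>2) / m ^ 3 \<le> B\<^sup>2 * (2 * m) / m ^ 3" by (intro divide_right_mono) auto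
    moreover have "mean (unif m) (\<lambda>u. (mean (unif m) (?k u))\<^sup>2) = (\<Sum>u<m. (\<Sum>u'<m. ?k u u')\<^sup>2) / m ^ 3"
      using m by (simp add: mean_unif power_divide power2_eq_square power3_eq_cube flip: sum_divide_distrib)
    ultimately show ?thesis using m by (simp add: power2_eq_square power3_eq_cube mult_ac)
  qed
  have rR: "R \<le> r"
  proof -
    have "R\<^sup>2 * 1 \<le> R\<^sup>2 * m" using m by (intro mult_left_mono) auto
    then have "R\<^sup>2 \<le> (real r)\<^sup>2" using r by linarith
    then show ?thesis by (rule power2_le_imp_le) simp
  qed
  have mR: "m * R \<le> (real r)\<^sup>2"
  proof -
    have "m * R * 1 \<le> m * R * R" using R by (intro mult_left_mono) auto
    then show ?thesis using r by (simp add: power2_eq_square mult_ac)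
  qed
  have "mean (pair_pmf (iid r m) (iid r m)) (\<lambda>(us, us'). (\<Sum>u\<leftarrow>us. \<Sum>u'\<leftarrow>us'. ?k u u')\<^sup>2) \<le>
     real r * real r * (B\<^sup>2 / m) + (real r)\<^sup>2 * real r * (B\<^sup>2 / m\<^sup>2)
     + real r * (real r)\<^sup>2 * (2 * (B\<^sup>2 / m\<^sup>2)) + (real r * real r * ((\<Sum>u<m. \<Sum>u'<m. ?k u u') / m / m))\<^sup>2"
    by (rule order.trans[OF mean_bipartite_sq[OF fin fin]], unfold e)
      (intro add_mono mult_left_mono sq left right order.refl; simp)
  also have "real r * real r * (B\<^sup>2 / m) + (real r)\<^sup>2 * real r * (B\<^sup>2 / m\<^sup>2) + real r * (real r)\<^sup>2 * (2 * (B\<^sup>2 / m\<^sup>2))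
      = B\<^sup>2 * (real r)\<^sup>2 / m\<^sup>2 * (m + 3 * r)"
    using m by (simp add: power2_eq_square field_simps)
  also have "\<dots> \<le> B\<^sup>2 * (real r)\<^sup>2 / m\<^sup>2 * (4 * (real r)\<^sup>2 / R)"
  proof (intro mult_left_mono)
    have "(m + 3 * r) * R \<le> 4 * (real r)\<^sup>2"
      using mR mult_left_mono[OF rR, of r] by (simp add: power2_eq_square algebra_simps)
    then show "real (m + 3 * r) \<le> 4 * (real r)\<^sup>2 / R" using R by (simp add: field_simps)
  qed auto
  also have "\<dots> = 4 * (B * ((real r)\<^sup>2 / m))\<^sup>2 / R"
    by (simp add: power2_eq_square)
  also have "(real r * real r * ((\<Sum>u<m. \<Sum>u'<m. ?k u u') / m / m)) =
      (real r)\<^sup>2 / m * ((\<Sum>u<m. \<Sum>u'<m. K u u' * D u u') / m)"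
    by (simp add: power2_eq_square)
  finally show ?thesis by simp
qed

text \<open>Chebyshev at distance \<open>\<nu> / 2\<close>, where \<open>\<nu>\<close> is only a
  lower bound for the mean; this is all that is known in the applications.\<close>

lemma weighted_lower_tail:
  fixes R B :: real and r :: nat and D :: "nat \<Rightarrow> nat \<Rightarrow> real"
  assumes R: "R \<ge> 1" and r: "(real r)\<^sup>2 \<ge> R\<^sup>2 * m" and Q2: "Q \<le> 2" and B: "B \<ge> 0"
    and D: "\<And>u u'. 0 \<le> D u u'" "\<And>u u'. D u u' \<le> B"
  defines "\<mu> \<equiv> (real r)\<^sup>2 / m * ((\<Sum>u<m. \<Sum>u'<m. K u u' * D u u') / m)"
  assumes \<nu>: "0 < \<nu>" "\<nu> \<le> \<mu>"
  shows "prb (pair_pmf (iid r m) (iid r m)) (\<lambda>(us, us'). (\<Sum>u\<leftarrow>us. \<Sum>u'\<leftarrow>us'. K u u' * D u u') \<le> \<nu> / 2)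
    \<le> 16 * (B * ((real r)\<^sup>2 / m))\<^sup>2 / (R * \<nu>\<^sup>2)"
proof -
  have "prb (pair_pmf (iid r m) (iid r m)) (\<lambda>(us, us'). (\<Sum>u\<leftarrow>us. \<Sum>u'\<leftarrow>us'. K u u' * D u u') \<le> \<nu> / 2)
    \<le> prb (pair_pmf (iid r m) (iid r m))
      (\<lambda>z. \<nu> / 2 \<le> \<bar>(case z of (us, us') \<Rightarrow> (\<Sum>u\<leftarrow>us. \<Sum>u'\<leftarrow>us'. K u u' * D u u')) - \<mu>\<bar>)"
    using \<nu> by (intro prb_mono) auto
  also have "\<dots> \<le> (4 * (B * ((real r)\<^sup>2 / m))\<^sup>2 / R) / (\<nu> / 2)\<^sup>2"
    unfolding \<mu>_def
    using \<nu> weighted_second_moment[OF R r Q2 B D] mean_weighted[of r D]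
    by (intro prb_chebyshev) (auto simp: case_prod_unfold)
  also have "\<dots> = 16 * (B * ((real r)\<^sup>2 / m))\<^sup>2 / (R * \<nu>\<^sup>2)" by (simp add: power_divide)
  finally show ?thesis .
qed

text \<open>Regrouped so that for fixed \<open>us\<close>, \<open>us'\<close> the statistic is a
  bilinear form in \<open>vs\<close>, \<open>vs'\<close>.\<close>

lemma mismatch_stat_eq:
  "mismatch_stat m l l' X us us' vs vs' =
    (\<Sum>v\<leftarrow>vs. \<Sum>v'\<leftarrow>vs'. K v v' * (\<Sum>u\<leftarrow>us. \<Sum>u'\<leftarrow>us'. K u u' * of_bool (X u u' v v')))"
proof -
  have swap: "(\<Sum>x\<leftarrow>xs. \<Sum>y\<leftarrow>ys. f x y) = (\<Sum>y\<leftarrow>ys. \<Sum>x\<leftarrow>xs. f x y)"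
    for xs ys :: "nat list" and f :: "nat \<Rightarrow> nat \<Rightarrow> real"
    by (induction xs) (simp_all add: sum_list_addf)
  have "mismatch_stat m l l' X us us' vs vs' =
    (\<Sum>u\<leftarrow>us. \<Sum>v\<leftarrow>vs. \<Sum>u'\<leftarrow>us'. \<Sum>v'\<leftarrow>vs'. K v v' * (K u u' * of_bool (X u u' v v')))"
    unfolding mismatch_stat_def by (subst swap[of _ us']) (simp add: mult_ac)
  also have "\<dots> = (\<Sum>u\<leftarrow>us. \<Sum>v\<leftarrow>vs. \<Sum>v'\<leftarrow>vs'. \<Sum>u'\<leftarrow>us'. K v v' * (K u u' * of_bool (X u u' v v')))"
    by (subst swap[of _ us']) simp
  also have "\<dots> = (\<Sum>v\<leftarrow>vs. \<Sum>v'\<leftarrow>vs'. \<Sum>u\<leftarrow>us. \<Sum>u'\<leftarrow>us'. K v v' * (K u u' * of_bool (X u u' v v')))"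
    by (subst swap[of _ us], subst swap[of _ us]) simp
  finally show ?thesis by (simp only: sum_list_const_mult)
qed

lemma mean_mismatch:
  fixes r :: nat
  defines "\<rho> \<equiv> (real r)\<^sup>2 / m" and "P \<equiv> pair_pmf (iid r m) (iid r m)"
  shows "mean P (\<lambda>(vs, vs'). mismatch_stat m l l' X us us' vs vs') =
      \<rho> * (\<Sum>u\<leftarrow>us. \<Sum>u'\<leftarrow>us'. K u u' * ((\<Sum>v<m. \<Sum>v'<m. K v v' * of_bool (X u u' v v')) / m))" (is ?A)
    and "mean P (\<lambda>(us, us'). \<Sum>u\<leftarrow>us. \<Sum>u'\<leftarrow>us'. K u u' * ((\<Sum>v<m. \<Sum>v'<m. K v v' * of_bool (X u u' v v')) / m))
      = \<rho> * mismatch_density m l l' X" (is ?B)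
proof -
  have lin: "(\<Sum>x<m. \<Sum>y<m. \<Sum>u\<leftarrow>us. \<Sum>u'\<leftarrow>us'. f x y u u') = (\<Sum>u\<leftarrow>us. \<Sum>u'\<leftarrow>us'. \<Sum>x<m. \<Sum>y<m. f x y u u')"
    for f :: "nat \<Rightarrow> nat \<Rightarrow> nat \<Rightarrow> nat \<Rightarrow> real"
  proof -
    have 1: "(\<Sum>x\<in>A. \<Sum>u\<leftarrow>us. g x u) = (\<Sum>u\<leftarrow>us. \<Sum>x\<in>A. g x u)" for A :: "nat set" and us :: "nat list" and g :: "nat \<Rightarrow> nat \<Rightarrow> real"
      by (induction us) (simp_all add: sum.distrib)
    show ?thesis by (simp add: 1)
  qed
  have "mean P (\<lambda>(vs, vs'). mismatch_stat m l l' X us us' vs vs') =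
      \<rho> * ((\<Sum>v<m. \<Sum>v'<m. K v v' * (\<Sum>u\<leftarrow>us. \<Sum>u'\<leftarrow>us'. K u u' * of_bool (X u u' v v'))) / m)"
    unfolding mismatch_stat_eq P_def \<rho>_def by (rule mean_weighted)
  also have "(\<Sum>v<m. \<Sum>v'<m. K v v' * (\<Sum>u\<leftarrow>us. \<Sum>u'\<leftarrow>us'. K u u' * of_bool (X u u' v v'))) =
      (\<Sum>v<m. \<Sum>v'<m. \<Sum>u\<leftarrow>us. \<Sum>u'\<leftarrow>us'. K u u' * (K v v' * of_bool (X u u' v v')))"
    by (simp add: mult.left_commute flip: sum_list_const_mult)
  also have "\<dots> = (\<Sum>u\<leftarrow>us. \<Sum>u'\<leftarrow>us'. K u u' * (\<Sum>v<m. \<Sum>v'<m. K v v' * of_bool (X u u' v v')))"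
    unfolding lin by (simp only: sum_distrib_left)
  finally show ?A
    by (simp add: sum_list_mult_const divide_inverse mult.assoc flip: sum_list_mult_const)
  show ?B unfolding P_def \<rho>_def mean_weighted mismatch_density_def
    using m by (simp add: power2_eq_square sum_distrib_left mult.assoc del: sum_mult_of_bool_eq flip: sum_divide_distrib)
qed

text \<open>Markov suffices: in the accepting case the mismatch density is a small fraction of the
  threshold \<open>t\<close>.\<close>

lemma mismatch_accepts:
  fixes t :: real
  assumes t: "t > 0" and r: "r > 0"
  shows "prb (pair_pmf (pair_pmf (iid r m) (iid r m)) (pair_pmf (iid r m) (iid r m)))
      (\<lambda>((us, us'), (vs, vs')). t * ((real r)\<^sup>2 / m)\<^sup>2 \<le> mismatch_stat m l l' X us us' vs vs')
    \<le> mismatch_density m l l' X / t" (is "prb ?P _ \<le> _")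
proof -
  let ?\<rho> = "(real r)\<^sup>2 / m"
  let ?f = "\<lambda>((us, us'), (vs, vs')). mismatch_stat m l l' X us us' vs vs'"
  have \<rho>: "?\<rho> > 0" using m r by simp
  have "prb ?P (\<lambda>((us, us'), (vs, vs')). t * ?\<rho>\<^sup>2 \<le> mismatch_stat m l l' X us us' vs vs') =
    prb ?P (\<lambda>z. t * ?\<rho>\<^sup>2 \<le> ?f z)"
    by (simp add: case_prod_unfold)
  also have "\<dots> \<le> mean ?P ?f / (t * ?\<rho>\<^sup>2)"
  proof (rule prb_markov[where f = ?f])
    show "0 \<le> ?f z" for z
      unfolding mismatch_stat_def
      by (auto simp: case_prod_unfold intro!: sum_list_nonneg mult_nonneg_nonneg kern_nonneg)
    have "?\<rho>\<^sup>2 > 0" using \<rho> by (rule zero_less_power)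
    then show "t * ?\<rho>\<^sup>2 > 0" using t by (rule mult_pos_pos[rotated])
  qed auto
  also have "mean ?P ?f = ?\<rho>\<^sup>2 * mismatch_density m l l' X"
  proof -
    have "mean ?P ?f =
      mean (pair_pmf (iid r m) (iid r m)) (\<lambda>(us, us'). mean (pair_pmf (iid r m) (iid r m)) (\<lambda>(vs, vs'). mismatch_stat m l l' X us us' vs vs'))"
      by (subst mean_pair) (auto simp: case_prod_unfold)
    also have "\<dots> = ?\<rho> * (?\<rho> * mismatch_density m l l' X)"
      unfolding mean_mismatch(1) mean_mismatch(2)[symmetric] by (simp add: case_prod_unfold)
    finally show ?thesis by (simp add: power2_eq_square)
  qed
  also have "?\<rho>\<^sup>2 * mismatch_density m l l' X / (t * ?\<rho>\<^sup>2) = mismatch_density m l l' X / t"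
    using m r by simp
  finally show ?thesis .
qed

text \<open>The fourfold sum is treated in two stages. The samples \<open>us\<close>,
  \<open>us'\<close> are good if the conditional mean, proportional to \<open>?S\<close>, is not too
  small and the total weight \<open>?F\<close> is not too large; \<open>?F\<close> then bounds the
  coefficients \<open>?H\<close> of the second stage. Each stage loses a factor 2, whence the
  threshold \<open>e / 4\<close>.\<close>

lemma mismatch_rejects:
  fixes R e :: real
  assumes R: "R \<ge> 1" and r: "(real r)\<^sup>2 \<ge> R\<^sup>2 * m" and Q2: "Q \<le> 2"
    and e: "e > 0" "e \<le> mismatch_density m l l' X"
  shows "prb (pair_pmf (pair_pmf (iid r m) (iid r m)) (pair_pmf (iid r m) (iid r m)))
      (\<lambda>((us, us'), (vs, vs')). \<not> e / 4 * ((real r)\<^sup>2 / m)\<^sup>2 \<le> mismatch_stat m l l' X us us' vs vs')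
    \<le> 1 / 16 + 16400 / (R * e\<^sup>2)" (is "prb (pair_pmf ?P ?P) ?rej \<le> _")
proof -
  let ?\<rho> = "(real r)\<^sup>2 / m"
  let ?D = "\<lambda>u u'. (\<Sum>v<m. \<Sum>v'<m. K v v' * of_bool (X u u' v v')) / m"
  let ?S = "\<lambda>us us'. \<Sum>u\<leftarrow>us. \<Sum>u'\<leftarrow>us'. K u u' * ?D u u'"
  let ?F = "\<lambda>us us'. \<Sum>u\<leftarrow>us. \<Sum>u'\<leftarrow>us'. K u u'"
  note K0 = kern_nonneg[of m l l l']
  have "R\<^sup>2 * m > 0" using R m by simp
  then have "(real r)\<^sup>2 > 0" using r by linarith
  then have \<rho>: "?\<rho> > 0" using m by simp
  have D0: "0 \<le> ?D u u'" for u u' by (intro divide_nonneg_nonneg sum_nonneg mult_nonneg_nonneg K0) auto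
  have D1: "?D u u' \<le> 1" for u u'
  proof -
    have "(\<Sum>v<m. \<Sum>v'<m. K v v' * of_bool (X u u' v v')) \<le> (\<Sum>v<m. \<Sum>v'<m. K v v')"
      by (intro sum_mono) (use K0 in auto)
    then show ?thesis using sum_sum_K_le m by simp
  qed
  have p1: "prb ?P (\<lambda>(us, us'). ?S us us' \<le> ?\<rho> * e / 2) \<le> 16 / (R * e\<^sup>2)"
  proof -
    have "?\<rho> * e \<le> ?\<rho> * mismatch_density m l l' X" using e \<rho> by (intro mult_left_mono) auto
    also have "\<dots> = ?\<rho> * ((\<Sum>u<m. \<Sum>u'<m. K u u' * ?D u u') / m)"
      unfolding mean_mismatch(2)[symmetric] mean_weighted ..
    finally have "prb ?P (\<lambda>(us, us'). ?S us us' \<le> ?\<rho> * e / 2) \<le> 16 * (1 * ?\<rho>)\<^sup>2 / (R * (?\<rho> * e)\<^sup>2)"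
      using \<rho> e(1) by (intro weighted_lower_tail[OF R r Q2 _ D0 D1] mult_pos_pos) auto
    also have "\<dots> = 16 / (R * e\<^sup>2)"
    proof -
      have "16 * (1 * x)\<^sup>2 / (R * (x * e)\<^sup>2) = 16 / (R * e\<^sup>2)" if "x > 0" for x :: real
        using that by (simp add: power_mult_distrib)
      then show ?thesis using \<rho> .
    qed
    finally show ?thesis .
  qed
  \<comment> \<open>The cap 16 on the coefficients costs probability 1/16 here and returns in
    \<open>16384 = 16 * 16^2 * 2^2\<close> in the second stage.\<close>
  have p2: "prb ?P (\<lambda>(us, us'). 16 * ?\<rho> \<le> ?F us us') \<le> 1 / 16"
  proof -
    have "prb ?P (\<lambda>z. 16 * ?\<rho> \<le> (case z of (us, us') \<Rightarrow> ?F us us')) \<le> mean ?P (\<lambda>(us, us'). ?F us us') / (16 * ?\<rho>)"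
      using \<rho> by (intro prb_markov) (auto intro!: sum_list_nonneg K0)
    also have "mean ?P (\<lambda>(us, us'). ?F us us') = ?\<rho> * ((\<Sum>u<m. \<Sum>u'<m. K u u') / m)"
      using mean_weighted[of r "\<lambda>_ _. 1"] by simp
    also have "\<dots> / (16 * ?\<rho>) \<le> 1 / 16"
      using \<rho> sum_sum_K_le m by (simp add: field_simps)
    finally show ?thesis by (simp add: case_prod_unfold)
  qed
  let ?Good = "\<lambda>(us, us'). ?\<rho> * e / 2 < ?S us us' \<and> ?F us us' < 16 * ?\<rho>"
  have "prb (pair_pmf ?P ?P) ?rej \<le> (16 / (R * e\<^sup>2) + 1 / 16) + 16384 / (R * e\<^sup>2)"
  proof (rule prb_pair_le[where Good = ?Good])
    have "prb ?P (\<lambda>z. \<not> ?Good z) = prb ?P (\<lambda>z. (case z of (us, us') \<Rightarrow> ?S us us' \<le> ?\<rho> * e / 2) \<or> (case z of (us, us') \<Rightarrow> 16 * ?\<rho> \<le> ?F us us'))"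
      by (simp add: case_prod_unfold not_less)
    also have "\<dots> \<le> 16 / (R * e\<^sup>2) + 1 / 16"
      by (rule order.trans[OF prb_disj add_mono[OF p1 p2]])
    finally show "prb ?P (\<lambda>z. \<not> ?Good z) \<le> 16 / (R * e\<^sup>2) + 1 / 16" .
  next
    fix z assume "z \<in> set_pmf ?P" "?Good z"
    then obtain us us' where z: "z = (us, us')" and S: "?\<rho> * e / 2 < ?S us us'" and F: "?F us us' < 16 * ?\<rho>"
      by auto
    let ?H = "\<lambda>v v'. \<Sum>u\<leftarrow>us. \<Sum>u'\<leftarrow>us'. K u u' * of_bool (X u u' v v')"
    have H0: "0 \<le> ?H v v'" for v v' using K0 by (intro sum_list_nonneg) (auto intro!: sum_list_nonneg)
    have H1: "?H v v' \<le> 16 * ?\<rho>" for v v'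
    proof -
      have "?H v v' \<le> ?F us us'" by (intro sum_list_mono) (use K0 in auto)
      then show ?thesis using F by simp
    qed
    have "mean ?P (\<lambda>(vs, vs'). mismatch_stat m l l' X us us' vs vs') = ?\<rho> * ?S us us'"
      by (rule mean_mismatch(1))
    then have mH: "?\<rho> * ((\<Sum>v<m. \<Sum>v'<m. K v v' * ?H v v') / m) = ?\<rho> * ?S us us'"
      unfolding mismatch_stat_eq mean_weighted .
    have nu: "?\<rho> * (?\<rho> * e / 2) \<le> ?\<rho> * ((\<Sum>v<m. \<Sum>v'<m. K v v' * ?H v v') / m)"
      unfolding mH using S \<rho> by (intro mult_left_mono) auto
    have nu0: "0 < ?\<rho> * (?\<rho> * e / 2)" using \<rho> e(1) by (intro mult_pos_pos divide_pos_pos[where y = 2]) auto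
    have "prb ?P (\<lambda>w. ?rej (z, w)) \<le> prb ?P (\<lambda>(vs, vs'). (\<Sum>v\<leftarrow>vs. \<Sum>v'\<leftarrow>vs'. K v v' * ?H v v') \<le> ?\<rho> * (?\<rho> * e / 2) / 2)"
      unfolding z mismatch_stat_eq
      by (intro prb_mono) (auto simp: power2_eq_square algebra_simps)
    also have "\<dots> \<le> 16 * (16 * ?\<rho> * ?\<rho>)\<^sup>2 / (R * (?\<rho> * (?\<rho> * e / 2))\<^sup>2)"
      using \<rho> by (intro weighted_lower_tail[OF R r Q2 _ H0 H1 nu0 nu]) simp
    also have "\<dots> = 16384 / (R * e\<^sup>2)"
    proof -
      have "16 * (16 * x * x)\<^sup>2 / (R * (x * (x * e / 2))\<^sup>2) = 16384 / (R * e\<^sup>2)" if "x > 0" for x :: real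
        using that by (simp add: power_mult_distrib power_divide)
      then show ?thesis using \<rho> .
    qed
    finally show "prb ?P (\<lambda>w. ?rej (z, w)) \<le> 16384 / (R * e\<^sup>2)" .
  qed (use R in auto)
  also have "\<dots> = 1 / 16 + 16400 / (R * e\<^sup>2)" by (simp add: add_divide_distrib[symmetric])
  finally show ?thesis .
qed

end

section \<open>Label-preserving bijections\<close>

lemma ex_partial_injection:
  assumes "finite A" "finite B"
  shows "\<exists>A' h. A' \<subseteq> A \<and> inj_on h A' \<and> h ` A' \<subseteq> B \<and> card (A - A') = card A - card B"
proof (cases "card A \<le> card B")
  case True
  then obtain h where "h ` A \<subseteq> B" "inj_on h A" using card_le_inj[OF assms] by blast
  then show ?thesis using True by (intro exI[of _ A] exI[of _ h]) auto
next
  case False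
  then obtain A' where A': "A' \<subseteq> A" "card A' = card B" "finite A'"
    by (meson nat_le_linear obtain_subset_with_card_n)
  then obtain h where "h ` A' \<subseteq> B" "inj_on h A'" using card_le_inj[of A' B] assms by auto
  then show ?thesis using A' assms by (intro exI[of _ A'] exI[of _ h]) (auto simp: card_Diff_subset)
qed

definition label_perms :: "nat \<Rightarrow> (nat \<Rightarrow> 'c) \<Rightarrow> (nat \<Rightarrow> nat) set" where
  "label_perms m l = {\<tau>. \<tau> permutes {..<m} \<and> (\<forall>v. l (\<tau> v) = l v)}"

lemma finite_label_perms [simp]: "finite (label_perms m l)"
  by (rule finite_subset[OF _ finite_permutations[of "{..<m}"]]) (auto simp: label_perms_def)

lemma card_label_perms_pos: "card (label_perms m l) > 0"
proof -
  have "id \<in> label_perms m l" by (simp add: label_perms_def permutes_id)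
  then show ?thesis by (subst card_gt_0_iff) auto
qed

lemma label_perms_comp: "\<lbrakk>\<rho> \<in> label_perms m l; \<tau> \<in> label_perms m l\<rbrakk> \<Longrightarrow> \<rho> \<circ> \<tau> \<in> label_perms m l"
  by (auto simp: label_perms_def intro: permutes_compose)

lemma transpose_label_perms:
  "\<lbrakk>x < m; y < m; l x = l y\<rbrakk> \<Longrightarrow> Transposition.transpose x y \<in> label_perms m l"
  by (auto simp: label_perms_def permutes_swap_id Transposition.transpose_def)

lemma ex_label_perm_moving:
  assumes "u < m" "u1 < m" "v < m" "v1 < m" "l u = l u1" "l v = l v1" "u \<noteq> v" "u1 \<noteq> v1"
  shows "\<exists>\<rho>\<in>label_perms m l. \<rho> u = u1 \<and> \<rho> v = v1"
proof -
  \<comment> \<open>Where \<open>v\<close> is after \<open>u\<close> has been moved to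
    \<open>u1\<close>. Both \<open>w\<close> and \<open>v1\<close> differ from \<open>u1\<close>, so
    the second transposition leaves \<open>u1\<close> in place.\<close>
  define w where "w = Transposition.transpose u u1 v"
  have w: "w < m" "l w = l v1" "w \<noteq> u1"
    using assms by (auto simp: w_def Transposition.transpose_def)
  have "Transposition.transpose w v1 \<circ> Transposition.transpose u u1 \<in> label_perms m l"
    using assms w by (intro label_perms_comp transpose_label_perms) auto
  moreover have "(Transposition.transpose w v1 \<circ> Transposition.transpose u u1) u = u1" "(Transposition.transpose w v1 \<circ> Transposition.transpose u u1) v = v1"
    using assms w by (auto simp: Transposition.transpose_def w_def)
  ultimately show ?thesis by blast
qed

lemma card_label_perms_pair_le:
  assumes "u < m" "u1 < m" "v < m" "v1 < m" "l u = l u1" "l v = l v1" "u \<noteq> v" "u1 \<noteq> v1"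
  shows "card {\<tau> \<in> label_perms m l. \<tau> p = u \<and> \<tau> q = v} \<le> card {\<tau> \<in> label_perms m l. \<tau> p = u1 \<and> \<tau> q = v1}"
proof -
  obtain \<rho> where \<rho>: "\<rho> \<in> label_perms m l" "\<rho> u = u1" "\<rho> v = v1"
    using ex_label_perm_moving[OF assms] by blast
  show ?thesis
  proof (rule card_inj_on_le[where f = "\<lambda>\<tau>. \<rho> \<circ> \<tau>"])
    have "inj \<rho>" using \<rho>(1) by (auto simp: label_perms_def permutes_inj)
    then show "inj_on ((\<circ>) \<rho>) {\<tau> \<in> label_perms m l. \<tau> p = u \<and> \<tau> q = v}"
      by (auto simp: inj_on_def fun_eq_iff)
  qed (use \<rho> label_perms_comp in auto)
qed

text \<open>By symmetry all pairs of distinct vertices with prescribed labels are equally likely images;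
  the factor 2 accounts for the missing diagonal when the two labels coincide.\<close>
lemma card_label_perms_pair:
  assumes "u < m" "v < m" "u \<noteq> v"
  shows "real (card {\<tau> \<in> label_perms m l. \<tau> p = u \<and> \<tau> q = v}) \<le>
    2 * card (label_perms m l) * wt m l (l u) * wt m l (l v)"
proof -
  let ?N = "\<lambda>(u, v). {\<tau> \<in> label_perms m l. \<tau> p = u \<and> \<tau> q = v}"
  let ?B = "\<lambda>c. {x. x < m \<and> l x = c}"
  let ?P = "?B (l u) \<times> ?B (l v) - {(x, y). x = y}"
  have "card ?P * card (?N (u, v)) = (\<Sum>z\<in>?P. card (?N (u, v)))" by simp
  also have "\<dots> \<le> (\<Sum>z\<in>?P. card (?N z))"
    using assms by (intro sum_mono) (auto intro!: card_label_perms_pair_le)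
  also have "\<dots> = card (\<Union>z\<in>?P. ?N z)" by (subst card_UN_disjoint) auto
  also have "\<dots> \<le> card (label_perms m l)" by (intro card_mono) auto
  finally have 1: "card ?P * card (?N (u, v)) \<le> card (label_perms m l)" .
  have c: "cls m l (l u) > 0" "cls m l (l v) > 0" using assms cls_pos by auto
  have "cls m l (l u) * cls m l (l v) \<le> 2 * card ?P"
  proof (cases "l u = l v")
    case False
    then have "?P = ?B (l u) \<times> ?B (l v)" by auto
    then show ?thesis by (simp add: cls_def)
  next
    case True
    have "card {u, v} \<le> cls m l (l u)" unfolding cls_def using assms True by (intro card_mono) auto
    then have 2: "2 \<le> cls m l (l u)" using assms by simp
    have "?B (l u) \<times> ?B (l v) \<inter> {(x, y). x = y} = (\<lambda>x. (x, x)) ` ?B (l u)" using True by auto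
    then have "card (?B (l u) \<times> ?B (l v) \<inter> {(x, y). x = y}) = cls m l (l u)"
      by (simp add: card_image inj_on_def cls_def)
    moreover have "card (?B (l u) \<times> ?B (l v)) = cls m l (l u) * cls m l (l u)"
      using True by (simp add: cls_def card_cartesian_product)
    ultimately have "card ?P = cls m l (l u) * cls m l (l u) - cls m l (l u)"
      by (subst card_Diff_subset_Int) auto
    moreover have "n * n \<le> 2 * (n * n - n)" if "2 \<le> n" for n :: nat
    proof -
      have "2 * n \<le> n * n" using that by (rule mult_right_mono) simp
      then show ?thesis by linarith
    qed
    ultimately show ?thesis using True 2 by metis
  qed
  then have "cls m l (l u) * cls m l (l v) * card (?N (u, v)) \<le> 2 * card ?P * card (?N (u, v))"
    by (intro mult_right_mono) auto
  also have "\<dots> \<le> 2 * card (label_perms m l)" using 1 by simp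
  finally have "real (cls m l (l u) * cls m l (l v) * card (?N (u, v))) \<le> real (2 * card (label_perms m l))"
    by (rule of_nat_mono)
  then show ?thesis using c by (simp add: wt_def field_simps)
qed

definition mismatches :: "nat \<Rightarrow> (nat \<Rightarrow> nat \<Rightarrow> bool) \<Rightarrow> (nat \<Rightarrow> nat \<Rightarrow> bool) \<Rightarrow> (nat \<Rightarrow> nat) \<Rightarrow> nat" where
  "mismatches m G H \<pi> = card {(u, v). u < m \<and> v < m \<and> G (\<pi> u) (\<pi> v) \<noteq> H u v}"

lemma mismatches_eq_sum: "real (mismatches m G H \<pi>) = (\<Sum>u<m. \<Sum>v<m. of_bool (G (\<pi> u) (\<pi> v) \<noteq> H u v))"
proof -
  let ?B = "\<lambda>(u, v). G (\<pi> u) (\<pi> v) \<noteq> H u v"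
  have "{(u, v). u < m \<and> v < m \<and> G (\<pi> u) (\<pi> v) \<noteq> H u v} = {..<m} \<times> {..<m} \<inter> {z. ?B z}" by auto
  then have "real (mismatches m G H \<pi>) = (\<Sum>z\<in>{..<m} \<times> {..<m}. of_bool (?B z))"
    by (simp add: mismatches_def)
  also have "\<dots> = (\<Sum>u<m. \<Sum>v<m. of_bool (G (\<pi> u) (\<pi> v) \<noteq> H u v))"
    by (simp only: sum.cartesian_product case_prod_unfold)
  finally show ?thesis .
qed

context labels
begin

text \<open>Label by label, as many vertices of the second graph as possible are injected into the
  class of the first. The leftovers on the two sides are equally many and are paired
  arbitrarily.\<close>

lemma ex_almost_label_preserving:
  "\<exists>\<pi>. \<pi> permutes {..<m} \<and> card {v. v < m \<and> l (\<pi> v) \<noteq> l' v} \<le>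
    (\<Sum>c\<in>l ` {..<m} \<union> l' ` {..<m}. cls m l' c - cls m l c)"
proof -
  let ?A = "\<lambda>c. {v. v < m \<and> l' v = c}" and ?B = "\<lambda>c. {v. v < m \<and> l v = c}"
  have "\<exists>A' h. A' \<subseteq> ?A c \<and> inj_on h A' \<and> h ` A' \<subseteq> ?B c \<and> card (?A c - A') = card (?A c) - card (?B c)" for c
    by (rule ex_partial_injection) auto
  then have "\<forall>c. \<exists>z. fst z \<subseteq> ?A c \<and> inj_on (snd z) (fst z) \<and> snd z ` fst z \<subseteq> ?B c \<and>
      card (?A c - fst z) = card (?A c) - card (?B c)"
    by simp
  from choice[OF this] obtain z where z: "\<And>c. fst (z c) \<subseteq> ?A c \<and> inj_on (snd (z c)) (fst (z c)) \<and>
      snd (z c) ` fst (z c) \<subseteq> ?B c \<and> card (?A c - fst (z c)) = card (?A c) - card (?B c)"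
    by blast
  define A' h where "A' c = fst (z c)" and "h c = snd (z c)" for c
  have inj: "\<And>c. inj_on (h c) (A' c)" and im: "\<And>c. h c ` A' c \<subseteq> ?B c"
    and cd: "\<And>c. card (?A c - A' c) = card (?A c) - card (?B c)"
    using z by (simp_all add: A'_def h_def)
  define S where "S = {v. v < m \<and> v \<in> A' (l' v)}"
  define f where "f v = h (l' v) v" for v
  have lf: "l (f v) = l' v" "f v < m" if "v \<in> S" for v
    using im[of "l' v"] that by (auto simp: S_def f_def)
  have injf: "inj_on f S"
  proof (rule inj_onI)
    fix x y assume xy: "x \<in> S" "y \<in> S" "f x = f y"
    then have "l' x = l' y" using lf by metis
    then show "x = y" using xy inj[of "l' x"] by (auto simp: S_def f_def inj_on_def)
  qed
  have S: "S \<subseteq> {..<m}" "f ` S \<subseteq> {..<m}" using lf by (auto simp: S_def)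
  then have "card ({..<m} - S) = card ({..<m} - f ` S)"
    using injf by (simp add: card_Diff_subset finite_subset card_image)
  then obtain g where g: "bij_betw g ({..<m} - S) ({..<m} - f ` S)"
    using finite_same_card_bij[of "{..<m} - S" "{..<m} - f ` S"] by auto
  define \<pi> where "\<pi> v = (if v \<in> S then f v else if v < m then g v else v)" for v
  have "bij_betw \<pi> S (f ` S)"
    using injf by (subst bij_betw_cong[of _ _ f]) (auto simp: \<pi>_def bij_betw_imageI)
  moreover have "bij_betw \<pi> ({..<m} - S) ({..<m} - f ` S)"
    using g by (subst bij_betw_cong[of _ _ g]) (auto simp: \<pi>_def)
  ultimately have "bij_betw \<pi> (S \<union> ({..<m} - S)) (f ` S \<union> ({..<m} - f ` S))"
    by (rule bij_betw_combine) auto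
  moreover have "S \<union> ({..<m} - S) = {..<m}" "f ` S \<union> ({..<m} - f ` S) = {..<m}" using S by auto
  ultimately have "bij_betw \<pi> {..<m} {..<m}" by simp
  then have perm: "\<pi> permutes {..<m}" using S by (intro bij_imp_permutes) (auto simp: \<pi>_def)
  have "card {v. v < m \<and> l (\<pi> v) \<noteq> l' v} \<le> card (\<Union>c\<in>l ` {..<m} \<union> l' ` {..<m}. ?A c - A' c)"
    by (intro card_mono) (auto simp: \<pi>_def S_def lf)
  also have "\<dots> \<le> (\<Sum>c\<in>l ` {..<m} \<union> l' ` {..<m}. card (?A c - A' c))" by (rule card_UN_le) simp
  also have "\<dots> = (\<Sum>c\<in>l ` {..<m} \<union> l' ` {..<m}. cls m l' c - cls m l c)" by (simp add: cd cls_def)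
  finally show ?thesis using perm by blast
qed

text \<open>Averages the mismatches of \<open>\<tau> \<circ> \<pi>\<close> over all
  \<open>\<tau>\<close> in \<open>label_perms m l\<close>. A pair of distinct well-matched vertices
  lands on \<open>(u, v)\<close> with probability at most \<open>2 * K u u' * K v v'\<close>, whence
  the factor 2 before the density. A badly matched vertex may spoil every pair that contains it, and
  such vertices are counted by \<open>excess_le\<close>.\<close>

lemma ex_permutation_few_mismatches:
  assumes diag: "\<And>u v. \<lbrakk>u < m; v < m; l u = l' v\<rbrakk> \<Longrightarrow> G u u = H v v"
    and t: "0 < t" "t \<le> 1"
  shows "\<exists>\<pi>. \<pi> permutes {..<m} \<and> real (mismatches m G H \<pi>) \<le>
    (2 * mismatch_density m l l' (\<lambda>u u' v v'. G u v \<noteq> H u' v') + 2 * (t + (Q - 1) / t)) * (real m)\<^sup>2"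
proof -
  let ?X = "\<lambda>u u' v v'. G u v \<noteq> H u' v'"
  let ?\<Gamma> = "label_perms m l"
  obtain \<pi> where \<pi>: "\<pi> permutes {..<m}" and bad: "card {v. v < m \<and> l (\<pi> v) \<noteq> l' v} \<le>
      (\<Sum>c\<in>l ` {..<m} \<union> l' ` {..<m}. cls m l' c - cls m l c)"
    using ex_almost_label_preserving by blast
  define bd :: "nat \<Rightarrow> real" where "bd v = of_bool (l (\<pi> v) \<noteq> l' v)" for v
  have "(\<Sum>v<m. bd v) = real (card {v. v < m \<and> l (\<pi> v) \<noteq> l' v})"
    by (simp add: bd_def Collect_conj_eq lessThan_def)
  also have "\<dots> \<le> real (\<Sum>c\<in>l ` {..<m} \<union> l' ` {..<m}. cls m l' c - cls m l c)" using bad by (rule of_nat_mono)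
  also have "\<dots> \<le> (t + (Q - 1) / t) * m" unfolding of_nat_sum by (rule excess_le[OF t])
  finally have bd: "(\<Sum>v<m. bd v) \<le> (t + (Q - 1) / t) * m" .
  let ?T = "\<lambda>u' v'. \<Sum>u<m. \<Sum>v<m. K u u' * K v v' * of_bool (?X u u' v v')"
  have T0: "?T u' v' \<ge> 0" for u' v' by (intro sum_nonneg mult_nonneg_nonneg kern_nonneg) auto
  have bd0: "bd v \<ge> 0" for v by (simp add: bd_def)
  have pair: "(\<Sum>\<tau>\<in>?\<Gamma>. of_bool (G (\<tau> (\<pi> u')) (\<tau> (\<pi> v')) \<noteq> H u' v')) \<le>
      real (card ?\<Gamma>) * (2 * ?T u' v' + bd u' + bd v')" if uv: "u' < m" "v' < m" for u' v'
  proof (cases "l (\<pi> u') = l' u' \<and> l (\<pi> v') = l' v'")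
    case False
    then have "1 \<le> 2 * ?T u' v' + bd u' + bd v'" using T0[of u' v'] by (auto simp: bd_def)
    then have "real (card ?\<Gamma>) * 1 \<le> real (card ?\<Gamma>) * (2 * ?T u' v' + bd u' + bd v')" by (intro mult_left_mono) auto
    moreover have "(\<Sum>\<tau>\<in>?\<Gamma>. of_bool (G (\<tau> (\<pi> u')) (\<tau> (\<pi> v')) \<noteq> H u' v')) \<le> (\<Sum>\<tau>\<in>?\<Gamma>. 1 :: real)"
      by (intro sum_mono) auto
    ultimately show ?thesis by simp
  next
    case True
    let ?p = "\<pi> u'" and ?q = "\<pi> v'"
    have pq: "?p < m" "?q < m" using permutes_in_image[OF \<pi>] uv by auto
    have \<tau>m: "\<tau> x < m \<longleftrightarrow> x < m" "l (\<tau> x) = l x" if "\<tau> \<in> ?\<Gamma>" for \<tau> x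
      using that permutes_in_image[of \<tau> "{..<m}" x] by (auto simp: label_perms_def)
    have inj: "\<tau> ?p = \<tau> ?q \<longleftrightarrow> u' = v'" if "\<tau> \<in> ?\<Gamma>" for \<tau>
      using that permutes_inj[of \<tau> "{..<m}"] permutes_inj[OF \<pi>] by (auto simp: label_perms_def inj_eq)
    show ?thesis
    proof (cases "u' = v'")
      \<comment> \<open>The image pair stays on the diagonal, where the bound for distinct images
        says nothing; here equal labels must force equal loops.\<close>
      case eq: True
      have "G (\<tau> ?p) (\<tau> ?p) = H u' u'" if "\<tau> \<in> ?\<Gamma>" for \<tau>
        using True \<tau>m[OF that] pq uv by (intro diag) auto
      then have "(\<Sum>\<tau>\<in>?\<Gamma>. of_bool (G (\<tau> ?p) (\<tau> ?q) \<noteq> H u' v')) = (0 :: real)"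
        using eq by (intro sum.neutral) auto
      then show ?thesis using T0[of u' v'] bd0[of u'] bd0[of v'] by simp
    next
      case neq: False
      have "(\<Sum>\<tau>\<in>?\<Gamma>. of_bool (G (\<tau> ?p) (\<tau> ?q) \<noteq> H u' v')) =
        (\<Sum>\<tau>\<in>?\<Gamma>. \<Sum>u<m. \<Sum>v<m. of_bool (\<tau> ?p = u \<and> \<tau> ?q = v) * of_bool (?X u u' v v') :: real)"
      proof (intro sum.cong refl)
        fix \<tau> assume \<tau>: "\<tau> \<in> ?\<Gamma>"
        have "(\<Sum>u<m. \<Sum>v<m. of_bool (\<tau> ?p = u \<and> \<tau> ?q = v) * of_bool (?X u u' v v') :: real) =
          (\<Sum>u<m. if \<tau> ?p = u then (\<Sum>v<m. if \<tau> ?q = v then of_bool (?X u u' v v') else 0) else 0)"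
          by (intro sum.cong refl) (auto intro!: sum.cong)
        also have "\<dots> = of_bool (G (\<tau> ?p) (\<tau> ?q) \<noteq> H u' v')"
          using \<tau>m[OF \<tau>] pq by (simp add: sum.delta')
        finally show "of_bool (G (\<tau> ?p) (\<tau> ?q) \<noteq> H u' v') =
          (\<Sum>u<m. \<Sum>v<m. of_bool (\<tau> ?p = u \<and> \<tau> ?q = v) * of_bool (?X u u' v v') :: real)" by simp
      qed
      also have "\<dots> = (\<Sum>u<m. \<Sum>v<m. \<Sum>\<tau>\<in>?\<Gamma>. of_bool (\<tau> ?p = u \<and> \<tau> ?q = v) * of_bool (?X u u' v v'))"
        by (subst sum.swap) (intro sum.cong refl sum.swap)
      also have "\<dots> = (\<Sum>u<m. \<Sum>v<m. real (card {\<tau> \<in> ?\<Gamma>. \<tau> ?p = u \<and> \<tau> ?q = v}) * of_bool (?X u u' v v'))"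
        by (subst sum_distrib_right[symmetric]) (simp add: Int_def)
      also have "\<dots> \<le> (\<Sum>u<m. \<Sum>v<m. (2 * card ?\<Gamma> * K u u' * K v v') * of_bool (?X u u' v v'))"
      proof (intro sum_mono mult_right_mono)
        fix u v assume u: "u \<in> {..<m}" "v \<in> {..<m}"
        show "real (card {\<tau> \<in> ?\<Gamma>. \<tau> ?p = u \<and> \<tau> ?q = v}) \<le> 2 * card ?\<Gamma> * K u u' * K v v'"
        proof (cases "l u = l' u' \<and> l v = l' v' \<and> u \<noteq> v")
          case t: True
          then show ?thesis using card_label_perms_pair[of u m v l ?p ?q] u by (simp add: kern_def)
        next
          case f: False
          have "{\<tau> \<in> ?\<Gamma>. \<tau> ?p = u \<and> \<tau> ?q = v} = {}" using f \<tau>m inj True neq by auto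
          then have "real (card {\<tau> \<in> ?\<Gamma>. \<tau> ?p = u \<and> \<tau> ?q = v}) = 0" by (simp only: card.empty of_nat_0)
          moreover have "0 \<le> 2 * card ?\<Gamma> * K u u' * K v v'" by (intro mult_nonneg_nonneg kern_nonneg) auto
          ultimately show ?thesis by linarith
        qed
      qed auto
      also have "\<dots> = real (card ?\<Gamma>) * (2 * ?T u' v')"
        by (simp add: sum_distrib_left mult_ac del: sum_mult_of_bool_eq)
      finally show ?thesis using True by (simp add: bd_def)
    qed
  qed
  let ?M = "\<lambda>\<tau>. real (mismatches m G H (\<tau> \<circ> \<pi>))"
  let ?b = "(2 * mismatch_density m l l' ?X + 2 * (t + (Q - 1) / t)) * (real m)\<^sup>2"
  have TT: "(\<Sum>u'<m. \<Sum>v'<m. ?T u' v') = mismatch_density m l l' ?X * (real m)\<^sup>2"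
  proof -
    have "(\<Sum>u'<m. \<Sum>v'<m. ?T u' v') = (\<Sum>u'<m. \<Sum>u<m. \<Sum>v'<m. \<Sum>v<m. K u u' * K v v' * of_bool (?X u u' v v'))"
      by (intro sum.cong refl sum.swap)
    also have "\<dots> = (\<Sum>u<m. \<Sum>u'<m. \<Sum>v<m. \<Sum>v'<m. K u u' * K v v' * of_bool (?X u u' v v'))"
      by (subst sum.swap) (intro sum.cong refl sum.swap)
    finally show ?thesis using m by (simp add: mismatch_density_def)
  qed
  have "(\<Sum>\<tau>\<in>?\<Gamma>. ?M \<tau>) = (\<Sum>u'<m. \<Sum>v'<m. \<Sum>\<tau>\<in>?\<Gamma>. of_bool (G (\<tau> (\<pi> u')) (\<tau> (\<pi> v')) \<noteq> H u' v'))"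
    unfolding mismatches_eq_sum o_def by (subst sum.swap) (intro sum.cong refl sum.swap)
  also have "\<dots> \<le> (\<Sum>u'<m. \<Sum>v'<m. real (card ?\<Gamma>) * (2 * ?T u' v' + bd u' + bd v'))"
    by (intro sum_mono pair) auto
  also have "\<dots> = real (card ?\<Gamma>) * (2 * (\<Sum>u'<m. \<Sum>v'<m. ?T u' v') + m * (\<Sum>v<m. bd v) + m * (\<Sum>v<m. bd v))"
    by (simp only: sum_distrib_left[symmetric] sum.distrib sum_constant card_lessThan)
  also have "\<dots> \<le> real (card ?\<Gamma>) * ?b"
  proof (intro mult_left_mono)
    have aux: "2 * (x * M\<^sup>2) + y + y \<le> (2 * x + 2 * z) * M\<^sup>2" if "y \<le> M * (z * M)" for x y z M :: real
      using that by (simp add: power2_eq_square algebra_simps)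
    show "2 * (\<Sum>u'<m. \<Sum>v'<m. ?T u' v') + m * (\<Sum>v<m. bd v) + m * (\<Sum>v<m. bd v) \<le> ?b"
      unfolding TT by (rule aux[OF mult_left_mono[OF bd]]) simp
  qed simp
  finally have sum_le: "(\<Sum>\<tau>\<in>?\<Gamma>. ?M \<tau>) \<le> real (card ?\<Gamma>) * ?b" .
  have "\<exists>\<tau>\<in>?\<Gamma>. ?M \<tau> \<le> ?b"
  proof (rule ccontr)
    assume "\<not> (\<exists>\<tau>\<in>?\<Gamma>. ?M \<tau> \<le> ?b)"
    then have "(\<Sum>\<tau>\<in>?\<Gamma>. ?b) < (\<Sum>\<tau>\<in>?\<Gamma>. ?M \<tau>)"
      using card_label_perms_pos[of m l] by (intro sum_strict_mono) (auto simp: card_gt_0_iff)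
    then show False using sum_le by simp
  qed
  then obtain \<tau> where \<tau>: "\<tau> \<in> ?\<Gamma>" "?M \<tau> \<le> ?b" by blast
  then have "\<tau> \<circ> \<pi> permutes {..<m}" using \<pi> by (auto simp: label_perms_def intro: permutes_compose)
  then show ?thesis using \<tau> by blast
qed

section \<open>Isomorphic graphs with matching labels\<close>

lemma isomorphic_labels:
  assumes \<sigma>: "\<sigma> permutes {..<m}" and l: "\<And>u. u < m \<Longrightarrow> l' (\<sigma> u) = l u"
  shows "Q = 1"
proof (rule chi_eq_one)
  fix x assume "x < m"
  have "bij_betw \<sigma> {v. v < m \<and> l v = c} {v. v < m \<and> l' v = c}" for c
  proof (rule bij_betw_imageI)
    show "inj_on \<sigma> {v. v < m \<and> l v = c}" using permutes_inj[OF \<sigma>] inj_on_subset by blast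
    show "\<sigma> ` {v. v < m \<and> l v = c} = {v. v < m \<and> l' v = c}"
    proof (intro equalityI subsetI)
      fix y assume y: "y \<in> {v. v < m \<and> l' v = c}"
      then obtain x where "x < m" "y = \<sigma> x" using permutes_image[OF \<sigma>] by (metis (mono_tags, lifting) imageE lessThan_iff mem_Collect_eq)
      then show "y \<in> \<sigma> ` {v. v < m \<and> l v = c}" using y l by auto
    qed (use l permutes_in_image[OF \<sigma>] in auto)
  qed
  then show "cls m l (l' x) = cls m l' (l' x)" unfolding cls_def by (rule bij_betw_same_card)
qed

text \<open>Pulled back along \<open>\<sigma>\<close>, the matching weights become the kernel
  \<open>?k\<close> of the first graph with itself, which is doubly stochastic. The entries at
  \<open>(u, v)\<close> and \<open>(x, y)\<close> are compared through the hybrid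
  \<open>(x, v)\<close>; each step exchanges one vertex for a label-mate and costs
  \<open>\<delta>\<close> by the core property.\<close>

lemma isomorphic_mismatch_density:
  fixes \<delta> :: real
  assumes \<sigma>: "\<sigma> permutes {..<m}" and l: "\<And>u. u < m \<Longrightarrow> l' (\<sigma> u) = l u"
    and iso: "\<And>u v. \<lbrakk>u < m; v < m\<rbrakk> \<Longrightarrow> G u v = H (\<sigma> u) (\<sigma> v)"
    and core: "\<And>u x. \<lbrakk>u < m; x < m; l u = l x\<rbrakk> \<Longrightarrow>
      real (card {w. w < m \<and> (G u w \<noteq> G x w \<or> G w u \<noteq> G w x)}) \<le> \<delta> * m"
  shows "mismatch_density m l l' (\<lambda>u u' v v'. G u v \<noteq> H u' v') \<le> 2 * \<delta>"
proof -
  let ?k = "kern m l l l"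
  have k: "K u (\<sigma> x) = ?k u x" if "x < m" for u x using l[OF that] by (simp add: kern_def)
  have k0: "?k u x \<ge> 0" for u x by (rule kern_nonneg)
  have row: "(\<Sum>x<m. ?k u x) = 1" if "u < m" for u
    unfolding sum_kern cls_mult_wt using cls_pos[OF that, of l] by simp
  have col: "(\<Sum>u<m. ?k u x) = 1" if "x < m" for x
    unfolding sum_kern' cls_mult_wt using cls_pos[OF that, of l] by simp
  have ksum: "(\<Sum>u<m. \<Sum>x<m. ?k u x) = m" using row by simp
  have diff: "?k u x * (\<Sum>v<m. of_bool (G u v \<noteq> G x v)) \<le> ?k u x * (\<delta> * m)"
      "?k u x * (\<Sum>v<m. of_bool (G v u \<noteq> G v x)) \<le> ?k u x * (\<delta> * m)" if "u < m" "x < m" for u x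
  proof -
    have "(\<Sum>v<m. of_bool (G u v \<noteq> G x v)) \<le> \<delta> * m" "(\<Sum>v<m. of_bool (G v u \<noteq> G v x)) \<le> \<delta> * m" if lx: "l u = l x"
    proof -
      have "real (card ({..<m} \<inter> {v. G u v \<noteq> G x v})) \<le> real (card {w. w < m \<and> (G u w \<noteq> G x w \<or> G w u \<noteq> G w x)})"
        "real (card ({..<m} \<inter> {v. G v u \<noteq> G v x})) \<le> real (card {w. w < m \<and> (G u w \<noteq> G x w \<or> G w u \<noteq> G w x)})"
        by (auto intro!: card_mono)
      then show "(\<Sum>v<m. of_bool (G u v \<noteq> G x v)) \<le> \<delta> * m" "(\<Sum>v<m. of_bool (G v u \<noteq> G v x)) \<le> \<delta> * m"
        using core[OF \<open>u < m\<close> \<open>x < m\<close> lx] by simp_all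
    qed
    moreover have "l u = l x \<or> ?k u x = 0" by (auto simp: kern_def)
    ultimately show "?k u x * (\<Sum>v<m. of_bool (G u v \<noteq> G x v)) \<le> ?k u x * (\<delta> * m)"
      "?k u x * (\<Sum>v<m. of_bool (G v u \<noteq> G v x)) \<le> ?k u x * (\<delta> * m)"
      using k0[of u x] by (auto intro: mult_left_mono simp del: sum_of_bool_eq)
  qed
  have re: "(\<Sum>u'<m. f u') = (\<Sum>x<m. f (\<sigma> x))" for f :: "nat \<Rightarrow> real"
    using sum.permute[OF \<sigma>, of f] by simp
  have "mismatch_density m l l' (\<lambda>u u' v v'. G u v \<noteq> H u' v') * (real m)\<^sup>2 =
    (\<Sum>u<m. \<Sum>u'<m. \<Sum>v<m. \<Sum>v'<m. K u u' * K v v' * of_bool (G u v \<noteq> H u' v'))"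
    using m by (simp add: mismatch_density_def)
  also have "\<dots> = (\<Sum>u<m. \<Sum>x<m. \<Sum>v<m. \<Sum>y<m. K u (\<sigma> x) * K v (\<sigma> y) * of_bool (G u v \<noteq> H (\<sigma> x) (\<sigma> y)))"
    by (subst re) (subst (2) re, rule refl)
  also have "\<dots> = (\<Sum>u<m. \<Sum>x<m. \<Sum>v<m. \<Sum>y<m. ?k u x * ?k v y * of_bool (G u v \<noteq> G x y))"
    by (intro sum.cong refl) (simp add: k iso)
  also have "\<dots> \<le> (\<Sum>u<m. \<Sum>x<m. \<Sum>v<m. \<Sum>y<m. ?k u x * of_bool (G u v \<noteq> G x v) * ?k v y + ?k v y * of_bool (G x v \<noteq> G x y) * ?k u x)"
    by (intro sum_mono) (use k0 in \<open>auto intro!: mult_nonneg_nonneg\<close>)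
  also have "\<dots> = (\<Sum>u<m. \<Sum>x<m. \<Sum>v<m. \<Sum>y<m. ?k u x * of_bool (G u v \<noteq> G x v) * ?k v y)
      + (\<Sum>u<m. \<Sum>x<m. \<Sum>v<m. \<Sum>y<m. ?k v y * of_bool (G x v \<noteq> G x y) * ?k u x)"
    by (simp only: sum.distrib)
  also have "(\<Sum>u<m. \<Sum>x<m. \<Sum>v<m. \<Sum>y<m. ?k u x * of_bool (G u v \<noteq> G x v) * ?k v y) =
      (\<Sum>u<m. \<Sum>x<m. ?k u x * (\<Sum>v<m. of_bool (G u v \<noteq> G x v)))"
  proof (intro sum.cong refl)
    fix u x
    have "(\<Sum>v<m. \<Sum>y<m. ?k u x * of_bool (G u v \<noteq> G x v) * ?k v y) =
      (\<Sum>v<m. ?k u x * of_bool (G u v \<noteq> G x v) * (\<Sum>y<m. ?k v y))" by (simp only: sum_distrib_left)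
    also have "\<dots> = (\<Sum>v<m. ?k u x * of_bool (G u v \<noteq> G x v))" by (intro sum.cong refl) (simp add: row)
    finally show "(\<Sum>v<m. \<Sum>y<m. ?k u x * of_bool (G u v \<noteq> G x v) * ?k v y) = ?k u x * (\<Sum>v<m. of_bool (G u v \<noteq> G x v))"
      by (simp only: sum_distrib_left)
  qed
  also have "\<dots> \<le> (\<Sum>u<m. \<Sum>x<m. ?k u x * (\<delta> * m))" by (intro sum_mono diff) auto
  also have "\<dots> = m * (\<delta> * m)" by (simp only: sum_distrib_right[symmetric] ksum)
  also have "(\<Sum>u<m. \<Sum>x<m. \<Sum>v<m. \<Sum>y<m. ?k v y * of_bool (G x v \<noteq> G x y) * ?k u x) =
      (\<Sum>x<m. \<Sum>u<m. ?k u x * (\<Sum>v<m. \<Sum>y<m. ?k v y * of_bool (G x v \<noteq> G x y)))"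
    by (subst sum.swap) (simp only: sum_distrib_left mult.commute)
  also have "\<dots> = (\<Sum>x<m. \<Sum>v<m. \<Sum>y<m. ?k v y * of_bool (G x v \<noteq> G x y))"
    by (simp only: sum_distrib_right[symmetric]) (simp add: col)
  also have "\<dots> = (\<Sum>v<m. \<Sum>y<m. ?k v y * (\<Sum>x<m. of_bool (G x v \<noteq> G x y)))"
    by (subst sum.swap) (simp only: sum_distrib_left, intro sum.cong refl sum.swap)
  also have "\<dots> \<le> (\<Sum>v<m. \<Sum>y<m. ?k v y * (\<delta> * m))" by (intro sum_mono diff) auto
  also have "\<dots> = m * (\<delta> * m)" by (simp only: sum_distrib_right[symmetric] ksum)
  finally have "mismatch_density m l l' (\<lambda>u u' v v'. G u v \<noteq> H u' v') * (real m)\<^sup>2 \<le> (2 * \<delta>) * (real m)\<^sup>2"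
    by (simp add: power2_eq_square)
  then show ?thesis using m by simp
qed

end

section \<open>Comparing two graphs\<close>

text \<open>The loop bit makes diagonal entries agree under every label-preserving map.\<close>
definition lab :: "(nat \<Rightarrow> nat \<Rightarrow> bool) \<Rightarrow> nat list \<Rightarrow> nat \<Rightarrow> bool \<times> (bool \<times> bool) list" where
  "lab G xs v = (G v v, map (\<lambda>x. (G x v, G v x)) xs)"

type_synonym block = "(nat list \<times> nat list) \<times> (nat list \<times> nat list)"

text \<open>A block consists of samples \<open>us\<close>, \<open>vs\<close> of vertices of \<open>G\<close> and \<open>us'\<close>, \<open>vs'\<close> of vertices of \<open>H\<close>.\<close>
definition block_rejects :: "nat \<Rightarrow> nat \<Rightarrow> real \<Rightarrow> real \<Rightarrow> (nat \<Rightarrow> nat \<Rightarrow> bool) \<Rightarrow> (nat \<Rightarrow> nat \<Rightarrow> bool) \<Rightarrow>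
    (nat \<times> nat) list \<Rightarrow> block \<Rightarrow> bool" where
  "block_rejects m r \<eta> \<tau> G H cs = (\<lambda>((us, us'), (vs, vs')).
    collision_stat m (lab G (map fst cs)) (lab H (map snd cs)) us' vs' > (1 + \<eta>) * ((real r)\<^sup>2 / m) \<or>
    \<tau> * ((real r)\<^sup>2 / m)\<^sup>2 \<le>
      mismatch_stat m (lab G (map fst cs)) (lab H (map snd cs)) (\<lambda>u u' v v'. G u v \<noteq> H u' v') us us' vs vs')"

abbreviation block_pmf :: "nat \<Rightarrow> nat \<Rightarrow> block pmf" where
  "block_pmf r m \<equiv> pair_pmf (pair_pmf (iid r m) (iid r m)) (pair_pmf (iid r m) (iid r m))"

lemma block_marginal:
  "prb (block_pmf r m) (\<lambda>((us, us'), (vs, vs')). S us' vs') = prb (pair_pmf (iid r m) (iid r m)) (\<lambda>(xs, ys). S xs ys)"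
proof -
  have "pair_pmf (iid r m) (iid r m) = map_pmf (\<lambda>(p, q). (snd p, snd q)) (block_pmf r m)"
    by (subst map_pair) (simp add: map_snd_pair_pmf)
  then have "prb (pair_pmf (iid r m) (iid r m)) (\<lambda>(xs, ys). S xs ys) =
    prb (map_pmf (\<lambda>(p, q). (snd p, snd q)) (block_pmf r m)) (\<lambda>(xs, ys). S xs ys)" by simp
  also have "\<dots> = prb (block_pmf r m) (\<lambda>((us, us'), (vs, vs')). S us' vs')"
    by (subst measure_map_pmf) (auto intro!: arg_cong[where f = "measure (measure_pmf _)"])
  finally show ?thesis by simp
qed

text \<open>A correct core transports the labels along \<open>\<sigma>\<close>, so
  \<open>chi\<close> is 1 and the density is at most \<open>2 * \<delta>\<close>. The two summands
  are the errors of the collision test and of the mismatch test.\<close>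

lemma block_completeness:
  fixes R :: real
  assumes m: "m > 0" and R: "R \<ge> 1" and r: "(real r)\<^sup>2 \<ge> R\<^sup>2 * m" and \<eta>: "\<eta> > 0" and \<tau>: "\<tau> > 0"
    and \<sigma>: "\<sigma> permutes {..<m}" and iso: "\<And>u v. \<lbrakk>u < m; v < m\<rbrakk> \<Longrightarrow> G u v = H (\<sigma> u) (\<sigma> v)"
    and cs: "\<And>x y. (x, y) \<in> set cs \<Longrightarrow> x < m \<and> y = \<sigma> x"
    and core: "\<And>u x. \<lbrakk>u < m; x < m; \<And>w. w \<in> fst ` set cs \<Longrightarrow> G u w = G x w \<and> G w u = G w x\<rbrakk> \<Longrightarrow>
      real (card {w. w < m \<and> (G u w \<noteq> G x w \<or> G w u \<noteq> G w x)}) \<le> \<delta> * m"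
  shows "prb (block_pmf r m) (block_rejects m r \<eta> \<tau> G H cs) \<le> 8 / (R * \<eta>\<^sup>2) + 2 * \<delta> / \<tau>"
proof -
  define l l' where "l = lab G (map fst cs)" and "l' = lab H (map snd cs)"
  interpret labels m l l' using m by unfold_locales
  have l: "l' (\<sigma> u) = l u" if "u < m" for u
    using cs iso that by (force simp: l_def l'_def lab_def)
  have Q: "chi m l l' = 1" using \<sigma> l by (rule isomorphic_labels)
  have few: "real (card {w. w < m \<and> (G u w \<noteq> G x w \<or> G w u \<noteq> G w x)}) \<le> \<delta> * m"
    if "u < m" "x < m" "l u = l x" for u x
    by (rule core) (use that in \<open>auto simp: l_def lab_def\<close>)
  have dens: "mismatch_density m l l' (\<lambda>u u' v v'. G u v \<noteq> H u' v') \<le> 2 * \<delta>"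
    by (rule isomorphic_mismatch_density[OF \<sigma> l iso few])
  have "R\<^sup>2 * m > 0" using R m by simp
  then have r0: "r > 0" using r by (cases "r = 0") auto
  have "prb (block_pmf r m) (block_rejects m r \<eta> \<tau> G H cs) =
    prb (block_pmf r m) (\<lambda>z. (case z of ((us, us'), (vs, vs')) \<Rightarrow> collision_stat m l l' us' vs' > (1 + \<eta>) * ((real r)\<^sup>2 / m)) \<or>
      (case z of ((us, us'), (vs, vs')) \<Rightarrow> \<tau> * ((real r)\<^sup>2 / m)\<^sup>2 \<le> mismatch_stat m l l' (\<lambda>u u' v v'. G u v \<noteq> H u' v') us us' vs vs'))"
    by (simp add: block_rejects_def l_def l'_def case_prod_unfold)
  also have "\<dots> \<le> 8 / (R * \<eta>\<^sup>2) + mismatch_density m l l' (\<lambda>u u' v v'. G u v \<noteq> H u' v') / \<tau>"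
    using collision_accepts[OF R r \<eta> Q] mismatch_accepts[OF \<tau> r0, of "\<lambda>u u' v v'. G u v \<noteq> H u' v'"]
      block_marginal[of r m "\<lambda>us' vs'. collision_stat m l l' us' vs' > (1 + \<eta>) * ((real r)\<^sup>2 / m)"]
    by (intro order.trans[OF prb_disj] add_mono) (simp_all add: case_prod_unfold)
  also have "\<dots> \<le> 8 / (R * \<eta>\<^sup>2) + 2 * \<delta> / \<tau>"
    using dens \<tau> by (intro add_left_mono divide_right_mono) auto
  finally show ?thesis .
qed

lemma weighted_bound_mono:
  fixes x y z t s M :: real
  assumes "\<not> 4 * s \<le> x" "y \<le> z" "0 \<le> M"
  shows "(2 * x + 2 * (t + y)) * M \<le> (8 * s + 2 * (t + z)) * M"
  using assms by (intro mult_right_mono) auto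

text \<open>Covers every candidate \<open>cs\<close>, right or wrong. If \<open>chi\<close> exceeds
  \<open>1 + 2 * \<eta>\<close>, the collision test rejects. Otherwise few vertices lack a
  label-mate, and a mismatch density below \<open>4 * \<tau>\<close> would yield a permutation that
  contradicts \<open>far\<close>; so the mismatch test rejects.\<close>

lemma block_soundness:
  fixes R :: real
  assumes m: "m > 0" and R: "R \<ge> 1" and r: "(real r)\<^sup>2 \<ge> R\<^sup>2 * m"
    and \<eta>: "0 < \<eta>" "\<eta> \<le> 1 / 2" and \<tau>: "\<tau> > 0" and t: "0 < t" "t \<le> 1"
    and far: "\<And>\<pi>. \<pi> permutes {..<m} \<Longrightarrow> real (mismatches m G H \<pi>) > (8 * \<tau> + 2 * (t + 2 * \<eta> / t)) * (real m)\<^sup>2"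
    and R1: "72 / (R * \<eta>\<^sup>2) \<le> 1 / 2" and R2: "16400 / (R * (4 * \<tau>)\<^sup>2) \<le> 7 / 16"
  shows "prb (block_pmf r m) (block_rejects m r \<eta> \<tau> G H cs) \<ge> 1 / 2"
proof -
  define l l' where "l = lab G (map fst cs)" and "l' = lab H (map snd cs)"
  interpret labels m l l' using m by unfold_locales
  let ?X = "\<lambda>u u' v v'. G u v \<noteq> H u' v'"
  have "prb (block_pmf r m) (\<lambda>z. \<not> block_rejects m r \<eta> \<tau> G H cs z) \<le> 1 / 2"
  proof (cases "chi m l l' > 1 + 2 * \<eta>")
    case True
    have "prb (block_pmf r m) (\<lambda>z. \<not> block_rejects m r \<eta> \<tau> G H cs z) \<le>
      prb (block_pmf r m) (\<lambda>((us, us'), (vs, vs')). \<not> collision_stat m l l' us' vs' > (1 + \<eta>) * ((real r)\<^sup>2 / m))"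
      by (intro prb_mono) (auto simp: block_rejects_def l_def l'_def)
    also have "\<dots> \<le> 72 / (R * \<eta>\<^sup>2)"
      unfolding block_marginal[of r m "\<lambda>us' vs'. \<not> collision_stat m l l' us' vs' > (1 + \<eta>) * ((real r)\<^sup>2 / m)"]
      using \<eta> by (intro collision_rejects[OF R r _ _ True]) auto
    finally show ?thesis using R1 by linarith
  next
    case False
    have "4 * \<tau> \<le> mismatch_density m l l' ?X"
    proof (rule ccontr)
      assume less: "\<not> 4 * \<tau> \<le> mismatch_density m l l' ?X"
      have "\<exists>\<pi>. \<pi> permutes {..<m} \<and> real (mismatches m G H \<pi>) \<le>
        (2 * mismatch_density m l l' ?X + 2 * (t + (chi m l l' - 1) / t)) * (real m)\<^sup>2"
        using t by (intro ex_permutation_few_mismatches) (auto simp: l_def l'_def lab_def)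
      then obtain \<pi> where \<pi>: "\<pi> permutes {..<m}" "real (mismatches m G H \<pi>) \<le>
        (2 * mismatch_density m l l' ?X + 2 * (t + (chi m l l' - 1) / t)) * (real m)\<^sup>2" by blast
      have "(2 * mismatch_density m l l' ?X + 2 * (t + (chi m l l' - 1) / t)) * (real m)\<^sup>2 \<le>
        (8 * \<tau> + 2 * (t + 2 * \<eta> / t)) * (real m)\<^sup>2"
      proof -
        show ?thesis by (rule weighted_bound_mono[OF less]) (use False t in \<open>auto intro: divide_right_mono\<close>)
      qed
      then show False using \<pi> far[OF \<pi>(1)] by linarith
    qed
    moreover have "chi m l l' \<le> 2" using False \<eta> by linarith
    ultimately have "prb (block_pmf r m)
      (\<lambda>((us, us'), (vs, vs')). \<not> 4 * \<tau> / 4 * ((real r)\<^sup>2 / m)\<^sup>2 \<le> mismatch_stat m l l' ?X us us' vs vs')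
      \<le> 1 / 16 + 16400 / (R * (4 * \<tau>)\<^sup>2)"
      using \<tau> by (intro mismatch_rejects[OF R r]) auto
    moreover have "prb (block_pmf r m) (\<lambda>z. \<not> block_rejects m r \<eta> \<tau> G H cs z) \<le>
      prb (block_pmf r m) (\<lambda>((us, us'), (vs, vs')). \<not> 4 * \<tau> / 4 * ((real r)\<^sup>2 / m)\<^sup>2 \<le> mismatch_stat m l l' ?X us us' vs vs')"
      by (intro prb_mono) (auto simp: block_rejects_def l_def l'_def)
    ultimately show ?thesis using R2 by linarith
  qed
  then show ?thesis by (simp add: prb_not)
qed

lemma set_replicate_pmfD: "xs \<in> set_pmf (replicate_pmf n p) \<Longrightarrow> x \<in> set xs \<Longrightarrow> x \<in> set_pmf p"
  by (auto simp: set_replicate_pmf)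

section \<open>Finding a core by birthday collisions\<close>

definition hits :: "(nat \<Rightarrow> nat) \<Rightarrow> nat list \<times> nat list \<Rightarrow> (nat \<times> nat) list" where
  "hits \<sigma> = (\<lambda>(xs, ys). concat (map (\<lambda>x. map (Pair x) (filter (\<lambda>y. y = \<sigma> x) ys)) xs))"

lemma set_hits: "set (hits \<sigma> z) = {(x, y). x \<in> set (fst z) \<and> y \<in> set (snd z) \<and> y = \<sigma> x}"
  by (auto simp: hits_def case_prod_unfold)

lemma length_hits: "real (length (hits \<sigma> (xs, ys))) = (\<Sum>x\<leftarrow>xs. \<Sum>y\<leftarrow>ys. of_bool (y = \<sigma> x))"
  by (induction xs) (simp_all add: hits_def length_filter_eq_sum_list)

lemma mean_length_hits:
  assumes m: "m > 0" and \<sigma>: "\<sigma> permutes {..<m}"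
  shows "mean (pair_pmf (iid r m) (iid r' m)) (\<lambda>z. real (length (hits \<sigma> z))) = real r * real r' / m"
proof -
  have "\<sigma> x < m" if "x < m" for x using permutes_in_image[OF \<sigma>, of x] that by simp
  then have "{..<m} \<inter> {y. y = \<sigma> x} = {\<sigma> x}" if "x < m" for x using that by auto
  then have "(\<Sum>x<m. mean (unif m) (\<lambda>y. of_bool (y = \<sigma> x))) = 1"
    using m by (simp add: mean_unif)
  then have "mean (unif m) (\<lambda>x. mean (unif m) (\<lambda>y. of_bool (y = \<sigma> x))) = 1 / m"
    by (simp only: mean_unif[OF m, of "\<lambda>x. mean (unif m) (\<lambda>y. of_bool (y = \<sigma> x))"])
  moreover have "(\<lambda>z. real (length (hits \<sigma> z))) = (\<lambda>(xs, ys). \<Sum>x\<leftarrow>xs. \<Sum>y\<leftarrow>ys. of_bool (y = \<sigma> x))"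
    by (auto simp: length_hits)
  ultimately show ?thesis using m by (simp add: mean_bipartite)
qed

text \<open>Second-moment method for the number of hits in \<open>W\<close>. With
  \<open>d = card W\<close> the relative variance is at most
  \<open>(m / (r * r') + 1 / r' + 1 / r) * (m / d)\<close>, hence at most
  \<open>3 / (R * \<delta>)\<close>; this is the origin of the 6.\<close>

lemma prb_no_hit:
  fixes R \<delta> :: real
  assumes m: "m > 0" and \<sigma>: "\<sigma> permutes {..<m}" and W: "W \<subseteq> {..<m}" "real (card W) \<ge> \<delta> * m"
    and \<delta>: "\<delta> > 0" and R: "R \<ge> 1" "R * \<delta> \<ge> 6" and r: "real r \<ge> R" "real r' \<ge> R" "real r * real r' \<ge> R\<^sup>2 * m"
  shows "prb (pair_pmf (iid r m) (iid r' m)) (\<lambda>(xs, ys). \<not> (\<exists>x\<in>set xs \<inter> W. \<sigma> x \<in> set ys)) \<le> 1 / 2"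
proof -
  let ?k = "\<lambda>x y. of_bool (x \<in> W \<and> y = \<sigma> x) :: real"
  let ?Z = "\<lambda>(xs, ys). \<Sum>x\<leftarrow>xs. \<Sum>y\<leftarrow>ys. ?k x y"
  let ?P = "pair_pmf (iid r m) (iid r' m)"
  define d where "d = real (card W)"
  have m': "real m > 0" using m by simp
  have d0: "d > 0" unfolding d_def by (rule less_le_trans[OF mult_pos_pos[OF \<delta> m'] W(2)])
  have rp: "real r > 0" "real r' > 0" using r R by linarith+
  have \<sigma>m: "\<sigma> x < m" if "x < m" for x using permutes_in_image[OF \<sigma>, of x] that by simp
  have row: "mean (unif m) (?k x) = of_bool (x \<in> W) / m" if "x < m" for x
  proof -
    have "{..<m} \<inter> {y. y = \<sigma> x} = {\<sigma> x}" using \<sigma>m[OF that] by auto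
    then show ?thesis using m by (simp add: mean_unif)
  qed
  have sumW: "(\<Sum>x<m. of_bool (x \<in> W) :: real) = d"
    using W by (simp add: d_def Int_absorb1)
  have sq: "(of_bool b)\<^sup>2 = (of_bool b :: real)" for b by simp
  have ee: "mean (unif m) (\<lambda>x. mean (unif m) (?k x)) = d / m\<^sup>2"
  proof -
    have "mean (unif m) (\<lambda>x. mean (unif m) (?k x)) = (\<Sum>x<m. of_bool (x \<in> W) / m) / m"
      using m row by (simp only: mean_unif) auto
    then show ?thesis using sumW by (simp add: power2_eq_square flip: sum_divide_distrib)
  qed
  have "mean (unif m) (\<lambda>x. (mean (unif m) (?k x))\<^sup>2) = (\<Sum>x<m. (of_bool (x \<in> W) / m)\<^sup>2) / m"
    unfolding mean_unif[OF m, of "\<lambda>x. (mean (unif m) (?k x))\<^sup>2"] using row by simp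
  then have e1: "mean (unif m) (\<lambda>x. (mean (unif m) (?k x))\<^sup>2) = d / m ^ 3"
    using sumW by (simp only: power_divide sq sum_divide_distrib[symmetric]) (simp add: power2_eq_square power3_eq_cube)
  have col: "(\<Sum>x<m. ?k x (\<sigma> y)) = of_bool (y \<in> W)" if "y < m" for y
  proof -
    have "(\<Sum>x<m. ?k x (\<sigma> y)) = (\<Sum>x<m. if x = y then of_bool (y \<in> W) else 0)"
      using permutes_inj[OF \<sigma>] by (intro sum.cong refl) (auto simp: inj_eq)
    then show ?thesis using that by simp
  qed
  have "mean (unif m) (\<lambda>y. (mean (unif m) (\<lambda>x. ?k x y))\<^sup>2) = (\<Sum>y<m. ((\<Sum>x<m. ?k x y) / m)\<^sup>2) / m"
    using m by (simp only: mean_unif)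
  also have "\<dots> = (\<Sum>y<m. ((\<Sum>x<m. ?k x (\<sigma> y)) / m)\<^sup>2) / m"
    using sum.permute[OF \<sigma>, of "\<lambda>y. ((\<Sum>x<m. ?k x y) / m)\<^sup>2"] by simp
  also have "\<dots> = (\<Sum>y<m. (of_bool (y \<in> W) / m)\<^sup>2) / m" using col by simp
  finally have e2: "mean (unif m) (\<lambda>y. (mean (unif m) (\<lambda>x. ?k x y))\<^sup>2) = d / m ^ 3"
    using sumW by (simp only: power_divide sq sum_divide_distrib[symmetric]) (simp add: power2_eq_square power3_eq_cube)
  define \<mu> where "\<mu> = real r * real r' * (d / m\<^sup>2)"
  define v where "v = real r * real r' * (d / m\<^sup>2) + (real r)\<^sup>2 * real r' * (d / m ^ 3) + real r * (real r')\<^sup>2 * (d / m ^ 3)"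
  have \<mu>0: "\<mu> > 0" using rp d0 m' by (simp add: \<mu>_def)
  have "prb ?P (\<lambda>(xs, ys). \<not> (\<exists>x\<in>set xs \<inter> W. \<sigma> x \<in> set ys)) \<le> prb ?P (\<lambda>z. \<mu> \<le> \<bar>?Z z - \<mu>\<bar>)"
  proof (intro prb_mono, clarify)
    fix xs ys assume no: "\<not> (\<exists>x\<in>set xs \<inter> W. \<sigma> x \<in> set ys)"
    have "(\<Sum>x\<leftarrow>xs. \<Sum>y\<leftarrow>ys. ?k x y) = (\<Sum>x\<leftarrow>xs. \<Sum>y\<leftarrow>ys. 0)"
      using no by (intro arg_cong[where f = sum_list] map_cong refl) auto
    then show "\<mu> \<le> \<bar>(\<Sum>x\<leftarrow>xs. \<Sum>y\<leftarrow>ys. ?k x y) - \<mu>\<bar>" by simp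
  qed
  also have "\<dots> \<le> v / \<mu>\<^sup>2"
  proof (rule prb_chebyshev[OF _ \<mu>0])
    show "mean ?P ?Z = \<mu>" unfolding \<mu>_def using m by (subst mean_bipartite) (simp_all add: ee)
    have "mean ?P (\<lambda>(xs, ys). (\<Sum>x\<leftarrow>xs. \<Sum>y\<leftarrow>ys. ?k x y)\<^sup>2) \<le> v + \<mu>\<^sup>2"
      using mean_bipartite_sq[of "unif m" "unif m" r r' ?k] m unfolding ee e1 e2 sq v_def \<mu>_def by simp
    then show "mean ?P (\<lambda>z. (?Z z)\<^sup>2) \<le> v + \<mu>\<^sup>2" by (simp add: case_prod_unfold)
  qed (use m in auto)
  also have "v / \<mu>\<^sup>2 = (m / (real r * real r') + 1 / r' + 1 / r) * (m / d)"
    using rp d0 m' by (simp add: v_def \<mu>_def field_simps power2_eq_square power3_eq_cube)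
  also have "\<dots> \<le> (3 / R) * (1 / \<delta>)"
  proof (intro mult_mono)
    have "m / (real r * real r') \<le> 1 / R\<^sup>2" using r(3) rp R(1) by (simp add: field_simps)
    also have "\<dots> \<le> 1 / R" using R(1) by (simp add: power2_eq_square field_simps)
    finally have a: "m / (real r * real r') \<le> 1 / R" .
    have "1 / r' \<le> 1 / R" "1 / r \<le> 1 / R" using r rp R(1) by (simp_all add: field_simps)
    then show "m / (real r * real r') + 1 / r' + 1 / r \<le> 3 / R" using a by linarith
    show "m / d \<le> 1 / \<delta>" using W(2) d0 \<delta> by (simp add: d_def field_simps)
  qed (use R d0 in auto)
  also have "\<dots> \<le> 1 / 2" using R \<delta> by (simp add: field_simps)
  finally show ?thesis .
qed

abbreviation group_pmf :: "nat \<Rightarrow> nat \<Rightarrow> nat \<Rightarrow> (nat list \<times> nat list) pmf" where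
  "group_pmf r r' m \<equiv> pair_pmf (iid r m) (iid r' m)"

text \<open>Depends on the unknown \<open>\<sigma>\<close> and so lives in the analysis only; when
  it is short, it is one of the candidates that the tester tries.\<close>

definition core_of :: "(nat \<Rightarrow> nat) \<Rightarrow> (nat list \<times> nat list) list \<Rightarrow> (nat \<times> nat) list" where
  "core_of \<sigma> hs = concat (map (hits \<sigma>) hs)"

lemma prb_core_too_long:
  assumes m: "m > 0" and \<sigma>: "\<sigma> permutes {..<m}" and c: "c > 0"
  shows "prb (replicate_pmf g (group_pmf r r' m)) (\<lambda>hs. length (core_of \<sigma> hs) > c) \<le> g * (real r * real r' / m) / c"
proof -
  have len: "real (length (core_of \<sigma> hs)) = (\<Sum>z\<leftarrow>hs. real (length (hits \<sigma> z)))" for hs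
    by (induction hs) (simp_all add: core_of_def)
  have "prb (replicate_pmf g (group_pmf r r' m)) (\<lambda>hs. length (core_of \<sigma> hs) > c) \<le>
    prb (replicate_pmf g (group_pmf r r' m)) (\<lambda>hs. real c \<le> (\<Sum>z\<leftarrow>hs. real (length (hits \<sigma> z))))"
    by (intro prb_mono) (simp flip: len)
  also have "\<dots> \<le> mean (replicate_pmf g (group_pmf r r' m)) (\<lambda>hs. \<Sum>z\<leftarrow>hs. real (length (hits \<sigma> z))) / c"
    by (intro prb_markov) (use m c in \<open>auto intro!: sum_list_nonneg\<close>)
  also have "\<dots> = g * (real r * real r' / m) / c"
    using m by (subst mean_replicate_sum_list) (auto simp: mean_length_hits[OF m \<sigma>])
  finally show ?thesis .
qed

text \<open>A group misses a given large set with probability at most 1/2, so \<open>g\<close>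
  independent groups all miss it with probability at most \<open>1 / 2 ^ g\<close>; a union bound
  covers the sets. In the application \<open>z\<close> is a pair of vertices and \<open>W z\<close>
  the set of vertices that tell them apart.\<close>

lemma prb_core_bad:
  fixes R \<delta> :: real
  assumes m: "m > 0" and \<sigma>: "\<sigma> permutes {..<m}"
    and \<delta>: "\<delta> > 0" and R: "R \<ge> 1" "R * \<delta> \<ge> 6" and r: "real r \<ge> R" "real r' \<ge> R" "real r * real r' \<ge> R\<^sup>2 * m"
  shows "prb (replicate_pmf g (group_pmf r r' m)) (\<lambda>hs. \<exists>z\<in>{..<m} \<times> {..<m}.
      real (card (W z)) \<ge> \<delta> * m \<and> W z \<subseteq> {..<m} \<and> fst ` set (core_of \<sigma> hs) \<inter> W z = {}) \<le> (real m)\<^sup>2 / 2 ^ g"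
proof -
  have "prb (replicate_pmf g (group_pmf r r' m)) (\<lambda>hs. \<exists>z\<in>{..<m} \<times> {..<m}.
      real (card (W z)) \<ge> \<delta> * m \<and> W z \<subseteq> {..<m} \<and> fst ` set (core_of \<sigma> hs) \<inter> W z = {}) \<le>
    card ({..<m} \<times> {..<m}) * (1 / 2 ^ g)"
  proof (intro prb_Bex_le)
    fix z
    show "prb (replicate_pmf g (group_pmf r r' m)) (\<lambda>hs. real (card (W z)) \<ge> \<delta> * m \<and> W z \<subseteq> {..<m} \<and>
      fst ` set (core_of \<sigma> hs) \<inter> W z = {}) \<le> 1 / 2 ^ g"
    proof (cases "real (card (W z)) \<ge> \<delta> * m \<and> W z \<subseteq> {..<m}")
      case True
      have "prb (replicate_pmf g (group_pmf r r' m)) (\<lambda>hs. real (card (W z)) \<ge> \<delta> * m \<and> W z \<subseteq> {..<m} \<and>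
          fst ` set (core_of \<sigma> hs) \<inter> W z = {}) \<le>
        prb (replicate_pmf g (group_pmf r r' m)) (\<lambda>hs. \<forall>h\<in>set hs. case h of (xs, ys) \<Rightarrow> \<not> (\<exists>x\<in>set xs \<inter> W z. \<sigma> x \<in> set ys))"
        by (intro prb_mono) (fastforce simp: core_of_def set_hits)
      also have "\<dots> = prb (group_pmf r r' m) (\<lambda>(xs, ys). \<not> (\<exists>x\<in>set xs \<inter> W z. \<sigma> x \<in> set ys)) ^ g"
        using m by (intro prb_replicate_all) simp
      also have "\<dots> \<le> (1 / 2) ^ g"
        using True by (intro power_mono prb_no_hit[OF m \<sigma> _ _ \<delta> R r]) auto
      finally show ?thesis by (simp add: power_divide)
    next
      case False
      then have "{hs. real (card (W z)) \<ge> \<delta> * m \<and> W z \<subseteq> {..<m} \<and> fst ` set (core_of \<sigma> hs) \<inter> W z = {}} = {}" by blast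
      then show ?thesis by (simp only: measure_empty) simp
    qed
  qed simp
  then show ?thesis by (simp add: power2_eq_square)
qed

section \<open>The complete test for one pair of graphs\<close>

definition pair_accepts :: "nat \<Rightarrow> nat \<Rightarrow> real \<Rightarrow> real \<Rightarrow> nat \<Rightarrow> nat \<Rightarrow> (nat \<Rightarrow> nat \<Rightarrow> bool) \<Rightarrow> (nat \<Rightarrow> nat \<Rightarrow> bool) \<Rightarrow>
    (nat list \<times> nat list) list \<Rightarrow> block list \<Rightarrow> bool" where
  "pair_accepts m r \<eta> \<tau> c k G H hs bs \<longleftrightarrow>
    (\<exists>cs. set cs \<subseteq> (\<Union>h\<in>set hs. set (fst h)) \<times> (\<Union>h\<in>set hs. set (snd h)) \<and> length cs \<le> c \<and>
      length (filter (block_rejects m r \<eta> \<tau> G H cs) bs) \<le> k)"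

text \<open>It is enough that the candidate \<open>core_of \<sigma> hs\<close> passes. Markov over
  \<open>8 * k\<close> blocks with limit \<open>k\<close> multiplies the error of a block by 8,
  whatever \<open>k\<close> is.\<close>

lemma pair_completeness:
  fixes R R' \<delta> :: real
  assumes m: "m > 0" and R: "R \<ge> 1" and r: "(real r)\<^sup>2 \<ge> R\<^sup>2 * m" and \<eta>: "\<eta> > 0" and \<tau>: "\<tau> > 0"
    and \<sigma>: "\<sigma> permutes {..<m}" and iso: "\<And>u v. \<lbrakk>u < m; v < m\<rbrakk> \<Longrightarrow> G u v = H (\<sigma> u) (\<sigma> v)"
    and c: "c > 0" and k: "k > 0" and \<delta>: "\<delta> > 0" and R': "R' \<ge> 1" "R' * \<delta> \<ge> 6"
    and a: "real a \<ge> R'" "real a' \<ge> R'" "real a * real a' \<ge> R'\<^sup>2 * m"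
  shows "prb (pair_pmf (replicate_pmf g (group_pmf a a' m)) (replicate_pmf (8 * k) (block_pmf r m)))
      (\<lambda>(hs, bs). \<not> pair_accepts m r \<eta> \<tau> c k G H hs bs)
    \<le> (g * (real a * real a' / m) / c + (real m)\<^sup>2 / 2 ^ g) + 8 * (8 / (R * \<eta>\<^sup>2) + 2 * \<delta> / \<tau>)"
proof (rule prb_pair_le)
  let ?W = "\<lambda>(u, x). {w. w < m \<and> (G u w \<noteq> G x w \<or> G w u \<noteq> G w x)}"
  let ?Good = "\<lambda>hs. \<not> (length (core_of \<sigma> hs) > c \<or>
    (\<exists>z\<in>{..<m} \<times> {..<m}. real (card (?W z)) \<ge> \<delta> * m \<and> ?W z \<subseteq> {..<m} \<and> fst ` set (core_of \<sigma> hs) \<inter> ?W z = {}))"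
  let ?P = "replicate_pmf g (group_pmf a a' m)"
  show "finite (set_pmf ?P)" "finite (set_pmf (replicate_pmf (8 * k) (block_pmf r m)))" using m by auto
  have "prb ?P (\<lambda>hs. \<not> ?Good hs) = prb ?P (\<lambda>hs. length (core_of \<sigma> hs) > c \<or>
    (\<exists>z\<in>{..<m} \<times> {..<m}. real (card (?W z)) \<ge> \<delta> * m \<and> ?W z \<subseteq> {..<m} \<and> fst ` set (core_of \<sigma> hs) \<inter> ?W z = {}))"
    by (simp only: not_not)
  also have "\<dots> \<le> g * (real a * real a' / m) / c + (real m)\<^sup>2 / 2 ^ g"
    by (rule order.trans[OF prb_disj add_mono[OF prb_core_too_long[OF m \<sigma> c] prb_core_bad[OF m \<sigma> \<delta> R' a]]])
  finally show "prb ?P (\<lambda>hs. \<not> ?Good hs) \<le> g * (real a * real a' / m) / c + (real m)\<^sup>2 / 2 ^ g" .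
  show "0 \<le> 8 * (8 / (R * \<eta>\<^sup>2) + 2 * \<delta> / \<tau>)" using R \<eta> \<delta> \<tau> by simp
  fix hs assume hs: "hs \<in> set_pmf ?P" and good: "?Good hs"
  let ?cs = "core_of \<sigma> hs"
  have sub: "set ?cs \<subseteq> (\<Union>h\<in>set hs. set (fst h)) \<times> (\<Union>h\<in>set hs. set (snd h))"
    by (auto simp: core_of_def set_hits)
  have hm: "set (fst h) \<subseteq> {..<m}" if "h \<in> set hs" for h
  proof -
    have "h \<in> set_pmf (group_pmf a a' m)" using hs that by (rule set_replicate_pmfD)
    then show "set (fst h) \<subseteq> {..<m}" using m by (auto simp: set_iid)
  qed
  have "prb (replicate_pmf (8 * k) (block_pmf r m)) (\<lambda>bs. \<not> pair_accepts m r \<eta> \<tau> c k G H hs bs) \<le>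
    prb (replicate_pmf (8 * k) (block_pmf r m)) (\<lambda>bs. length (filter (block_rejects m r \<eta> \<tau> G H ?cs) bs) > k)"
    using sub good by (intro prb_mono) (auto simp: pair_accepts_def not_le)
  also have "\<dots> \<le> real (8 * k) * prb (block_pmf r m) (block_rejects m r \<eta> \<tau> G H ?cs) / k"
    using m k by (intro prb_replicate_many) auto
  also have "\<dots> = 8 * prb (block_pmf r m) (block_rejects m r \<eta> \<tau> G H ?cs)" using k by simp
  also have "\<dots> \<le> 8 * (8 / (R * \<eta>\<^sup>2) + 2 * \<delta> / \<tau>)"
  proof (intro mult_left_mono block_completeness[where G = G and H = H, OF m R r \<eta> \<tau> \<sigma> iso])
    show "x < m \<and> y = \<sigma> x" if "(x, y) \<in> set ?cs" for x y
      using that hm by (auto simp: core_of_def set_hits)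
    fix u x assume ux: "u < m" "x < m" and eq: "\<And>w. w \<in> fst ` set ?cs \<Longrightarrow> G u w = G x w \<and> G w u = G w x"
    have "fst ` set ?cs \<inter> ?W (u, x) = {}" using eq by auto
    moreover have "?W (u, x) \<subseteq> {..<m}" "(u, x) \<in> {..<m} \<times> {..<m}" using ux by auto
    ultimately have "\<not> real (card (?W (u, x))) \<ge> \<delta> * m" using good by blast
    then show "real (card {w. w < m \<and> (G u w \<noteq> G x w \<or> G w u \<noteq> G w x)}) \<le> \<delta> * m" by simp
  qed auto
  finally show "prb (replicate_pmf (8 * k) (block_pmf r m)) (\<lambda>y. case (hs, y) of (hs, bs) \<Rightarrow> \<not> pair_accepts m r \<eta> \<tau> c k G H hs bs)
    \<le> 8 * (8 / (R * \<eta>\<^sup>2) + 2 * \<delta> / \<tau>)" by simp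
qed

lemma sum_power_le: "(\<Sum>i\<le>c. M ^ i) \<le> (M + 1) ^ c" for M :: nat
proof (induction c)
  case (Suc c)
  have "(\<Sum>i\<le>Suc c. M ^ i) = (\<Sum>i\<le>c. M ^ i) + M * M ^ c" by simp
  also have "\<dots> \<le> (M + 1) ^ c + M * (M + 1) ^ c" by (intro add_mono Suc mult_left_mono power_mono) auto
  finally show ?case by simp
qed simp

text \<open>The union bound runs over all lists of at most \<open>c\<close> pairs of vertices. This
  set is fixed before \<open>hs\<close> and the blocks are drawn, so the same blocks can judge all
  candidates.\<close>

lemma pair_soundness:
  fixes R :: real
  assumes m: "m > 0" and R: "R \<ge> 1" and r: "(real r)\<^sup>2 \<ge> R\<^sup>2 * m"
    and \<eta>: "0 < \<eta>" "\<eta> \<le> 1 / 2" and \<tau>: "\<tau> > 0" and t: "0 < t" "t \<le> 1"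
    and far: "\<And>\<pi>. \<pi> permutes {..<m} \<Longrightarrow> real (mismatches m G H \<pi>) > (8 * \<tau> + 2 * (t + 2 * \<eta> / t)) * (real m)\<^sup>2"
    and R1: "72 / (R * \<eta>\<^sup>2) \<le> 1 / 2" and R2: "16400 / (R * (4 * \<tau>)\<^sup>2) \<le> 7 / 16"
  shows "prb (pair_pmf (replicate_pmf g (group_pmf a a' m)) (replicate_pmf (8 * k) (block_pmf r m)))
      (\<lambda>(hs, bs). pair_accepts m r \<eta> \<tau> c k G H hs bs) \<le> (real m * real m + 1) ^ c / 4 ^ k"
proof -
  let ?P = "replicate_pmf g (group_pmf a a' m)" and ?B = "replicate_pmf (8 * k) (block_pmf r m)"
  let ?C = "{cs. set cs \<subseteq> {..<m} \<times> {..<m} \<and> length cs \<le> c}"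
  have "card ?C \<le> (m * m + 1) ^ c"
    by (subst card_lists_length_le) (use sum_power_le[of "m * m" c] in auto)
  then have "real (card ?C) \<le> real ((m * m + 1) ^ c)" by (rule of_nat_mono)
  then have C: "real (card ?C) \<le> (real m * real m + 1) ^ c" by (simp add: add.commute)
  have finC: "finite ?C" by (rule finite_lists_length_le) simp
  have "prb ?B (\<lambda>bs. pair_accepts m r \<eta> \<tau> c k G H hs bs) \<le> (real m * real m + 1) ^ c / 4 ^ k"
    if hs: "hs \<in> set_pmf ?P" for hs
  proof -
    have hm: "set (fst h) \<subseteq> {..<m}" "set (snd h) \<subseteq> {..<m}" if "h \<in> set hs" for h
    proof -
      have "h \<in> set_pmf (group_pmf a a' m)" using hs that by (rule set_replicate_pmfD)
      then show "set (fst h) \<subseteq> {..<m}" "set (snd h) \<subseteq> {..<m}" using m by (auto simp: set_iid)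
    qed
    have "prb ?B (\<lambda>bs. pair_accepts m r \<eta> \<tau> c k G H hs bs) \<le>
      prb ?B (\<lambda>bs. \<exists>cs\<in>?C. length (filter (block_rejects m r \<eta> \<tau> G H cs) bs) \<le> k)"
    proof (intro prb_mono)
      fix bs assume "pair_accepts m r \<eta> \<tau> c k G H hs bs"
      then obtain cs where cs: "set cs \<subseteq> (\<Union>h\<in>set hs. set (fst h)) \<times> (\<Union>h\<in>set hs. set (snd h))" "length cs \<le> c"
          "length (filter (block_rejects m r \<eta> \<tau> G H cs) bs) \<le> k"
        unfolding pair_accepts_def by blast
      have "(\<Union>h\<in>set hs. set (fst h)) \<times> (\<Union>h\<in>set hs. set (snd h)) \<subseteq> {..<m} \<times> {..<m}" using hm by blast
      then show "\<exists>cs\<in>?C. length (filter (block_rejects m r \<eta> \<tau> G H cs) bs) \<le> k" using cs by blast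
    qed
    also have "\<dots> \<le> real (card ?C) * (1 / 4 ^ k)"
      using m by (intro prb_Bex_le finC prb_replicate_few block_soundness[OF m R r \<eta> \<tau> t far R1 R2]) auto
    also have "\<dots> \<le> (real m * real m + 1) ^ c * (1 / 4 ^ k)" by (intro mult_right_mono C) auto
    finally show ?thesis by simp
  qed
  then show ?thesis using m by (subst prb_pair) (auto intro!: mean_le_const)
qed

section \<open>Query trees, relabelled strings and distances\<close>

text \<open>A nonadaptive algorithm: the positions in \<open>S\<close> are queried one after
  another, and each answer is substituted into \<open>\<Phi>\<close>.\<close>

lemma ex_query_tree:
  assumes "finite S" "\<And>i j. (i, j) \<in> S \<Longrightarrow> i < s \<and> j < n"
    and "\<And>\<alpha> \<beta>. (\<And>z. z \<in> S \<Longrightarrow> \<alpha> z = \<beta> z) \<Longrightarrow> \<Phi> \<alpha> = \<Phi> \<beta>"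
  shows "\<exists>t. legal_queries s n t \<and> num_queries t \<le> card S \<and> (\<forall>X. accepts t X \<longleftrightarrow> \<Phi> (\<lambda>(i, j). X i ! j))"
  using assms
proof (induction S arbitrary: \<Phi> rule: finite_induct)
  case empty
  have "\<Phi> \<alpha> = \<Phi> (\<lambda>_. False)" for \<alpha> by (rule empty(2)) simp
  then show ?case by (intro exI[of _ "Verdict (\<Phi> (\<lambda>_. False))"]) (metis accepts.simps(1) legal_queries.simps(1) num_queries.simps(1) le0)
next
  case (insert z S)
  obtain i j where z: "z = (i, j)" by force
  have "\<exists>t. legal_queries s n t \<and> num_queries t \<le> card S \<and> (\<forall>X. accepts t X \<longleftrightarrow> \<Phi> ((\<lambda>(i, j). X i ! j)(z := b)))" for b
  proof (rule insert.IH[of "\<lambda>\<alpha>. \<Phi> (\<alpha>(z := b))"])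
    fix \<alpha> \<beta> :: "nat \<times> nat \<Rightarrow> bool" assume "\<And>x. x \<in> S \<Longrightarrow> \<alpha> x = \<beta> x"
    then show "\<Phi> (\<alpha>(z := b)) = \<Phi> (\<beta>(z := b))" by (intro insert.prems(2)) auto
  qed (use insert.prems(1) in auto)
  then obtain t where t: "legal_queries s n (t b)" "num_queries (t b) \<le> card S"
      "accepts (t b) X \<longleftrightarrow> \<Phi> ((\<lambda>(i, j). X i ! j)(z := b))" for b X
    by metis
  have same: "\<Phi> (\<alpha>(z := \<alpha> z)) = \<Phi> \<alpha>" for \<alpha> by simp
  have "accepts (Query i j (t False) (t True)) X \<longleftrightarrow> \<Phi> (\<lambda>(i, j). X i ! j)" for X
    using same[of "\<lambda>(i, j). X i ! j"] t(3)[of "X i ! j" X] by (cases "X i ! j") (auto simp: z)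
  then show ?case
    using insert.prems(1)[of i j] insert.hyps t(1,2)
    by (intro exI[of _ "Query i j (t False) (t True)"]) (auto simp: z)
qed

section \<open>Adjacency strings and graph isomorphism\<close>

definition gr :: "nat \<Rightarrow> bool list \<Rightarrow> nat \<Rightarrow> nat \<Rightarrow> bool" where
  "gr m x u v = x ! (u * m + v)"

lemma index_less: "\<lbrakk>u < m; v < m\<rbrakk> \<Longrightarrow> u * m + v < m\<^sup>2" for u v m :: nat
proof -
  assume "u < m" "v < m"
  then have "u * m + v < (u + 1) * m" by simp
  also have "\<dots> \<le> m * m" using \<open>u < m\<close> by (intro mult_right_mono) auto
  finally show ?thesis by (simp add: power2_eq_square)
qed

text \<open>Tail and head in both graphs are the projections of pairs, so the vertex map of the
  isomorphism forces its arc map. Extended by the identity, the vertex map is a permutation.\<close>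

lemma digraph_iso_imp_permutation:
  assumes "digraph_iso (with_proj (graph_of m y)) (with_proj (graph_of m x))"
  shows "\<exists>\<sigma>. \<sigma> permutes {..<m} \<and> (\<forall>u<m. \<forall>v<m. gr m y u v = gr m x (\<sigma> u) (\<sigma> v))"
proof -
  let ?Y = "with_proj (graph_of m y)" and ?X = "with_proj (graph_of m x)"
  obtain f where f: "pre_digraph.digraph_isomorphism ?Y f" and X: "?X = app_iso f ?Y"
    using assms unfolding digraph_iso_def by blast
  define \<sigma> where "\<sigma> v = (if v < m then iso_verts f v else v)" for v
  have inj: "inj_on (iso_verts f) {..<m}" and
    arc: "\<And>a. a \<in> parcs (graph_of m y) \<Longrightarrow> iso_verts f (fst a) = iso_tail f (iso_arcs f a) \<and> iso_verts f (snd a) = iso_head f (iso_arcs f a)"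
    using f unfolding pre_digraph.digraph_isomorphism_def by (auto simp: graph_of_def)
  have "verts ?X = iso_verts f ` verts ?Y" "arcs ?X = iso_arcs f ` arcs ?Y" "tail ?X = iso_tail f" "head ?X = iso_head f"
    unfolding X by (simp_all add: app_iso_def)
  then have verts: "{..<m} = iso_verts f ` {..<m}" and arcs: "parcs (graph_of m x) = iso_arcs f ` parcs (graph_of m y)"
    and th: "fst = iso_tail f" "snd = iso_head f"
    by (simp_all add: graph_of_def)
  have "bij_betw (iso_verts f) {..<m} {..<m}" using inj verts by (auto simp: bij_betw_def)
  then have "bij_betw \<sigma> {..<m} {..<m}" by (subst bij_betw_cong[of _ _ "iso_verts f"]) (auto simp: \<sigma>_def)
  then have perm: "\<sigma> permutes {..<m}" by (rule bij_imp_permutes) (simp add: \<sigma>_def)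
  have iarc: "iso_arcs f (u, v) = (\<sigma> u, \<sigma> v)" if "(u, v) \<in> parcs (graph_of m y)" for u v
  proof -
    have "u < m" "v < m" using that by (auto simp: graph_of_def)
    then show ?thesis using arc[OF that] by (intro prod_eqI) (simp_all add: \<sigma>_def flip: th)
  qed
  have "gr m y u v = gr m x (\<sigma> u) (\<sigma> v)" if uv: "u < m" "v < m" for u v
  proof -
    have "\<sigma> u < m" "\<sigma> v < m" using uv permutes_in_image[OF perm] by auto
    then have x: "gr m x (\<sigma> u) (\<sigma> v) \<longleftrightarrow> (\<sigma> u, \<sigma> v) \<in> parcs (graph_of m x)" by (simp add: gr_def graph_of_def)
    have y: "gr m y u v \<longleftrightarrow> (u, v) \<in> parcs (graph_of m y)" using uv by (simp add: gr_def graph_of_def)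
    show ?thesis
    proof
      assume "gr m y u v"
      then have "(u, v) \<in> parcs (graph_of m y)" using y by simp
      then have "(\<sigma> u, \<sigma> v) \<in> parcs (graph_of m x)"
        unfolding arcs by (intro image_eqI[of _ _ "(u, v)"]) (simp_all add: iarc)
      then show "gr m x (\<sigma> u) (\<sigma> v)" using x by simp
    next
      assume "gr m x (\<sigma> u) (\<sigma> v)"
      then obtain a where a: "a \<in> parcs (graph_of m y)" "iso_arcs f a = (\<sigma> u, \<sigma> v)" using x arcs by auto
      obtain u' v' where a': "a = (u', v')" by force
      have "\<sigma> u' = \<sigma> u" "\<sigma> v' = \<sigma> v" using iarc[of u' v'] a a' by auto
      then have "u' = u" "v' = v" using permutes_inj[OF perm] by (auto simp: inj_eq)
      then show "gr m y u v" using a a' y by simp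
    qed
  qed
  then show ?thesis using perm by blast
qed

definition perm_string :: "nat \<Rightarrow> bool list \<Rightarrow> (nat \<Rightarrow> nat) \<Rightarrow> bool list" where
  "perm_string m x \<pi> = map (\<lambda>i. x ! (\<pi> (i div m) * m + \<pi> (i mod m))) [0..<m\<^sup>2]"

lemma length_perm_string [simp]: "length (perm_string m x \<pi>) = m\<^sup>2"
  by (simp add: perm_string_def)

lemma gr_perm_string: "\<lbrakk>u < m; v < m\<rbrakk> \<Longrightarrow> gr m (perm_string m x \<pi>) u v = gr m x (\<pi> u) (\<pi> v)"
  by (simp add: perm_string_def gr_def index_less)

lemma digraph_iso_perm_string:
  assumes \<pi>: "\<pi> permutes {..<m}"
  shows "digraph_iso (with_proj (graph_of m (perm_string m x \<pi>))) (with_proj (graph_of m x))"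
proof -
  let ?f = "\<lparr>iso_verts = \<pi>, iso_arcs = map_prod \<pi> \<pi>, iso_head = snd, iso_tail = fst\<rparr>"
  let ?Y = "with_proj (graph_of m (perm_string m x \<pi>))"
  have par: "parcs (graph_of m z) = {(u, v). u < m \<and> v < m \<and> gr m z u v}" for z
    by (simp add: graph_of_def gr_def)
  have lt: "\<pi> u < m \<longleftrightarrow> u < m" for u using permutes_in_image[OF \<pi>, of u] by simp
  have "inj \<pi>" using permutes_inj[OF \<pi>] .
  then have "inj (map_prod \<pi> \<pi>)" by (rule prod.inj_map) (rule \<open>inj \<pi>\<close>)
  have "pre_digraph.digraph_isomorphism ?Y ?f"
    unfolding pre_digraph.digraph_isomorphism_def
    using \<open>inj \<pi>\<close> \<open>inj (map_prod \<pi> \<pi>)\<close> by (auto simp: graph_of_def wf_digraph_def intro: inj_on_subset)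
  moreover have "with_proj (graph_of m x) = app_iso ?f ?Y"
  proof (rule pre_digraph.equality)
    show "verts (with_proj (graph_of m x)) = verts (app_iso ?f ?Y)"
      using permutes_image[OF \<pi>] by (simp add: app_iso_def graph_of_def)
    have "{(u, v). u < m \<and> v < m \<and> gr m x u v} = map_prod \<pi> \<pi> ` {(u, v). u < m \<and> v < m \<and> gr m (perm_string m x \<pi>) u v}"
    proof (intro equalityI subsetI)
      fix a assume "a \<in> {(u, v). u < m \<and> v < m \<and> gr m x u v}"
      then obtain u v where a: "a = (u, v)" "u < m" "v < m" "gr m x u v" by auto
      obtain u' v' where "u = \<pi> u'" "v = \<pi> v'" using permutes_surj[OF \<pi>] by (metis surjD)
      then show "a \<in> map_prod \<pi> \<pi> ` {(u, v). u < m \<and> v < m \<and> gr m (perm_string m x \<pi>) u v}"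
        using a lt by (intro image_eqI[of _ _ "(u', v')"]) (auto simp: gr_perm_string)
    qed (auto simp: gr_perm_string lt)
    then show "arcs (with_proj (graph_of m x)) = arcs (app_iso ?f ?Y)"
      by (simp add: app_iso_def par)
  qed (simp_all add: app_iso_def)
  ultimately show ?thesis unfolding digraph_iso_def by blast
qed

lemma finite_bitstrings [simp]: "finite (bitstrings n)"
  using finite_lists_length_eq[of "UNIV :: bool set" n] by (simp add: bitstrings_def)

lemma rel_hamming_bounds: "0 \<le> rel_hamming n x y" "rel_hamming n x y \<le> 1"
proof -
  have "card {i. i < n \<and> x ! i \<noteq> y ! i} \<le> card {..<n}" by (intro card_mono) auto
  then show "0 \<le> rel_hamming n x y" "rel_hamming n x y \<le> 1" by (auto simp: rel_hamming_def divide_le_eq)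
qed

lemma rel_hamming_perm_string:
  assumes m: "m > 0"
  shows "rel_hamming (m\<^sup>2) y (perm_string m x \<pi>) = mismatches m (gr m x) (gr m y) \<pi> / (real m)\<^sup>2"
proof -
  let ?S = "{i. i < m\<^sup>2 \<and> y ! i \<noteq> perm_string m x \<pi> ! i}"
  let ?M = "{(u, v). u < m \<and> v < m \<and> gr m x (\<pi> u) (\<pi> v) \<noteq> gr m y u v}"
  have "bij_betw (\<lambda>(u, v). u * m + v) ?M ?S"
  proof (rule bij_betw_byWitness[where f' = "\<lambda>i. (i div m, i mod m)"])
    show "(\<lambda>(u, v). u * m + v) ` ?M \<subseteq> ?S"
      by (auto simp: index_less gr_def perm_string_def)
    have "i div m < m" if "i < m\<^sup>2" for i
      using that m by (simp add: less_mult_imp_div_less power2_eq_square)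
    then show "(\<lambda>i. (i div m, i mod m)) ` ?S \<subseteq> ?M"
      using m by (auto simp: gr_def perm_string_def)
  qed (use m in auto)
  then have "card ?M = card ?S" by (rule bij_betw_same_card)
  then show ?thesis by (simp add: rel_hamming_def mismatches_def)
qed

text \<open>The law of \<open>x\<close> relabelled by \<open>\<pi> y\<close>, with \<open>y\<close>
  drawn from \<open>P\<close>, lies in \<open>D_iso m\<close>. Coupling \<open>y\<close> with its
  own relabelling of \<open>x\<close> is one transport plan, so its cost is at least the
  distance.\<close>

lemma far_from_D_iso:
  assumes m: "m > 0" and P: "P \<in> distributions (m\<^sup>2)" and far: "far_from (m\<^sup>2) \<epsilon> P (D_iso m)"
    and x: "x \<in> bitstrings (m\<^sup>2)" and \<pi>: "\<And>y. \<pi> y permutes {..<m}"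
  shows "mean P (\<lambda>y. mismatches m (gr m x) (gr m y) (\<pi> y) / (real m)\<^sup>2) > \<epsilon>"
proof -
  let ?n = "m\<^sup>2"
  define f where "f y = perm_string m x (\<pi> y)" for y
  define Q where "Q = map_pmf f P"
  have fb: "f y \<in> bitstrings ?n" for y by (simp add: f_def bitstrings_def)
  have supp: "set_pmf P \<subseteq> bitstrings ?n" using P by (simp add: distributions_def)
  have "Q \<in> D_iso_of m x"
    using fb digraph_iso_perm_string[OF \<pi>] by (auto simp: D_iso_of_def distributions_def Q_def f_def)
  then have "Q \<in> D_iso m" using x by (auto simp: D_iso_def)
  then have gt: "dist_distance ?n P Q > \<epsilon>" using far by (simp add: far_from_def)
  define w where "w x y = pmf P x * of_bool (y = f x)" for x y
  have sumP: "(\<Sum>z\<in>bitstrings ?n. pmf P z * h z) = mean P h" for h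
    using supp by (subst integral_measure_pmf[of "bitstrings ?n"]) auto
  have "w \<in> couplings ?n P Q"
  proof -
    have 1: "(\<Sum>y\<in>bitstrings ?n. w z y) = pmf P z" for z
    proof -
      have "(\<Sum>y\<in>bitstrings ?n. w z y) = (\<Sum>y\<in>bitstrings ?n. if y = f z then pmf P z else 0)"
        by (intro sum.cong refl) (simp add: w_def)
      then show ?thesis using fb[of z] by simp
    qed
    have 2: "(\<Sum>z\<in>bitstrings ?n. w z y) = pmf Q y" for y
    proof -
      have "(\<Sum>z\<in>bitstrings ?n. w z y) = prb P (\<lambda>z. y = f z)"
        unfolding w_def sumP prb_eq_mean ..
      also have "{z. y = f z} = f -` {y}" by auto
      finally show ?thesis by (simp add: Q_def pmf_map)
    qed
    show ?thesis using 1 2 by (auto simp: couplings_def w_def)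
  qed
  then have "dist_distance ?n P Q \<le> (\<Sum>z\<in>bitstrings ?n. \<Sum>y\<in>bitstrings ?n. w z y * rel_hamming ?n z y)"
    unfolding dist_distance_def
  proof (rule cINF_lower[rotated])
    show "bdd_below ((\<lambda>w. \<Sum>z\<in>bitstrings ?n. \<Sum>y\<in>bitstrings ?n. w z y * rel_hamming ?n z y) ` couplings ?n P Q)"
      by (rule bdd_belowI2[of _ 0]) (auto simp: couplings_def intro!: sum_nonneg mult_nonneg_nonneg rel_hamming_bounds)
  qed
  also have "\<dots> = (\<Sum>z\<in>bitstrings ?n. pmf P z * rel_hamming ?n z (f z))"
  proof (intro sum.cong refl)
    fix z
    have "(\<Sum>y\<in>bitstrings ?n. w z y * rel_hamming ?n z y) =
      (\<Sum>y\<in>bitstrings ?n. if y = f z then pmf P z * rel_hamming ?n z (f z) else 0)"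
      by (intro sum.cong refl) (simp add: w_def)
    then show "(\<Sum>y\<in>bitstrings ?n. w z y * rel_hamming ?n z y) = pmf P z * rel_hamming ?n z (f z)"
      using fb[of z] by simp
  qed
  also have "\<dots> = mean P (\<lambda>y. mismatches m (gr m x) (gr m y) (\<pi> y) / (real m)\<^sup>2)"
    unfolding sumP f_def rel_hamming_perm_string[OF m] ..
  finally show ?thesis using gt by simp
qed

lemma mismatches_le: "real (mismatches m G H \<pi>) \<le> (real m)\<^sup>2"
proof -
  have "mismatches m G H \<pi> \<le> card ({..<m} \<times> {..<m})"
    unfolding mismatches_def by (intro card_mono) auto
  then have "real (mismatches m G H \<pi>) \<le> real (m * m)" by (simp only: card_cartesian_product card_lessThan of_nat_le_iff)
  then show ?thesis by (simp add: power2_eq_square)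
qed

lemma not_far_from_D_iso:
  assumes "m > 0" "P \<in> distributions (m\<^sup>2)" "\<epsilon> \<ge> 1"
  shows "\<not> far_from (m\<^sup>2) \<epsilon> P (D_iso m)"
proof
  assume far: "far_from (m\<^sup>2) \<epsilon> P (D_iso m)"
  have "replicate (m\<^sup>2) False \<in> bitstrings (m\<^sup>2)" by (simp add: bitstrings_def)
  from far_from_D_iso[OF assms(1,2) far this permutes_id]
  have "\<epsilon> < mean P (\<lambda>y. mismatches m (gr m (replicate (m\<^sup>2) False)) (gr m y) id / (real m)\<^sup>2)" .
  also have "\<dots> \<le> 1"
  proof (rule mean_le_const)
    show "finite (set_pmf P)" using assms finite_subset[OF _ finite_bitstrings] by (auto simp: distributions_def)
  qed (use mismatches_le assms(1) in \<open>simp add: divide_le_eq\<close>)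
  finally show False using assms by simp
qed

section \<open>Samples far from every relabelling of the first\<close>

definition near :: "nat \<Rightarrow> real \<Rightarrow> bool list \<Rightarrow> bool list \<Rightarrow> bool" where
  "near m \<gamma> x y \<longleftrightarrow> (\<exists>\<pi>. \<pi> permutes {..<m} \<and> real (mismatches m (gr m x) (gr m y) \<pi>) \<le> \<gamma> * (real m)\<^sup>2)"

text \<open>Each \<open>y\<close> is given a permutation with few mismatches whenever there is one.
  The cost is then at most \<open>\<epsilon> / 2\<close> on near strings and at most 1 elsewhere,
  yet its mean exceeds \<open>\<epsilon>\<close>.\<close>

lemma prb_near:
  assumes m: "m > 0" and P: "P \<in> distributions (m\<^sup>2)" and far: "far_from (m\<^sup>2) \<epsilon> P (D_iso m)"
    and x: "x \<in> bitstrings (m\<^sup>2)" and \<epsilon>: "\<epsilon> > 0"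
  shows "prb P (near m (\<epsilon> / 2) x) \<le> 1 - \<epsilon> / 2"
proof -
  define \<pi> where "\<pi> y = (if near m (\<epsilon> / 2) x y
    then SOME \<pi>. \<pi> permutes {..<m} \<and> real (mismatches m (gr m x) (gr m y) \<pi>) \<le> \<epsilon> / 2 * (real m)\<^sup>2 else id)" for y
  have some: "\<pi> y permutes {..<m} \<and> real (mismatches m (gr m x) (gr m y) (\<pi> y)) \<le> \<epsilon> / 2 * (real m)\<^sup>2"
    if "near m (\<epsilon> / 2) x y" for y
    using someI_ex[OF that[unfolded near_def]] that by (simp add: \<pi>_def)
  have perm: "\<pi> y permutes {..<m}" for y
    using some[of y] by (cases "near m (\<epsilon> / 2) x y") (auto simp: \<pi>_def permutes_id)
  have fin: "finite (set_pmf P)" using P finite_subset[OF _ finite_bitstrings] by (auto simp: distributions_def)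
  have "\<epsilon> < mean P (\<lambda>y. mismatches m (gr m x) (gr m y) (\<pi> y) / (real m)\<^sup>2)"
    by (rule far_from_D_iso[OF m P far x perm])
  also have "\<dots> \<le> mean P (\<lambda>y. of_bool (\<not> near m (\<epsilon> / 2) x y) + \<epsilon> / 2)"
  proof (intro mean_mono fin)
    fix y
    show "mismatches m (gr m x) (gr m y) (\<pi> y) / (real m)\<^sup>2 \<le> of_bool (\<not> near m (\<epsilon> / 2) x y) + \<epsilon> / 2"
    proof (cases "near m (\<epsilon> / 2) x y")
      case True
      then show ?thesis using some[OF True] m by (simp add: divide_le_eq)
    next
      case False
      have "mismatches m (gr m x) (gr m y) (\<pi> y) / (real m)\<^sup>2 \<le> 1" using mismatches_le m by (simp add: divide_le_eq)
      then show ?thesis using False \<epsilon> by simp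
    qed
  qed
  also have "\<dots> = prb P (\<lambda>y. \<not> near m (\<epsilon> / 2) x y) + \<epsilon> / 2" using fin by (simp add: mean_add prb_eq_mean)
  also have "\<dots> = 1 - prb P (near m (\<epsilon> / 2) x) + \<epsilon> / 2" by (simp add: prb_not)
  finally show ?thesis by simp
qed

lemma D_iso_isomorphic:
  assumes "P \<in> D_iso m" "x \<in> set_pmf P" "y \<in> set_pmf P"
  shows "\<exists>\<sigma>. \<sigma> permutes {..<m} \<and> (\<forall>u<m. \<forall>v<m. gr m x u v = gr m y (\<sigma> u) (\<sigma> v))"
proof -
  obtain z where z: "\<And>y. y \<in> set_pmf P \<Longrightarrow> digraph_iso (with_proj (graph_of m y)) (with_proj (graph_of m z))"
    using assms(1) by (auto simp: D_iso_def D_iso_of_def)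
  obtain \<sigma> where \<sigma>: "\<sigma> permutes {..<m}" "\<And>u v. \<lbrakk>u < m; v < m\<rbrakk> \<Longrightarrow> gr m x u v = gr m z (\<sigma> u) (\<sigma> v)"
    using digraph_iso_imp_permutation[OF z[OF assms(2)]] by blast
  obtain \<tau> where \<tau>: "\<tau> permutes {..<m}" "\<And>u v. \<lbrakk>u < m; v < m\<rbrakk> \<Longrightarrow> gr m y u v = gr m z (\<tau> u) (\<tau> v)"
    using digraph_iso_imp_permutation[OF z[OF assms(3)]] by blast
  have perm: "inv \<tau> \<circ> \<sigma> permutes {..<m}" using \<sigma>(1) \<tau>(1) by (intro permutes_compose permutes_inv)
  have "gr m x u v = gr m y ((inv \<tau> \<circ> \<sigma>) u) ((inv \<tau> \<circ> \<sigma>) v)" if "u < m" "v < m" for u v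
  proof -
    have "(inv \<tau> \<circ> \<sigma>) u < m" "(inv \<tau> \<circ> \<sigma>) v < m" using that permutes_in_image[OF perm] by auto
    then have "gr m y ((inv \<tau> \<circ> \<sigma>) u) ((inv \<tau> \<circ> \<sigma>) v) = gr m z (\<tau> ((inv \<tau> \<circ> \<sigma>) u)) (\<tau> ((inv \<tau> \<circ> \<sigma>) v))"
      by (rule \<tau>(2))
    also have "\<dots> = gr m z (\<sigma> u) (\<sigma> v)" by (simp add: permutes_inverses[OF \<tau>(1)])
    finally show ?thesis using \<sigma>(2)[OF that] by simp
  qed
  then show ?thesis using perm by blast
qed

text \<open>The first sample serves as reference. Once it is fixed, the other samples are
  independent, and \<open>prb_near\<close> applies to every possible value of it.\<close>

lemma prb_all_near:
  assumes m: "m > 0" and P: "P \<in> distributions (m\<^sup>2)" and far: "far_from (m\<^sup>2) \<epsilon> P (D_iso m)" and \<epsilon>: "\<epsilon> > 0"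
  shows "prb (Pi_pmf {..<Suc j} [] (\<lambda>_. P)) (\<lambda>X. \<forall>i\<in>{1..<Suc j}. near m (\<epsilon> / 2) (X 0) (X i)) \<le> (1 - \<epsilon> / 2) ^ j"
proof -
  let ?A = "{1..<Suc j}"
  let ?R = "Pi_pmf ?A [] (\<lambda>_. P)"
  have fin: "finite (set_pmf P)" and supp: "set_pmf P \<subseteq> bitstrings (m\<^sup>2)"
    using P finite_subset[OF _ finite_bitstrings] by (auto simp: distributions_def)
  have finR: "finite (set_pmf ?R)"
    by (subst set_Pi_pmf) (use fin in \<open>auto intro!: finite_PiE_dflt\<close>)
  have ins: "{..<Suc j} = insert 0 ?A" by auto
  have "prb (Pi_pmf {..<Suc j} [] (\<lambda>_. P)) (\<lambda>X. \<forall>i\<in>?A. near m (\<epsilon> / 2) (X 0) (X i)) =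
    prb (pair_pmf P ?R) (\<lambda>(y, f). \<forall>i\<in>?A. near m (\<epsilon> / 2) y (f i))"
    unfolding ins by (subst Pi_pmf_insert) (auto intro!: arg_cong[where f = "measure (measure_pmf _)"])
  also have "\<dots> = mean P (\<lambda>y. prb ?R (\<lambda>f. \<forall>i\<in>?A. near m (\<epsilon> / 2) y (f i)))"
    by (subst prb_pair[OF fin finR]) simp
  also have "\<dots> \<le> (1 - \<epsilon> / 2) ^ j"
  proof (rule mean_le_const[OF fin])
    fix y assume y: "y \<in> set_pmf P"
    have "prb ?R (\<lambda>f. \<forall>i\<in>?A. near m (\<epsilon> / 2) y (f i)) = measure_pmf.prob ?R (Pi ?A (\<lambda>_. {z. near m (\<epsilon> / 2) y z}))"
      by (intro arg_cong[where f = "measure (measure_pmf _)"]) auto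
    also have "\<dots> = prb P (near m (\<epsilon> / 2) y) ^ j" by (subst measure_Pi_pmf_Pi) auto
    also have "\<dots> \<le> (1 - \<epsilon> / 2) ^ j"
      using y supp by (intro power_mono prb_near[OF m P far _ \<epsilon>]) auto
    finally show "prb ?R (\<lambda>f. \<forall>i\<in>?A. near m (\<epsilon> / 2) y (f i)) \<le> (1 - \<epsilon> / 2) ^ j" .
  qed
  finally show ?thesis .
qed

section \<open>From the comparison of graphs to a tester\<close>

text \<open>All vertices are labelled, as the weights require the exact class sizes; the products of
  block samples are read by the mismatch statistic.\<close>

definition G_queries :: "nat \<Rightarrow> (nat list \<times> nat list) list \<Rightarrow> block list \<Rightarrow> (nat \<times> nat) set" where
  "G_queries m hs bs = (let A = (\<Union>h\<in>set hs. set (fst h)) in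
    A \<times> {..<m} \<union> {..<m} \<times> A \<union> (\<lambda>v. (v, v)) ` {..<m} \<union>
    (\<Union>b\<in>set bs. set (fst (fst b)) \<times> set (fst (snd b))))"

text \<open>Only the sampled vertices \<open>S\<close> are labelled, which leaves room for the
  larger core set \<open>B\<close>.\<close>

definition H_queries :: "(nat list \<times> nat list) list \<Rightarrow> block list \<Rightarrow> (nat \<times> nat) set" where
  "H_queries hs bs = (let B = (\<Union>h\<in>set hs. set (snd h)); S = (\<Union>b\<in>set bs. set (snd (fst b)) \<union> set (snd (snd b))) in
    B \<times> S \<union> S \<times> B \<union> (\<lambda>v. (v, v)) ` S \<union>
    (\<Union>b\<in>set bs. set (snd (fst b)) \<times> set (snd (snd b))))"

section \<open>Locality and number of the queries\<close>

lemma wt_cong: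
  assumes "\<And>v. v < m \<Longrightarrow> l v = k v"
  shows "wt m l = wt m k"
proof -
  have "cls m l c = cls m k c" for c unfolding cls_def using assms by (intro arg_cong[where f = card]) auto
  then show ?thesis by (simp add: fun_eq_iff wt_def)
qed

lemma kern_cong:
  assumes "\<And>v. v < m \<Longrightarrow> l v = k v" "f x = f' x" "g y = g' y"
  shows "kern m l f g x y = kern m k f' g' x y"
  using wt_cong[of m l k] assms by (simp add: kern_def)

lemma collision_stat_cong:
  assumes "\<And>v. v < m \<Longrightarrow> l v = k v" "\<And>v. v \<in> set xs \<union> set ys \<Longrightarrow> l' v = k' v"
  shows "collision_stat m l l' xs ys = collision_stat m k k' xs ys"
  unfolding collision_stat_def
  by (intro arg_cong[where f = sum_list] map_cong refl kern_cong assms) auto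

lemma mismatch_stat_cong:
  assumes "\<And>v. v < m \<Longrightarrow> l v = k v" "\<And>v. v \<in> set us' \<union> set vs' \<Longrightarrow> l' v = k' v"
    and "set us \<subseteq> {..<m}" "set vs \<subseteq> {..<m}"
    and "\<And>u u' v v'. \<lbrakk>u \<in> set us; u' \<in> set us'; v \<in> set vs; v' \<in> set vs'\<rbrakk> \<Longrightarrow> X u u' v v' = Y u u' v v'"
  shows "mismatch_stat m l l' X us us' vs vs' = mismatch_stat m k k' Y us us' vs vs'"
  unfolding mismatch_stat_def
proof (intro arg_cong[where f = sum_list] map_cong refl)
  fix u u' v v' assume "u \<in> set us" "u' \<in> set us'" "v \<in> set vs" "v' \<in> set vs'"
  then have "kern m l l l' u u' = kern m k k k' u u'" "kern m l l l' v v' = kern m k k k' v v'" "X u u' v v' = Y u u' v v'"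
    using assms by (auto intro!: kern_cong)
  then show "kern m l l l' u u' * kern m l l l' v v' * of_bool (X u u' v v') =
    kern m k k k' u u' * kern m k k k' v v' * of_bool (Y u u' v v')" by simp
qed

lemma block_rejects_cong:
  assumes cs: "set cs \<subseteq> (\<Union>h\<in>set hs. set (fst h)) \<times> (\<Union>h\<in>set hs. set (snd h))"
    and b: "b \<in> set bs" and valid: "set (fst (fst b)) \<subseteq> {..<m}" "set (fst (snd b)) \<subseteq> {..<m}"
    and G: "\<And>u v. (u, v) \<in> G_queries m hs bs \<Longrightarrow> G u v = G' u v"
    and H: "\<And>u v. (u, v) \<in> H_queries hs bs \<Longrightarrow> H u v = H' u v"
  shows "block_rejects m r \<eta> \<tau> G H cs b = block_rejects m r \<eta> \<tau> G' H' cs b"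
proof -
  obtain us us' vs vs' where beq: "b = ((us, us'), (vs, vs'))" by (metis prod.exhaust)
  have l: "lab G (map fst cs) v = lab G' (map fst cs) v" if "v < m" for v
  proof -
    have "G v v = G' v v" using that by (intro G) (auto simp: G_queries_def Let_def)
    moreover have "G x v = G' x v \<and> G v x = G' v x" if "x \<in> set (map fst cs)" for x
    proof -
      have "x \<in> (\<Union>h\<in>set hs. set (fst h))" using cs that by auto
      then show ?thesis using \<open>v < m\<close> by (intro conjI G) (simp_all add: G_queries_def Let_def)
    qed
    ultimately show ?thesis by (auto simp: lab_def)
  qed
  have l': "lab H (map snd cs) v = lab H' (map snd cs) v" if "v \<in> set us' \<union> set vs'" for v
  proof -
    have S: "v \<in> (\<Union>b\<in>set bs. set (snd (fst b)) \<union> set (snd (snd b)))" using b that beq by force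
    have "H v v = H' v v" using S by (intro H) (auto simp: H_queries_def Let_def)
    moreover have "H x v = H' x v \<and> H v x = H' v x" if "x \<in> set (map snd cs)" for x
    proof -
      have "x \<in> (\<Union>h\<in>set hs. set (snd h))" using cs that by auto
      then show ?thesis using S by (intro conjI H) (simp_all add: H_queries_def Let_def)
    qed
    ultimately show ?thesis by (auto simp: lab_def)
  qed
  have GX: "G u v = G' u v" if "u \<in> set us" "v \<in> set vs" for u v
    using b beq that by (intro G) (force simp: G_queries_def Let_def)
  have HX: "H u v = H' u v" if "u \<in> set us'" "v \<in> set vs'" for u v
    using b beq that by (intro H) (force simp: H_queries_def Let_def)
  have "collision_stat m (lab G (map fst cs)) (lab H (map snd cs)) us' vs' =
      collision_stat m (lab G' (map fst cs)) (lab H' (map snd cs)) us' vs'"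
    by (intro collision_stat_cong l l')
  moreover have "mismatch_stat m (lab G (map fst cs)) (lab H (map snd cs)) (\<lambda>u u' v v'. G u v \<noteq> H u' v') us us' vs vs' =
      mismatch_stat m (lab G' (map fst cs)) (lab H' (map snd cs)) (\<lambda>u u' v v'. G' u v \<noteq> H' u' v') us us' vs vs'"
    using valid by (intro mismatch_stat_cong l l') (auto simp: beq GX HX)
  ultimately show ?thesis by (simp add: block_rejects_def beq)
qed

text \<open>Candidate cores draw their vertices from the groups in \<open>hs\<close>, so one set of
  queried entries decides all of them.\<close>

lemma pair_accepts_cong:
  assumes valid: "\<And>b. b \<in> set bs \<Longrightarrow> set (fst (fst b)) \<subseteq> {..<m} \<and> set (fst (snd b)) \<subseteq> {..<m}"
    and G: "\<And>u v. (u, v) \<in> G_queries m hs bs \<Longrightarrow> G u v = G' u v"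
    and H: "\<And>u v. (u, v) \<in> H_queries hs bs \<Longrightarrow> H u v = H' u v"
  shows "pair_accepts m r \<eta> \<tau> c k G H hs bs = pair_accepts m r \<eta> \<tau> c k G' H' hs bs"
proof -
  have "filter (block_rejects m r \<eta> \<tau> G H cs) bs = filter (block_rejects m r \<eta> \<tau> G' H' cs) bs"
    if "set cs \<subseteq> (\<Union>h\<in>set hs. set (fst h)) \<times> (\<Union>h\<in>set hs. set (snd h))" for cs
  proof (rule filter_cong[OF refl])
    fix b assume "b \<in> set bs"
    then show "block_rejects m r \<eta> \<tau> G H cs b = block_rejects m r \<eta> \<tau> G' H' cs b"
      using that valid by (intro block_rejects_cong[of cs hs b bs] G H) auto
  qed
  then show ?thesis unfolding pair_accepts_def by metis
qed

lemma card_UN_list_le: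
  assumes "\<And>x. x \<in> set xs \<Longrightarrow> card (F x) \<le> b"
  shows "card (\<Union>x\<in>set xs. F x) \<le> length xs * b"
proof -
  have "card (\<Union>x\<in>set xs. F x) \<le> (\<Sum>x\<in>set xs. card (F x))" by (rule card_UN_le) simp
  also have "\<dots> \<le> card (set xs) * b" using sum_bounded_above[of "set xs" "\<lambda>x. card (F x)" b] assms by simp
  also have "\<dots> \<le> length xs * b" by (intro mult_right_mono card_length) simp
  finally show ?thesis .
qed

lemma card_Un4_le: "card (A \<union> B \<union> C \<union> D) \<le> card A + card B + card C + card D"
  by (meson add_mono card_Un_le order.trans order_refl)

lemma queries_valid:
  assumes m: "m > 0" and hs: "hs \<in> set_pmf (replicate_pmf g (group_pmf a a' m))"
    and bs: "bs \<in> set_pmf (replicate_pmf n (block_pmf r m))"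
  shows "G_queries m hs bs \<subseteq> {..<m} \<times> {..<m}" "H_queries hs bs \<subseteq> {..<m} \<times> {..<m}"
    and "card (G_queries m hs bs) \<le> 2 * (g * a * m) + m + n * (r * r)"
    and "card (H_queries hs bs) \<le> 2 * ((g * a') * (n * (2 * r))) + n * (2 * r) + n * (r * r)"
    and "\<And>b. b \<in> set bs \<Longrightarrow> set (fst (fst b)) \<subseteq> {..<m} \<and> set (fst (snd b)) \<subseteq> {..<m}"
proof -
  have lh: "length hs = g" "length bs = n" using hs bs by (simp_all add: set_replicate_pmf)
  have h: "set (fst h) \<subseteq> {..<m}" "set (snd h) \<subseteq> {..<m}" "card (set (fst h)) \<le> a" "card (set (snd h)) \<le> a'"
    if "h \<in> set hs" for h
  proof -
    have "h \<in> set_pmf (group_pmf a a' m)" using hs that by (rule set_replicate_pmfD)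
    then show "set (fst h) \<subseteq> {..<m}" "set (snd h) \<subseteq> {..<m}" "card (set (fst h)) \<le> a" "card (set (snd h)) \<le> a'"
      using m card_length[of "fst h"] card_length[of "snd h"] by (auto simp: set_iid)
  qed
  have b: "set (fst (fst b)) \<subseteq> {..<m}" "set (snd (fst b)) \<subseteq> {..<m}" "set (fst (snd b)) \<subseteq> {..<m}" "set (snd (snd b)) \<subseteq> {..<m}"
      "card (set (fst (fst b))) \<le> r" "card (set (snd (fst b))) \<le> r" "card (set (fst (snd b))) \<le> r" "card (set (snd (snd b))) \<le> r"
    if "b \<in> set bs" for b
  proof -
    have "b \<in> set_pmf (block_pmf r m)" using bs that by (rule set_replicate_pmfD)
    then show "set (fst (fst b)) \<subseteq> {..<m}" "set (snd (fst b)) \<subseteq> {..<m}" "set (fst (snd b)) \<subseteq> {..<m}" "set (snd (snd b)) \<subseteq> {..<m}"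
      "card (set (fst (fst b))) \<le> r" "card (set (snd (fst b))) \<le> r" "card (set (fst (snd b))) \<le> r" "card (set (snd (snd b))) \<le> r"
      using m card_length[of "fst (fst b)"] card_length[of "snd (fst b)"] card_length[of "fst (snd b)"] card_length[of "snd (snd b)"]
      by (auto simp: set_iid)
  qed
  show "\<And>b. b \<in> set bs \<Longrightarrow> set (fst (fst b)) \<subseteq> {..<m} \<and> set (fst (snd b)) \<subseteq> {..<m}" using b by blast
  let ?A = "\<Union>h\<in>set hs. set (fst h)" and ?B = "\<Union>h\<in>set hs. set (snd h)"
  let ?S = "\<Union>b\<in>set bs. set (snd (fst b)) \<union> set (snd (snd b))"
  have sub: "?A \<subseteq> {..<m}" "?B \<subseteq> {..<m}" "?S \<subseteq> {..<m}" using h b by blast+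
  have GX: "(\<Union>b\<in>set bs. set (fst (fst b)) \<times> set (fst (snd b))) \<subseteq> {..<m} \<times> {..<m}"
    and HX: "(\<Union>b\<in>set bs. set (snd (fst b)) \<times> set (snd (snd b))) \<subseteq> {..<m} \<times> {..<m}" using b by blast+
  show "G_queries m hs bs \<subseteq> {..<m} \<times> {..<m}"
    unfolding G_queries_def Let_def using sub GX by (intro Un_least) auto
  show "H_queries hs bs \<subseteq> {..<m} \<times> {..<m}"
    unfolding H_queries_def Let_def using sub HX by (intro Un_least) auto
  have cA: "card ?A \<le> g * a" using card_UN_list_le[of hs "\<lambda>h. set (fst h)" a] h lh by simp
  have cB: "card ?B \<le> g * a'" using card_UN_list_le[of hs "\<lambda>h. set (snd h)" a'] h lh by simp
  have cS: "card ?S \<le> n * (2 * r)"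
  proof -
    have "card (set (snd (fst b)) \<union> set (snd (snd b))) \<le> 2 * r" if "b \<in> set bs" for b
      using b[OF that] card_Un_le[of "set (snd (fst b))" "set (snd (snd b))"] by linarith
    then show ?thesis using card_UN_list_le[of bs "\<lambda>b. set (snd (fst b)) \<union> set (snd (snd b))" "2 * r"] lh by simp
  qed
  have cGX: "card (\<Union>b\<in>set bs. set (fst (fst b)) \<times> set (fst (snd b))) \<le> n * (r * r)"
    using card_UN_list_le[of bs "\<lambda>b. set (fst (fst b)) \<times> set (fst (snd b))" "r * r"] b lh
    by (simp add: card_cartesian_product mult_mono)
  have cHX: "card (\<Union>b\<in>set bs. set (snd (fst b)) \<times> set (snd (snd b))) \<le> n * (r * r)"
    using card_UN_list_le[of bs "\<lambda>b. set (snd (fst b)) \<times> set (snd (snd b))" "r * r"] b lh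
    by (simp add: card_cartesian_product mult_mono)
  have "card (G_queries m hs bs) \<le> card (?A \<times> {..<m}) + card ({..<m} \<times> ?A) + card ((\<lambda>v. (v, v)) ` {..<m}) +
      card (\<Union>b\<in>set bs. set (fst (fst b)) \<times> set (fst (snd b)))"
    unfolding G_queries_def Let_def by (rule card_Un4_le)
  also have "\<dots> \<le> g * a * m + m * (g * a) + m + n * (r * r)"
    using card_image_le[of "{..<m}" "\<lambda>v. (v, v)"]
    by (intro add_mono cGX) (auto simp: card_cartesian_product intro: mult_right_mono mult_left_mono cA)
  finally show "card (G_queries m hs bs) \<le> 2 * (g * a * m) + m + n * (r * r)" by (simp add: mult_ac)
  have "card (H_queries hs bs) \<le> card (?B \<times> ?S) + card (?S \<times> ?B) + card ((\<lambda>v. (v, v)) ` ?S) +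
      card (\<Union>b\<in>set bs. set (snd (fst b)) \<times> set (snd (snd b)))"
    unfolding H_queries_def Let_def by (rule card_Un4_le)
  also have "\<dots> \<le> (g * a') * (n * (2 * r)) + (n * (2 * r)) * (g * a') + n * (2 * r) + n * (r * r)"
  proof (intro add_mono cHX)
    show "card (?B \<times> ?S) \<le> (g * a') * (n * (2 * r))" "card (?S \<times> ?B) \<le> (n * (2 * r)) * (g * a')"
      unfolding card_cartesian_product by (intro mult_mono cB cS; simp)+
    show "card ((\<lambda>v. (v, v)) ` ?S) \<le> n * (2 * r)" using card_image_le[of ?S "\<lambda>v. (v, v)"] cS by (simp add: order.trans)
  qed
  finally show "card (H_queries hs bs) \<le> 2 * ((g * a') * (n * (2 * r))) + n * (2 * r) + n * (r * r)" by (simp add: mult_ac)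
qed

text \<open>The same coins \<open>hs\<close>, \<open>bs\<close> are used in all \<open>j\<close>
  comparisons, so the first sample is queried once and only the second part of the bound is
  multiplied by \<open>j\<close>.\<close>

lemma ex_tester_tree:
  assumes m: "m > 0" and hs: "hs \<in> set_pmf (replicate_pmf g (group_pmf a a' m))"
    and bs: "bs \<in> set_pmf (replicate_pmf n (block_pmf r m))"
  shows "\<exists>t. legal_queries (Suc j) (m\<^sup>2) t \<and>
    num_queries t \<le> (2 * (g * a * m) + m + n * (r * r)) + j * (2 * ((g * a') * (n * (2 * r))) + n * (2 * r) + n * (r * r)) \<and>
    (\<forall>X. accepts t X \<longleftrightarrow> (\<forall>i\<in>{1..<Suc j}. pair_accepts m r' \<eta> \<tau> c k (gr m (X 0)) (gr m (X i)) hs bs))"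
proof -
  note v = queries_valid[OF m hs bs]
  let ?enc = "\<lambda>i (u, v). (i, u * m + v)"
  let ?g = "\<lambda>\<alpha> i u v. \<alpha> (i, u * m + v)"
  let ?S = "?enc 0 ` G_queries m hs bs \<union> (\<Union>i\<in>{1..<Suc j}. ?enc i ` H_queries hs bs)"
  let ?\<Phi> = "\<lambda>\<alpha>. \<forall>i\<in>{1..<Suc j}. pair_accepts m r' \<eta> \<tau> c k (?g \<alpha> 0) (?g \<alpha> i) hs bs"
  have fin: "finite (G_queries m hs bs)" "finite (H_queries hs bs)"
    using v(1,2) by (auto intro: finite_subset)
  have "\<exists>t. legal_queries (Suc j) (m\<^sup>2) t \<and> num_queries t \<le> card ?S \<and> (\<forall>X. accepts t X \<longleftrightarrow> ?\<Phi> (\<lambda>(i, j). X i ! j))"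
  proof (rule ex_query_tree)
    show "finite ?S" using fin by auto
    show "i < Suc j \<and> l < m\<^sup>2" if "(i, l) \<in> ?S" for i l
      using that v(1,2) by (auto intro!: index_less)
    show "?\<Phi> \<alpha> = ?\<Phi> \<beta>" if "\<And>z. z \<in> ?S \<Longrightarrow> \<alpha> z = \<beta> z" for \<alpha> \<beta> :: "nat \<times> nat \<Rightarrow> bool"
    proof (intro ball_cong refl pair_accepts_cong v(5))
      fix i u v assume i: "i \<in> {1..<Suc j}"
      show "?g \<alpha> 0 u v = ?g \<beta> 0 u v" if "(u, v) \<in> G_queries m hs bs"
        using that by (intro \<open>\<And>z. z \<in> ?S \<Longrightarrow> \<alpha> z = \<beta> z\<close>) force
      show "?g \<alpha> i u v = ?g \<beta> i u v" if "(u, v) \<in> H_queries hs bs"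
        using that i by (intro \<open>\<And>z. z \<in> ?S \<Longrightarrow> \<alpha> z = \<beta> z\<close>) force
    qed
  qed
  moreover have "card ?S \<le> (2 * (g * a * m) + m + n * (r * r)) + j * (2 * ((g * a') * (n * (2 * r))) + n * (2 * r) + n * (r * r))"
  proof -
    have "card (\<Union>i\<in>{1..<Suc j}. ?enc i ` H_queries hs bs) \<le> (\<Sum>i\<in>{1..<Suc j}. card (?enc i ` H_queries hs bs))"
      by (rule card_UN_le) simp
    also have "\<dots> \<le> (\<Sum>i\<in>{1..<Suc j}. card (H_queries hs bs))" by (intro sum_mono card_image_le fin)
    also have "\<dots> = j * card (H_queries hs bs)" by simp
    also have "\<dots> \<le> j * (2 * ((g * a') * (n * (2 * r))) + n * (2 * r) + n * (r * r))" by (intro mult_left_mono v(4)) simp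
    finally show ?thesis
      by (intro order.trans[OF card_Un_le] add_mono order.trans[OF card_image_le[OF fin(1)] v(3)])
  qed
  ultimately obtain t where t: "legal_queries (Suc j) (m\<^sup>2) t"
    "num_queries t \<le> (2 * (g * a * m) + m + n * (r * r)) + j * (2 * ((g * a') * (n * (2 * r))) + n * (2 * r) + n * (r * r))"
    "\<And>X. accepts t X \<longleftrightarrow> ?\<Phi> (\<lambda>(i, j). X i ! j)"
    by (meson order.trans)
  moreover have "?g (\<lambda>(i, j). X i ! j) i = gr m (X i)" for X :: "nat \<Rightarrow> bool list" and i by (simp add: gr_def fun_eq_iff)
  ultimately show ?thesis by (intro exI[of _ t]) simp
qed

text \<open>Completeness is a union bound over the \<open>j\<close> comparisons and tolerates their
  shared coins. Soundness needs one far sample: its index is determined by the samples, and the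
  coins are independent of these. The two failure probabilities of 1/8 stay below 1/3.\<close>

lemma ex_doho_tester:
  fixes C :: "'w pmf" and acc :: "'w \<Rightarrow> (nat \<Rightarrow> nat \<Rightarrow> bool) \<Rightarrow> (nat \<Rightarrow> nat \<Rightarrow> bool) \<Rightarrow> bool"
  assumes m: "m > 0" and finC: "finite (set_pmf C)" and \<epsilon>: "\<epsilon> > 0"
    and tree: "\<And>\<omega>. \<omega> \<in> set_pmf C \<Longrightarrow> \<exists>t. legal_queries (Suc j) (m\<^sup>2) t \<and> num_queries t \<le> q \<and>
      (\<forall>X. accepts t X \<longleftrightarrow> (\<forall>i\<in>{1..<Suc j}. acc \<omega> (gr m (X 0)) (gr m (X i))))"
    and compl: "\<And>G H \<sigma>. \<sigma> permutes {..<m} \<Longrightarrow> (\<And>u v. \<lbrakk>u < m; v < m\<rbrakk> \<Longrightarrow> G u v = H (\<sigma> u) (\<sigma> v)) \<Longrightarrow>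
      prb C (\<lambda>\<omega>. \<not> acc \<omega> G H) \<le> err"
    and sound: "\<And>G H. (\<And>\<pi>. \<pi> permutes {..<m} \<Longrightarrow> real (mismatches m G H \<pi>) > \<epsilon> / 2 * (real m)\<^sup>2) \<Longrightarrow>
      prb C (\<lambda>\<omega>. acc \<omega> G H) \<le> 1 / 8"
    and err: "j * err \<le> 1 / 3" "err \<ge> 0" and j: "(1 - \<epsilon> / 2) ^ j \<le> 1 / 8"
  shows "\<exists>T. doho_tester (m\<^sup>2) \<epsilon> (D_iso m) (Suc j) q T"
proof -
  have "\<exists>t. \<forall>\<omega>\<in>set_pmf C. legal_queries (Suc j) (m\<^sup>2) (t \<omega>) \<and> num_queries (t \<omega>) \<le> q \<and>
      (\<forall>X. accepts (t \<omega>) X \<longleftrightarrow> (\<forall>i\<in>{1..<Suc j}. acc \<omega> (gr m (X 0)) (gr m (X i))))"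
    by (intro bchoice ballI tree)
  then obtain t where t: "\<And>\<omega>. \<omega> \<in> set_pmf C \<Longrightarrow> legal_queries (Suc j) (m\<^sup>2) (t \<omega>) \<and> num_queries (t \<omega>) \<le> q"
    and acc: "\<And>\<omega> X. \<omega> \<in> set_pmf C \<Longrightarrow> accepts (t \<omega>) X \<longleftrightarrow> (\<forall>i\<in>{1..<Suc j}. acc \<omega> (gr m (X 0)) (gr m (X i)))"
    by blast
  let ?R = "\<lambda>P. Pi_pmf {..<Suc j} [] (\<lambda>_. P) :: (nat \<Rightarrow> bool list) pmf"
  \<comment> \<open>The samples are put first, so that \<open>prb_pair_le\<close> can fix them
    before the coins are tossed.\<close>
  have exec: "measure_pmf.prob (execution (map_pmf t C) (Suc j) P) {(t, X). Q t X} = prb (pair_pmf (?R P) C) (\<lambda>(X, \<omega>). Q (t \<omega>) X)" for P Q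
  proof -
    have "execution (map_pmf t C) (Suc j) P = map_pmf (\<lambda>(X, \<omega>). (t \<omega>, X)) (pair_pmf (?R P) C)"
      unfolding execution_def pair_map_pmf1
      by (subst pair_commute_pmf) (simp add: pmf.map_comp o_def case_prod_unfold apfst_def map_prod_def)
    then show ?thesis by (auto intro!: arg_cong[where f = "measure (measure_pmf _)"])
  qed
  have "doho_tester (m\<^sup>2) \<epsilon> (D_iso m) (Suc j) q (map_pmf t C)"
    unfolding doho_tester_def
  proof (intro conjI ballI impI)
    fix P assume P: "P \<in> distributions (m\<^sup>2)"
    have fin: "finite (set_pmf P)" using P finite_subset[OF _ finite_bitstrings] by (auto simp: distributions_def)
    have setR: "set_pmf (?R P) = PiE_dflt {..<Suc j} [] (\<lambda>_. set_pmf P)" by (simp add: set_Pi_pmf o_def)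
    then have finR: "finite (set_pmf (?R P))" using fin by (auto intro!: finite_PiE_dflt)
    {
      assume iso: "P \<in> D_iso m"
      have "prb (pair_pmf (?R P) C) (\<lambda>(X, \<omega>). \<not> accepts (t \<omega>) X) \<le> 0 + 1 / 3"
      proof (rule prb_pair_le[where Good = "\<lambda>_. True"])
        fix X assume "X \<in> set_pmf (?R P)"
        then have X: "X i \<in> set_pmf P" if "i < Suc j" for i using that by (auto simp: setR PiE_dflt_def)
        have "prb C (\<lambda>\<omega>. \<not> accepts (t \<omega>) X) \<le> prb C (\<lambda>\<omega>. \<exists>i\<in>{1..<Suc j}. \<not> acc \<omega> (gr m (X 0)) (gr m (X i)))"
          by (intro prb_mono) (auto simp: acc)
        also have "\<dots> \<le> card {1..<Suc j} * err"
        proof (intro prb_Bex_le)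
          fix i assume "i \<in> {1..<Suc j}"
          then obtain \<sigma> where "\<sigma> permutes {..<m}" "\<forall>u<m. \<forall>v<m. gr m (X 0) u v = gr m (X i) (\<sigma> u) (\<sigma> v)"
            using D_iso_isomorphic[OF iso X[of 0] X[of i]] by auto
          then show "prb C (\<lambda>\<omega>. \<not> acc \<omega> (gr m (X 0)) (gr m (X i))) \<le> err" by (intro compl) auto
        qed simp
        also have "\<dots> \<le> 1 / 3" using err by simp
        finally show "prb C (\<lambda>y. case (X, y) of (X, \<omega>) \<Rightarrow> \<not> accepts (t \<omega>) X) \<le> 1 / 3" by simp
      qed (use finR finC in auto)
      then have "measure_pmf.prob (execution (map_pmf t C) (Suc j) P) {(t, X). \<not> accepts t X} \<le> 1 / 3" by (simp add: exec)
      moreover have "measure_pmf.prob (execution (map_pmf t C) (Suc j) P) {(t, X). \<not> accepts t X} =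
        1 - measure_pmf.prob (execution (map_pmf t C) (Suc j) P) {(t, X). accepts t X}"
        using prb_not[of "execution (map_pmf t C) (Suc j) P" "\<lambda>(t, X). accepts t X"] by (simp add: case_prod_unfold)
      ultimately show "measure_pmf.prob (execution (map_pmf t C) (Suc j) P) {(t, X). accepts t X} \<ge> 2 / 3" by simp
    }
    {
      assume far: "far_from (m\<^sup>2) \<epsilon> P (D_iso m)"
      have "prb (pair_pmf (?R P) C) (\<lambda>(X, \<omega>). accepts (t \<omega>) X) \<le> 1 / 8 + 1 / 8"
      proof (rule prb_pair_le[where Good = "\<lambda>X. \<not> (\<forall>i\<in>{1..<Suc j}. near m (\<epsilon> / 2) (X 0) (X i))"])
        show "prb (?R P) (\<lambda>X. \<not> \<not> (\<forall>i\<in>{1..<Suc j}. near m (\<epsilon> / 2) (X 0) (X i))) \<le> 1 / 8"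
          unfolding not_not by (rule order.trans[OF prb_all_near[OF m P far \<epsilon>] j])
        fix X assume "X \<in> set_pmf (?R P)" "\<not> (\<forall>i\<in>{1..<Suc j}. near m (\<epsilon> / 2) (X 0) (X i))"
        then obtain i where i: "i \<in> {1..<Suc j}" "\<not> near m (\<epsilon> / 2) (X 0) (X i)" by blast
        have "prb C (\<lambda>\<omega>. accepts (t \<omega>) X) \<le> prb C (\<lambda>\<omega>. acc \<omega> (gr m (X 0)) (gr m (X i)))"
          using i(1) by (intro prb_mono) (auto simp: acc)
        also have "\<dots> \<le> 1 / 8" using i(2) by (intro sound) (auto simp: near_def not_le)
        finally show "prb C (\<lambda>y. case (X, y) of (X, \<omega>) \<Rightarrow> accepts (t \<omega>) X) \<le> 1 / 8" by simp
      qed (use finR finC in auto)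
      then have "measure_pmf.prob (execution (map_pmf t C) (Suc j) P) {(t, X). accepts t X} \<le> 1 / 4" by (simp add: exec)
      moreover have "measure_pmf.prob (execution (map_pmf t C) (Suc j) P) {(t, X). \<not> accepts t X} =
        1 - measure_pmf.prob (execution (map_pmf t C) (Suc j) P) {(t, X). accepts t X}"
        using prb_not[of "execution (map_pmf t C) (Suc j) P" "\<lambda>(t, X). accepts t X"] by (simp add: case_prod_unfold)
      ultimately show "measure_pmf.prob (execution (map_pmf t C) (Suc j) P) {(t, X). \<not> accepts t X} \<ge> 2 / 3" by simp
    }
  qed (use t in auto)
  then show ?thesis by blast
qed

section \<open>Choice of parameters\<close>

text \<open>Throughout, \<open>e\<close> stands for \<open>\<lceil>1 / \<epsilon>\<rceil>\<close> and \<open>L\<close> for a bound on \<open>log 2 m\<close>.  The comparison of the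
  first sample with each of the \<open>6 * e\<close> others may fail with probability \<open>3 / inv_err e\<close>.\<close>
definition inv_err :: "nat \<Rightarrow> nat" where "inv_err e = 54 * e"

text \<open>Gives \<open>R' * \<delta> = 6\<close>, as \<open>prb_no_hit\<close> demands, for
  \<open>\<delta> = 1 / (1024 * e * inv_err e)\<close>.\<close>

definition core_rate :: "nat \<Rightarrow> nat" where "core_rate e = 6144 * e * inv_err e"

text \<open>Makes the collision error \<open>8 / (R * \<eta>^2)\<close> equal to
  \<open>1 / (16 * inv_err e)\<close> for \<open>\<eta> = 1 / (512 * e^2)\<close>.\<close>

definition block_rate :: "nat \<Rightarrow> nat" where "block_rate e = 2 ^ 25 * inv_err e * e ^ 4"

text \<open>The first \<open>2 * L\<close> groups pay for the union bound over \<open>m^2\<close>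
  pairs of vertices, the others for the error, by \<open>1 / 2 ^ N \<le> 1 / N\<close> with
  \<open>N = inv_err e\<close>.\<close>

definition num_groups :: "nat \<Rightarrow> nat \<Rightarrow> nat" where "num_groups e L = 2 * L + inv_err e"

text \<open>By Markov, \<open>inv_err e\<close> times a bound on the mean core length; the 16 stems
  from \<open>a ^ 4 \<le> 16 * m\<close>.\<close>

definition core_size :: "nat \<Rightarrow> nat \<Rightarrow> nat" where
  "core_size e L = 16 * (core_rate e)\<^sup>2 * num_groups e L * inv_err e"

text \<open>The number of candidates is at most \<open>2 ^ ((2 * L + 1) * c)\<close> with
  \<open>c = core_size e L\<close>; the extra 3 leaves an error of 1/8.\<close>

definition reject_limit :: "nat \<Rightarrow> nat \<Rightarrow> nat" where
  "reject_limit e L = (2 * L + 1) * core_size e L + 3"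

definition query_factor :: "nat \<Rightarrow> nat \<Rightarrow> nat" where
  "query_factor e L = 2 * (num_groups e L * core_rate e) + 1 + 8 * reject_limit e L * (block_rate e)\<^sup>2
    + 6 * e * (32 * (num_groups e L * core_rate e * reject_limit e L * block_rate e)
      + 16 * (reject_limit e L * block_rate e) + 8 * reject_limit e L * (block_rate e)\<^sup>2)"

text \<open>By \<open>1 - x \<le> exp (- x)\<close> the power is at most \<open>exp (- 3)\<close>,
  which explains the \<open>6 * e\<close> comparisons.\<close>

lemma power_miss_le:
  fixes \<epsilon> :: real
  assumes "0 < \<epsilon>" "\<epsilon> < 1" "1 / \<epsilon> \<le> real e"
  shows "(1 - \<epsilon> / 2) ^ (6 * e) \<le> 1 / 8"
proof -
  have "(1 - \<epsilon> / 2) ^ (6 * e) \<le> exp (- \<epsilon> / 2) ^ (6 * e)"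
    using assms exp_ge_add_one_self[of "- \<epsilon> / 2"] by (intro power_mono) auto
  also have "\<dots> = exp (- (3 * (\<epsilon> * e)))" by (simp flip: exp_of_nat_mult)
  also have "\<dots> \<le> exp (- 3)" using assms by (simp add: field_simps)
  also have "\<dots> = 1 / exp 1 ^ 3" by (simp add: exp_minus inverse_eq_divide flip: exp_of_nat_mult)
  also have "\<dots> \<le> 1 / 2 ^ 3"
    using exp_ge_add_one_self[of 1] by (intro divide_left_mono power_mono) auto
  finally show ?thesis by simp
qed

lemma square_plus_one_le:
  fixes x :: real
  assumes "x \<le> 2 ^ L" "0 \<le> x"
  shows "x * x + 1 \<le> 2 ^ (2 * L + 1)"
proof -
  have "x * x \<le> 2 ^ L * 2 ^ L" using assms by (intro mult_mono) auto
  moreover have "1 * 1 \<le> 2 ^ L * (2 ^ L :: real)" by (intro mult_mono one_le_power) auto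
  moreover have "2 ^ (2 * L + 1) = 2 * (2 ^ L * (2 ^ L :: real))" by (induction L) auto
  ultimately show ?thesis by linarith
qed

lemma ex_tester_with_params:
  fixes m e L a :: nat and \<epsilon> :: real
  assumes m: "m > 0" and \<epsilon>: "0 < \<epsilon>" "\<epsilon> < 1" "1 / \<epsilon> \<le> real e"
    and a: "m \<le> a ^ 4" "a ^ 4 \<le> 16 * m" and L: "m \<le> 2 ^ L"
  shows "\<exists>T. doho_tester (m\<^sup>2) \<epsilon> (D_iso m) (Suc (6 * e)) (a ^ 5 * query_factor e L) T"
proof -
  define N R' R g c k where "N = inv_err e" and "R' = core_rate e" and "R = block_rate e"
    and "g = num_groups e L" and "c = core_size e L" and "k = reject_limit e L"
  note defs = N_def R'_def R_def g_def c_def k_def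
  \<comment> \<open>As \<open>a\<close> is about \<open>m^(1/4)\<close>, these are samples of order
    \<open>m^(1/2)\<close>, \<open>m^(1/4)\<close> and \<open>m^(3/4)\<close>, enlarged by the
    factors \<open>R\<close> and \<open>R'\<close>.\<close>
  define r ga ga' where "r = R * a\<^sup>2" and "ga = R' * a" and "ga' = R' * a ^ 3"
  have e1: "e \<ge> 1" using \<epsilon> by (cases "e = 0") (auto simp: divide_le_0_iff)
  define E where "E = real e"
  have E: "E \<ge> 1" using e1 by (simp add: E_def)
  \<comment> \<open>With these values \<open>8 * \<tau>\<close>, \<open>2 * t\<close> and
    \<open>4 * \<eta> / t\<close> are \<open>1 / (4 * E)\<close>, \<open>1 / (8 * E)\<close> and
    \<open>1 / (8 * E)\<close>; their sum \<open>1 / (2 * E)\<close> is at most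
    \<open>\<epsilon> / 2\<close>. The choice of \<open>\<delta>\<close> makes
    \<open>2 * \<delta> / \<tau>\<close> equal to \<open>1 / (16 * N)\<close>.\<close>
  define \<eta> \<tau> t \<delta> where "\<eta> = 1 / (512 * E\<^sup>2)" and "\<tau> = 1 / (32 * E)" and "t = 1 / (16 * E)" and "\<delta> = 1 / (1024 * E * N)"
  have N: "real N = 54 * E" by (simp add: N_def inv_err_def E_def)
  have N1: "N \<ge> 1" using e1 by (simp add: N_def inv_err_def)
  have R'E: "real R' = 6144 * E * N" by (simp add: R'_def core_rate_def N_def E_def)
  have RE: "real R = 2 ^ 25 * N * E ^ 4" by (simp add: R_def block_rate_def N_def E_def)
  have "R > 0" "R' > 0" using e1 N1 by (simp_all add: R_def block_rate_def R'_def core_rate_def N_def)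
  then have R1: "real R \<ge> 1" "real R' \<ge> 1" by linarith+
  have a1: "a \<ge> 1" using a(1) m by (cases "a = 0") auto
  have pos: "\<eta> > 0" "\<tau> > 0" "t > 0" "\<delta> > 0" using E N1 by (simp_all add: \<eta>_def \<tau>_def t_def \<delta>_def)
  have a4: "real m \<le> real a ^ 4" "real a ^ 4 \<le> 16 * real m"
    using of_nat_mono[OF a(1), where 'a = real] of_nat_mono[OF a(2), where 'a = real] by simp_all
  have r: "(real r)\<^sup>2 \<ge> (real R)\<^sup>2 * m"
  proof -
    have "(real R)\<^sup>2 * m \<le> (real R)\<^sup>2 * real a ^ 4" using a4 by (intro mult_left_mono) auto
    then show ?thesis by (simp add: r_def power_mult_distrib flip: power_mult)
  qed
  have gg: "real ga * real ga' = (real R')\<^sup>2 * real a ^ 4"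
    by (simp add: ga_def ga'_def power2_eq_square power3_eq_cube power4_eq_xxxx)
  have ggm: "real ga * real ga' \<ge> (real R')\<^sup>2 * m" unfolding gg using a4 by (intro mult_left_mono) auto
  have ga: "real ga \<ge> real R'" "real ga' \<ge> real R'"
    using a1 mult_left_mono[of 1 "real a" "real R'"] mult_left_mono[of 1 "real a ^ 3" "real R'"]
    by (simp_all add: ga_def ga'_def)
  have E0: "E \<noteq> 0" and N0: "real N \<noteq> 0" using E N1 by auto
  have "real R' * \<delta> = 6" unfolding R'E \<delta>_def using E0 N0 by simp
  then have Rd: "real R' * \<delta> \<ge> 6" by simp
  have g0: "g > 0" using N1 by (simp add: g_def num_groups_def N_def)
  have cE: "real c = 16 * (real R')\<^sup>2 * g * N" by (simp add: defs core_size_def)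
  have R'0: "R' > 0" using R1 by simp
  have c0: "c > 0" using g0 N1 R'0 by (simp add: c_def core_size_def g_def N_def R'_def)
  have k0: "k > 0" by (simp add: k_def reject_limit_def)
  let ?C = "pair_pmf (replicate_pmf g (group_pmf ga ga' m)) (replicate_pmf (8 * k) (block_pmf r m))"
  let ?acc = "\<lambda>(hs, bs) G H. pair_accepts m r \<eta> \<tau> c k G H hs bs"
  let ?q = "(2 * (g * ga * m) + m + 8 * k * (r * r)) + 6 * e * (2 * ((g * ga') * (8 * k * (2 * r))) + 8 * k * (2 * r) + 8 * k * (r * r))"
  have "\<exists>T. doho_tester (m\<^sup>2) \<epsilon> (D_iso m) (Suc (6 * e)) ?q T"
  proof (rule ex_doho_tester[where C = ?C and acc = ?acc and err = "3 / N"])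
    show "finite (set_pmf ?C)" using m by simp
    show "real (6 * e) * (3 / N) \<le> 1 / 3" using E by (simp add: N) (simp add: E_def)
    show "(1 - \<epsilon> / 2) ^ (6 * e) \<le> 1 / 8" by (rule power_miss_le[OF \<epsilon>])
    show "\<exists>t. legal_queries (Suc (6 * e)) (m\<^sup>2) t \<and> num_queries t \<le> ?q \<and>
      (\<forall>X. accepts t X \<longleftrightarrow> (\<forall>i\<in>{1..<Suc (6 * e)}. ?acc \<omega> (gr m (X 0)) (gr m (X i))))"
      if "\<omega> \<in> set_pmf ?C" for \<omega>
      using that ex_tester_tree[OF m, of "fst \<omega>" g ga ga' "snd \<omega>" "8 * k" r "6 * e" r \<eta> \<tau> c k]
      by (simp add: case_prod_unfold mem_Times_iff)
  next
    fix G H :: "nat \<Rightarrow> nat \<Rightarrow> bool" and \<sigma> assume \<sigma>: "\<sigma> permutes {..<m}" and iso: "\<And>u v. \<lbrakk>u < m; v < m\<rbrakk> \<Longrightarrow> G u v = H (\<sigma> u) (\<sigma> v)"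
    have "prb ?C (\<lambda>(hs, bs). \<not> pair_accepts m r \<eta> \<tau> c k G H hs bs) \<le>
      (g * (real ga * real ga' / m) / c + (real m)\<^sup>2 / 2 ^ g) + 8 * (8 / (R * \<eta>\<^sup>2) + 2 * \<delta> / \<tau>)"
      by (rule pair_completeness[where G = G and H = H, OF m R1(1) r pos(1,2) \<sigma> iso c0 k0 pos(4) R1(2) Rd ga ggm])
    also have "\<dots> \<le> (1 / N + 1 / N) + 1 / N"
    proof (intro add_mono)
      have "g * (real ga * real ga' / m) / c = (real R')\<^sup>2 * g * (real a ^ 4 / m) / (16 * (real R')\<^sup>2 * g * N)"
        by (simp add: gg cE)
      also have "\<dots> = (real a ^ 4 / m) / 16 / N" using g0 R'0 by simp
      also have "\<dots> \<le> 1 / N" using a4(2) m by (intro divide_right_mono) (auto simp: divide_le_eq)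
      finally show "g * (real ga * real ga' / m) / c \<le> 1 / N" .
      have "(real m)\<^sup>2 / 2 ^ g \<le> (2 ^ L)\<^sup>2 / 2 ^ g"
        using of_nat_mono[OF L, where 'a = real] by (intro divide_right_mono power_mono) auto
      also have "\<dots> = 1 / 2 ^ N"
        by (simp add: g_def num_groups_def N_def power_add mult.commute[of 2] power_mult)
      also have "\<dots> \<le> 1 / N" using N1 of_nat_mono[OF less_imp_le[OF less_exp[of N]], where 'a = real]
        by (intro divide_left_mono) auto
      finally show "(real m)\<^sup>2 / 2 ^ g \<le> 1 / N" .
      have "8 / (R * \<eta>\<^sup>2) = 1 / 16 / N"
        using E N1 by (simp add: RE \<eta>_def power2_eq_square power4_eq_xxxx field_simps)
      moreover have "2 * \<delta> / \<tau> = 1 / 16 / N" using E N1 by (simp add: \<delta>_def \<tau>_def)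
      ultimately show "8 * (8 / (R * \<eta>\<^sup>2) + 2 * \<delta> / \<tau>) \<le> 1 / N" by simp
    qed
    finally show "prb ?C (\<lambda>\<omega>. \<not> ?acc \<omega> G H) \<le> 3 / N" by (simp add: case_prod_unfold)
  next
    fix G H :: "nat \<Rightarrow> nat \<Rightarrow> bool" assume far: "\<And>\<pi>. \<pi> permutes {..<m} \<Longrightarrow> real (mismatches m G H \<pi>) > \<epsilon> / 2 * (real m)\<^sup>2"
    have "prb ?C (\<lambda>(hs, bs). pair_accepts m r \<eta> \<tau> c k G H hs bs) \<le> (real m * real m + 1) ^ c / 4 ^ k"
    proof (rule pair_soundness[OF m R1(1) r pos(1) _ pos(2,3)])
      have "E\<^sup>2 \<ge> 1" using E by simp
      then show "\<eta> \<le> 1 / 2" by (simp add: \<eta>_def divide_le_eq)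
      show "t \<le> 1" using E by (simp add: t_def)
      have "8 * \<tau> + 2 * (t + 2 * \<eta> / t) = 1 / E / 2"
        using E by (simp add: \<tau>_def t_def \<eta>_def power2_eq_square field_simps)
      also have "\<dots> \<le> \<epsilon> / 2" using \<epsilon> E by (simp add: E_def field_simps)
      finally have "(8 * \<tau> + 2 * (t + 2 * \<eta> / t)) * (real m)\<^sup>2 \<le> \<epsilon> / 2 * (real m)\<^sup>2" by (rule mult_right_mono) simp
      then show "real (mismatches m G H \<pi>) > (8 * \<tau> + 2 * (t + 2 * \<eta> / t)) * (real m)\<^sup>2" if "\<pi> permutes {..<m}" for \<pi>
        using far[OF that] by linarith
      have NE: "N * E ^ 4 \<ge> 1" "N * E\<^sup>2 \<ge> 1"
        using N1 E mult_mono[of 1 "real N" 1 "E ^ 4"] mult_mono[of 1 "real N" 1 "E\<^sup>2"] by simp_all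
      have "72 / (R * \<eta>\<^sup>2) = 9 / 16 / N"
        using E N1 by (simp add: RE \<eta>_def power2_eq_square power4_eq_xxxx field_simps)
      also have "\<dots> \<le> 1 / 2" using N E by (simp add: field_simps)
      finally show "72 / (R * \<eta>\<^sup>2) \<le> 1 / 2" .
      have "16400 / (R * (4 * \<tau>)\<^sup>2) = 1049600 / 2 ^ 25 / (N * E\<^sup>2)"
        using E N1 by (simp add: RE \<tau>_def power2_eq_square power4_eq_xxxx field_simps)
      also have "\<dots> \<le> 1049600 / 2 ^ 25 / 1" using NE(2) N1 by (intro divide_left_mono) auto
      also have "\<dots> \<le> 7 / 16" by simp
      finally show "16400 / (R * (4 * \<tau>)\<^sup>2) \<le> 7 / 16" .
    qed
    also have "\<dots> \<le> (2 ^ (2 * L + 1)) ^ c / 4 ^ k"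
    proof (intro divide_right_mono power_mono)
      have "real m \<le> 2 ^ L" using of_nat_mono[OF L, where 'a = real] by simp
      then show "real m * real m + 1 \<le> 2 ^ (2 * L + 1)" by (rule square_plus_one_le) simp
    qed auto
    also have "\<dots> \<le> (2 ^ (2 * L + 1)) ^ c / 2 ^ k"
      by (intro divide_left_mono power_mono) auto
    also have "(2 :: real) ^ k = (2 ^ (2 * L + 1)) ^ c * 8"
      unfolding k_def reject_limit_def c_def power_add power_mult by simp
    also have "(2 ^ (2 * L + 1)) ^ c / ((2 ^ (2 * L + 1)) ^ c * 8) = (1 / 8 :: real)" by simp
    finally show "prb ?C (\<lambda>\<omega>. ?acc \<omega> G H) \<le> 1 / 8" by (simp add: case_prod_unfold)
  qed (use m \<epsilon> in auto)
  \<comment> \<open>Labelling the first graph costs about \<open>a * a ^ 4\<close> queries and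
    labelling the samples of another about \<open>a ^ 3 * a ^ 2\<close>; the other terms are of
    order at most \<open>a ^ 4\<close>.\<close>
  moreover have "?q \<le> a ^ 5 * query_factor e L"
  proof -
    have le5: "m * x * a \<le> a ^ 5 * x" "m \<le> a ^ 5" "a ^ 4 * x \<le> a ^ 5 * x" "a\<^sup>2 * x \<le> a ^ 5 * x" for x
    proof -
      have "m * x * a \<le> a ^ 4 * x * a" using a(1) by (intro mult_right_mono) auto
      then show "m * x * a \<le> a ^ 5 * x" using power_add[of a 4 1] by (simp add: mult_ac)
      show "m \<le> a ^ 5" using a(1) a1 power_increasing[of 4 5 a] by simp
      show "a ^ 4 * x \<le> a ^ 5 * x" "a\<^sup>2 * x \<le> a ^ 5 * x" using a1 by (auto intro!: mult_right_mono power_increasing)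
    qed
    have 1: "2 * (g * ga * m) \<le> a ^ 5 * (2 * (g * R'))"
      using le5(1)[of "2 * (g * R')"] by (simp add: ga_def mult_ac)
    have 2: "8 * k * (r * r) \<le> a ^ 5 * (8 * k * R\<^sup>2)"
      using le5(3)[of "8 * k * R\<^sup>2"] by (simp add: r_def power2_eq_square power4_eq_xxxx mult_ac)
    have 3: "8 * k * (2 * r) \<le> a ^ 5 * (16 * (k * R))"
      using le5(4)[of "16 * (k * R)"] by (simp add: r_def mult_ac)
    have 4: "2 * ((g * ga') * (8 * k * (2 * r))) = a ^ 5 * (32 * (g * R' * k * R))"
      unfolding ga'_def r_def using power_add[of a 3 2] by (simp add: mult_ac)
    have "?q \<le> (a ^ 5 * (2 * (g * R')) + a ^ 5 * 1 + a ^ 5 * (8 * k * R\<^sup>2)) +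
      6 * e * (a ^ 5 * (32 * (g * R' * k * R)) + a ^ 5 * (16 * (k * R)) + a ^ 5 * (8 * k * R\<^sup>2))"
      using 1 2 3 4 le5(2) by (intro add_mono mult_left_mono) auto
    also have "\<dots> = a ^ 5 * query_factor e L"
      by (simp add: query_factor_def defs algebra_simps)
    finally show ?thesis .
  qed
  ultimately show ?thesis unfolding doho_tester_def by (meson order.trans)
qed

section \<open>Growth of the query bound\<close>

definition polynomially_bounded :: "(nat \<Rightarrow> nat \<Rightarrow> nat) \<Rightarrow> bool" where
  "polynomially_bounded f \<longleftrightarrow> (\<exists>C J K. \<forall>e\<ge>1. \<forall>L\<ge>1. f e L \<le> C * e ^ J * L ^ K)"

lemma polynomially_bounded_const: "polynomially_bounded (\<lambda>_ _. c)"
  unfolding polynomially_bounded_def by (intro exI[of _ c] exI[of _ 0]) simp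

lemma polynomially_bounded_fst: "polynomially_bounded (\<lambda>e _. e)"
  unfolding polynomially_bounded_def by (intro exI[of _ 1] exI[of _ 0]) (auto intro!: exI[of _ 1] exI[of _ 0])

lemma polynomially_bounded_snd: "polynomially_bounded (\<lambda>_ L. L)"
  unfolding polynomially_bounded_def by (rule exI[of _ 1], rule exI[of _ 0], rule exI[of _ 1]) simp

text \<open>As \<open>e\<close> and \<open>L\<close> are at least 1, adding exponents can replace
  taking their maximum.\<close>

lemma polynomially_bounded_add:
  assumes "polynomially_bounded f" "polynomially_bounded h"
  shows "polynomially_bounded (\<lambda>e L. f e L + h e L)"
proof -
  obtain C J K C' J' K' where f: "\<And>e L. \<lbrakk>e \<ge> 1; L \<ge> 1\<rbrakk> \<Longrightarrow> f e L \<le> C * e ^ J * L ^ K"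
    and h: "\<And>e L. \<lbrakk>e \<ge> 1; L \<ge> 1\<rbrakk> \<Longrightarrow> h e L \<le> C' * e ^ J' * L ^ K'"
    using assms unfolding polynomially_bounded_def by blast
  have "f e L + h e L \<le> (C + C') * e ^ (J + J') * L ^ (K + K')" if eL: "e \<ge> 1" "L \<ge> 1" for e L
  proof -
    have "f e L + h e L \<le> C * e ^ J * L ^ K + C' * e ^ J' * L ^ K'" by (intro add_mono f h eL)
    also have "\<dots> \<le> C * e ^ (J + J') * L ^ (K + K') + C' * e ^ (J + J') * L ^ (K + K')"
      using eL by (intro add_mono mult_mono power_increasing) auto
    finally show ?thesis by (simp add: algebra_simps)
  qed
  then show ?thesis unfolding polynomially_bounded_def by blast
qed

lemma polynomially_bounded_mult:
  assumes "polynomially_bounded f" "polynomially_bounded h"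
  shows "polynomially_bounded (\<lambda>e L. f e L * h e L)"
proof -
  obtain C J K C' J' K' where f: "\<And>e L. \<lbrakk>e \<ge> 1; L \<ge> 1\<rbrakk> \<Longrightarrow> f e L \<le> C * e ^ J * L ^ K"
    and h: "\<And>e L. \<lbrakk>e \<ge> 1; L \<ge> 1\<rbrakk> \<Longrightarrow> h e L \<le> C' * e ^ J' * L ^ K'"
    using assms unfolding polynomially_bounded_def by blast
  have "f e L * h e L \<le> (C * C') * e ^ (J + J') * L ^ (K + K')" if eL: "e \<ge> 1" "L \<ge> 1" for e L
  proof -
    have "f e L * h e L \<le> (C * e ^ J * L ^ K) * (C' * e ^ J' * L ^ K')" by (intro mult_mono f h eL) auto
    then show ?thesis by (simp add: power_add mult_ac)
  qed
  then show ?thesis unfolding polynomially_bounded_def by blast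
qed

lemma polynomially_bounded_power:
  "polynomially_bounded f \<Longrightarrow> polynomially_bounded (\<lambda>e L. f e L ^ n)"
  by (induction n) (auto intro: polynomially_bounded_const polynomially_bounded_mult)

lemma polynomially_bounded_query_factor: "polynomially_bounded query_factor"
proof -
  have eq: "query_factor = (\<lambda>e L. query_factor e L)" by simp
  show ?thesis
    by (subst eq, unfold query_factor_def reject_limit_def core_size_def num_groups_def block_rate_def core_rate_def inv_err_def)
      (intro polynomially_bounded_add polynomially_bounded_mult polynomially_bounded_power polynomially_bounded_const
        polynomially_bounded_fst polynomially_bounded_snd)
qed

text \<open>For \<open>n = m\<^sup>2\<close> this is \<open>m powr (1 / 4)\<close> rounded up.\<close>
definition eighth_root :: "nat \<Rightarrow> nat" where "eighth_root n = nat \<lceil>real n powr (1 / 8)\<rceil>"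

text \<open>The \<open>+ 1\<close> keeps the value positive at \<open>n = 1\<close>, since
  \<open>polynomially_bounded\<close> speaks about \<open>L \<ge> 1\<close> only.\<close>

definition log_bound :: "nat \<Rightarrow> nat" where "log_bound n = nat \<lceil>log 2 n\<rceil> + 1"

lemma eighth_root_bounds:
  assumes "n \<ge> 1"
  shows "real n powr (1 / 8) \<le> eighth_root n" "eighth_root n \<le> 2 * real n powr (1 / 8)"
proof -
  have "1 \<le> real n powr (1 / 8)" using assms by (intro ge_one_powr_ge_zero) auto
  then show "real n powr (1 / 8) \<le> eighth_root n" "eighth_root n \<le> 2 * real n powr (1 / 8)"
    unfolding eighth_root_def by linarith+
qed

lemma eighth_root_square:
  assumes "m > 0"
  shows "m \<le> eighth_root (m\<^sup>2) ^ 4" "eighth_root (m\<^sup>2) ^ 4 \<le> 16 * m"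
proof -
  have "(real (m\<^sup>2) powr (1 / 8)) ^ 4 = real m"
    using assms by (simp add: powr_power powr_half_sqrt)
  moreover have n1: "m\<^sup>2 \<ge> 1" using assms by simp
  ultimately have "real m \<le> real (eighth_root (m\<^sup>2)) ^ 4" "real (eighth_root (m\<^sup>2)) ^ 4 \<le> (2 * real (m\<^sup>2) powr (1 / 8)) ^ 4"
    using power_mono[OF eighth_root_bounds(1)[OF n1], of 4] power_mono[OF eighth_root_bounds(2)[OF n1], of 4] by simp_all
  then have "real m \<le> real (eighth_root (m\<^sup>2) ^ 4)" "real (eighth_root (m\<^sup>2) ^ 4) \<le> real (16 * m)"
    using \<open>(real (m\<^sup>2) powr (1 / 8)) ^ 4 = real m\<close> by (simp_all add: power_mult_distrib)
  then show "m \<le> eighth_root (m\<^sup>2) ^ 4" "eighth_root (m\<^sup>2) ^ 4 \<le> 16 * m" by (simp_all only: of_nat_le_iff)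
qed

lemma le_two_power_log_bound:
  assumes "m > 0"
  shows "m \<le> 2 ^ log_bound (m\<^sup>2)"
proof -
  have "log 2 m \<le> log 2 (m\<^sup>2)" using assms by (simp add: power2_eq_square)
  also have "\<dots> \<le> log_bound (m\<^sup>2)" unfolding log_bound_def by linarith
  finally have "real m \<le> 2 powr real (log_bound (m\<^sup>2))" using assms by (simp add: log_le_iff)
  then have "real m \<le> real (2 ^ log_bound (m\<^sup>2))" by (simp add: powr_realpow)
  then show ?thesis by (simp only: of_nat_le_iff)
qed

lemma query_bound_soft_bigo:
  "(\<lambda>n. c * real (eighth_root n) ^ 5 * real (log_bound n) ^ K) \<in> soft_bigo (\<lambda>n. real n powr (5 / 8))"
proof -
  have "(\<lambda>n. c * real (eighth_root n) ^ 5 * real (log_bound n) ^ K) \<in>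
      O(\<lambda>n. real n powr (5 / 8) * ln (real n powr (5 / 8)) ^ K)"
  \<comment> \<open>The 32 is \<open>2 ^ 5\<close>, from rounding up the eighth root. The 7 comes
    from \<open>log_bound n \<le> 4 * ln n\<close> together with
    \<open>4 \<le> 7 * 5 / 8\<close>.\<close>
  proof (rule bigoI[where c = "\<bar>c\<bar> * 32 * 7 ^ K"])
    show "eventually (\<lambda>n. norm (c * real (eighth_root n) ^ 5 * real (log_bound n) ^ K) \<le>
      \<bar>c\<bar> * 32 * 7 ^ K * norm (real n powr (5 / 8) * ln (real n powr (5 / 8)) ^ K)) sequentially"
      using eventually_ge_at_top[of 3]
    proof eventually_elim
      case (elim n)
      have "real (eighth_root n) ^ 5 \<le> (2 * real n powr (1 / 8)) ^ 5"
        using elim by (intro power_mono eighth_root_bounds) auto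
      also have "\<dots> = 32 * real n powr (5 / 8)"
        using elim by (simp add: power_mult_distrib powr_powr flip: powr_realpow)
      finally have A: "real (eighth_root n) ^ 5 \<le> 32 * real n powr (5 / 8)" .
      have "exp 1 \<le> (3 :: real)" by (rule exp_le)
      also have "\<dots> \<le> real n" using elim by simp
      finally have l1: "ln (real n) \<ge> 1" using elim by (subst ln_ge_iff) auto
      have "log_bound n \<le> log 2 n + 2" using elim unfolding log_bound_def by (simp add: zero_le_log_cancel_iff) linarith
      also have "log 2 n \<le> 2 * ln (real n)"
      proof -
        have "1 / 2 \<le> ln (2 :: real)" using ln2_ge_two_thirds by simp
        then show ?thesis using l1 by (simp add: log_def field_simps)
      qed
      finally have "real (log_bound n) \<le> 4 * ln (real n)" using l1 by simp
      also have "\<dots> \<le> 7 * ln (real n powr (5 / 8))" using l1 elim by (simp add: ln_powr)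
      finally have B: "real (log_bound n) ^ K \<le> (7 * ln (real n powr (5 / 8))) ^ K" by (intro power_mono) auto
      have l0: "0 \<le> ln (real n powr (5 / 8))" using l1 elim by (simp add: ln_powr)
      have "norm (c * real (eighth_root n) ^ 5 * real (log_bound n) ^ K) =
        \<bar>c\<bar> * (real (eighth_root n) ^ 5 * real (log_bound n) ^ K)" by (simp add: abs_mult)
      also have "\<dots> \<le> \<bar>c\<bar> * ((32 * real n powr (5 / 8)) * (7 * ln (real n powr (5 / 8))) ^ K)"
        by (intro mult_left_mono mult_mono A B) auto
      also have "\<dots> = \<bar>c\<bar> * 32 * 7 ^ K * norm (real n powr (5 / 8) * ln (real n powr (5 / 8)) ^ K)"
      proof -
        have "norm (real n powr (5 / 8) * ln (real n powr (5 / 8)) ^ K) = real n powr (5 / 8) * ln (real n powr (5 / 8)) ^ K"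
          unfolding real_norm_def using l0 by (intro abs_of_nonneg mult_nonneg_nonneg zero_le_power) auto
        then show ?thesis by (simp only: power_mult_distrib mult_ac)
      qed
      finally show ?case .
    qed
  qed
  then show ?thesis unfolding soft_bigo_def by blast
qed

lemma trivial_tester:
  assumes "m > 0" "\<epsilon> \<ge> 1"
  shows "doho_tester (m\<^sup>2) \<epsilon> (D_iso m) 0 0 (return_pmf (Verdict True))"
proof -
  have "measure_pmf.prob (execution (return_pmf (Verdict True)) 0 P) {(t, X). accepts t X} = 1" for P
  proof -
    have "{(t, X). accepts t X} \<inter> set_pmf (execution (return_pmf (Verdict True)) 0 P) = set_pmf (execution (return_pmf (Verdict True)) 0 P)"
      by (auto simp: execution_def)
    then show ?thesis by (metis measure_Int_set_pmf measure_pmf.prob_space measure_pmf_UNIV inf_top.left_neutral)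
  qed
  then show ?thesis using not_far_from_D_iso[OF assms(1) _ assms(2)] by (auto simp: doho_tester_def)
qed

theorem theorem4p6:
  shows "\<exists>(T :: nat \<Rightarrow> real \<Rightarrow> query_tree pmf) (s :: nat \<Rightarrow> real \<Rightarrow> nat) (q :: nat \<Rightarrow> real \<Rightarrow> nat)
           (C :: real) (p :: real poly) (g :: nat \<Rightarrow> real).
      g \<in> soft_bigo (\<lambda>n. real n powr (5 / 8)) \<and>
      (\<forall>(m :: nat) (n :: nat) (\<epsilon> :: real). m > 0 \<longrightarrow> n = m\<^sup>2 \<longrightarrow> \<epsilon> > 0 \<longrightarrow>
         doho_tester n \<epsilon> (D_iso m) (s n \<epsilon>) (q n \<epsilon>) (T n \<epsilon>) \<and>
         real (s n \<epsilon>) \<le> C * (1 / \<epsilon>) \<and>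
         real (q n \<epsilon>) \<le> poly p (1 / \<epsilon>) * g n)"
proof -
  define e where "e \<epsilon> = nat \<lceil>1 / \<epsilon>\<rceil>" for \<epsilon> :: real
  \<comment> \<open>For \<open>\<epsilon> \<ge> 1\<close> no sample may be drawn, because
    \<open>C * (1 / \<epsilon>)\<close> falls below 1 for large \<open>\<epsilon>\<close>; the
    constant verdict of \<open>trivial_tester\<close> is used there.\<close>
  define s where "s n \<epsilon> = (if \<epsilon> < 1 then Suc (6 * e \<epsilon>) else 0)" for n :: nat and \<epsilon> :: real
  define q where "q n \<epsilon> = (if \<epsilon> < 1 then eighth_root n ^ 5 * query_factor (e \<epsilon>) (log_bound n) else 0)" for n \<epsilon>
  obtain D J K where D: "\<And>e L. \<lbrakk>e \<ge> 1; L \<ge> 1\<rbrakk> \<Longrightarrow> query_factor e L \<le> D * e ^ J * L ^ K"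
    using polynomially_bounded_query_factor unfolding polynomially_bounded_def by blast
  \<comment> \<open>The factor \<open>2 ^ J\<close> absorbs the rounding
    \<open>e \<epsilon> \<le> 2 / \<epsilon>\<close>, so that the polynomial can be a plain
    monomial.\<close>
  define g where "g n = (real D * 2 ^ J) * real (eighth_root n) ^ 5 * real (log_bound n) ^ K" for n
  have e: "1 / \<epsilon> \<le> real (e \<epsilon>)" "real (e \<epsilon>) \<le> 2 * (1 / \<epsilon>)" "1 \<le> e \<epsilon>" if "0 < \<epsilon>" "\<epsilon> < 1" for \<epsilon>
  proof -
    have "1 / \<epsilon> > 1" using that by simp
    then show "1 / \<epsilon> \<le> real (e \<epsilon>)" "real (e \<epsilon>) \<le> 2 * (1 / \<epsilon>)" "1 \<le> e \<epsilon>" unfolding e_def by linarith+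
  qed
  \<comment> \<open>The tester has to be a function of \<open>n\<close> and
    \<open>\<epsilon>\<close> alone; this is possible because \<open>n\<close> determines
    \<open>m\<close>.\<close>
  have "\<exists>T. \<forall>m>0. n = m\<^sup>2 \<longrightarrow> \<epsilon> > 0 \<longrightarrow> doho_tester n \<epsilon> (D_iso m) (s n \<epsilon>) (q n \<epsilon>) T" for n \<epsilon>
  proof (cases "\<exists>m>0. n = m\<^sup>2 \<and> \<epsilon> > 0")
    case True
    then obtain m where m: "m > 0" "n = m\<^sup>2" and \<epsilon>: "\<epsilon> > 0" by blast
    have "\<exists>T. doho_tester n \<epsilon> (D_iso m) (s n \<epsilon>) (q n \<epsilon>) T"
    proof (cases "\<epsilon> < 1")
      case True
      then show ?thesis
        using ex_tester_with_params[OF m(1) \<epsilon> True e(1)[OF \<epsilon> True] eighth_root_square[OF m(1)] le_two_power_log_bound[OF m(1)]]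
        by (simp add: s_def q_def m(2))
    next
      case False
      then show ?thesis using trivial_tester[OF m(1), of \<epsilon>] by (auto simp: s_def q_def m(2))
    qed
    then obtain T where T: "doho_tester n \<epsilon> (D_iso m) (s n \<epsilon>) (q n \<epsilon>) T" by blast
    have "m' = m" if "n = m'\<^sup>2" for m' :: nat using that m(2) by simp
    then show ?thesis using T by blast
  qed blast
  then obtain T where T: "\<And>n \<epsilon> m. \<lbrakk>m > 0; n = m\<^sup>2; \<epsilon> > 0\<rbrakk> \<Longrightarrow> doho_tester n \<epsilon> (D_iso m) (s n \<epsilon>) (q n \<epsilon>) (T n \<epsilon>)"
    by metis
  \<comment> \<open>Twelve from \<open>6 * e \<epsilon>\<close>, and one for the reference sample,
    as \<open>1 \<le> 1 / \<epsilon>\<close>.\<close>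
  have s: "real (s n \<epsilon>) \<le> 13 * (1 / \<epsilon>)" if "\<epsilon> > 0" for n \<epsilon>
  proof (cases "\<epsilon> < 1")
    case True
    then have "1 \<le> 1 / \<epsilon>" using that by simp
    then show ?thesis using e(2)[OF that True] True by (simp add: s_def)
  qed (use that in \<open>simp add: s_def\<close>)
  have q: "real (q n \<epsilon>) \<le> poly (monom 1 J) (1 / \<epsilon>) * g n" if "\<epsilon> > 0" for n \<epsilon>
  proof (cases "\<epsilon> < 1")
    case True
    have "query_factor (e \<epsilon>) (log_bound n) \<le> D * e \<epsilon> ^ J * log_bound n ^ K"
      using e(3)[OF that True] by (intro D) (auto simp: log_bound_def)
    then have "real (query_factor (e \<epsilon>) (log_bound n)) \<le> real (D * e \<epsilon> ^ J * log_bound n ^ K)" by (rule of_nat_mono)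
    also have "\<dots> = D * real (e \<epsilon>) ^ J * real (log_bound n) ^ K" by simp
    also have "\<dots> \<le> D * (2 * (1 / \<epsilon>)) ^ J * real (log_bound n) ^ K"
      by (intro mult_left_mono mult_right_mono power_mono e that True) auto
    finally have "real (eighth_root n) ^ 5 * real (query_factor (e \<epsilon>) (log_bound n)) \<le>
      real (eighth_root n) ^ 5 * (D * (2 * (1 / \<epsilon>)) ^ J * real (log_bound n) ^ K)"
      by (intro mult_left_mono) auto
    also have "\<dots> = (1 / \<epsilon>) ^ J * g n" by (simp only: g_def power_mult_distrib mult_ac)
    finally show ?thesis using True by (simp add: q_def poly_monom)
  next
    case False
    have "0 \<le> g n" by (simp add: g_def)
    then show ?thesis using False that by (simp add: q_def poly_monom)
  qed
  have "g \<in> soft_bigo (\<lambda>n. real n powr (5 / 8))"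
    unfolding g_def by (rule query_bound_soft_bigo)
  moreover have "\<forall>m n \<epsilon>. m > 0 \<longrightarrow> n = m\<^sup>2 \<longrightarrow> \<epsilon> > 0 \<longrightarrow>
      doho_tester n \<epsilon> (D_iso m) (s n \<epsilon>) (q n \<epsilon>) (T n \<epsilon>) \<and>
      real (s n \<epsilon>) \<le> 13 * (1 / \<epsilon>) \<and> real (q n \<epsilon>) \<le> poly (monom 1 J) (1 / \<epsilon>) * g n"
    by (intro allI impI conjI T s q)
  ultimately show ?thesis
    by (intro exI[of _ T] exI[of _ s] exI[of _ q] exI[of _ 13] exI[of _ "monom 1 J"] exI[of _ g] conjI)
qed

end
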